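(* Let $k\ge 0$ be an integer and let $p,q,n\ge1$. Write $\mathbf x=(x_1,\dots,x_p)$, $\mathbf y=(y_1,\dots,y_q)$ in Type I, and $\mathbf x=(x_1,\dots,x_n)$ in Types II and III. The following identities hold. Type I: $$\prod_{\substack{1\le i\le p\\1\le j\le q}}(1-x_iy_j)\sum_{\nu\in\mathrm{Par}(\min\{p,q\}\times k)}s_\nu(\mathbf x)s_\nu(\mathbf y)=\sum_{(\alpha\mid\beta)\in\mathrm{Par}(p\times q)}(-1)^{|\pi_x|-k\,\mathrm{rk}\,\pi_x}\,s_{\pi_x}(\mathbf x)\,s_{\pi_y}(\mathbf y),$$ where $\pi_x=(\alpha+k\mid\beta)$ and $\pi_y=(\beta+k\mid\alpha)$ (note $|\pi_x|=|\pi_y|$ and $\mathrm{rk}\,\pi_x=\mathrm{rk}\,\pi_y$). Type II: $$\prod_{1\le i\le j\le n}(1-x_ix_j)\sum_{\substack{\nu\in\mathrm{Par}(n\times 2k)\\ \text{all row lengths even}}}s_\nu(\mathbf x)=\sum_{\substack{\pi=(\alpha+2k+1\mid\alpha)\\ \alpha_1<n}}(-1)^{(|\pi|-2k\,\mathrm{rk}\,\pi)/2}s_\pi(\mathbf x).$$ Type IIIa: $$\prod_{1\le i<j\le n}(1-x_ix_j)\sum_{\substack{\nu\in\mathrm{Par}(n\times k)\\ \text{all column lengths even}}}s_\nu(\mathbf x)=\sum_{\substack{\pi=(\alpha+k-1\mid\alpha)\\ \alpha_1<n,\ \mathrm{rk}\,\pi\text{ even}}}(-1)^{(|\pi|-k\,\mathrm{rk}\,\pi)/2}s_\pi(\mathbf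 x).$$ Type IIIb: $$\prod_{1\le i<j\le n}(1-x_ix_j)\sum_{\substack{\nu\in\mathrm{Par}(n\times k)\\ \text{all }k\text{ column lengths odd}}}s_\nu(\mathbf x)=\sum_{\substack{\pi=(\alpha+k-1\mid\alpha)\\ \alpha_1<n,\ \mathrm{rk}\,\pi\text{ odd}}}(-1)^{(|\pi|-k\,\mathrm{rk}\,\pi)/2}s_\pi(\mathbf x).$$ (For $k=0$ in Types IIIa and IIIb, the parity condition on the rank is dropped, so that these two identities become the same identity, with $\pi$ ranging over all partitions of the form $(\alpha-1\mid\alpha)$ with $\alpha_1<n$.) Moreover: (i) For $k=0$, the identities reduce to the classical identities: Type I becomes (after substituting $x_i\mapsto -x_i$) the dual Cauchy identity $\prod_{i,j}(1+x_iy_j)=\sum_{\pi\in\mathrm{Par}(p\times q)}s_\pi(\mathbf x)s_{\pi'}(\mathbf y)$; Type II becomes $\prod_{i\le j}(1-x_ix_j)=\sum_\pi(-1)^{|\pi|/2}s_\pi(\mathbf x)$, the sum over partitions $\pi=(\alpha+1\mid\alpha)$ with at most $n$ parts; Type III becomes $\prod_{i<j}(1-x_ix_j)=\sum_\pi(-1)^{|\pi|/2}s_\pi(\mathbf x)$, the sum over partitions $\pi$ with at most $n$ parts whose conjugate $\pi'$ has the form $(\alpha+1\mid\alpha)$. (ii) For $k=1$, the sum of the Type IIIa and Type IIIb identities reduces (after substituting $x_i\mapsto-x_i$) to the Littlewood identity $\prod_{i}(1-x_i)\prod_{i<j}(1-x_ix_j)=\sum_{\pi=\pi'}(-1)^{(|\pi|+\mathrm{rk}\,\pi)/2}s_\pi(\mathbf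 x)$, the sum over self-conjugate partitions with at most $n$ parts.
   Context: Frobenius notation: for a partition $\pi$ let $r=\mathrm{rk}\,\pi$ be the length of the main diagonal of its Young diagram. Write $\pi=(\alpha\mid\beta)=(\alpha_1,\dots,\alpha_r\mid\beta_1,\dots,\beta_r)$, where $\alpha_i$ is the number of boxes in row $i$ strictly right of the diagonal and $\beta_i$ the number of boxes in column $i$ strictly below the diagonal. So $\alpha_1>\cdots>\alpha_r\ge0$ and $\beta_1>\cdots>\beta_r\ge0$; the zero partition has $r=0$ (and then conditions such as $\alpha_1<n$ are vacuous). For an integer $m$, $\alpha+m=(\alpha_1+m,\dots,\alpha_r+m)$, and the Frobenius symbol is required to have nonnegative entries. $|\pi|$ is the number of boxes of $\pi$, $\pi'$ its conjugate, $s_\pi$ the Schur polynomial. $\mathrm{Par}(a\times b)$ is the set of partitions whose Young diagram fits in $a$ rows and $b$ columns. "All $k$ column lengths odd" for $\nu\in\mathrm{Par}(n\times k)$ means that each of the columns $1,\dots,k$ has odd (in particular nonzero) length; for $k=0$ only the zero partition occurs and the condition is vacuous. *)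

theory Defs
  imports "HOL-Library.FuncSet"
begin

text \<open>
  Partitions are lists of their (positive, weakly decreasing) parts, so the zero partition is
  \<^term>\<open>[]\<close>. Boxes, rows, columns and variables are all indexed from 0.
\<close>

definition is_partition :: "nat list \<Rightarrow> bool" where
  "is_partition \<pi> \<longleftrightarrow> sorted_wrt (\<ge>) \<pi> \<and> 0 \<notin> set \<pi>"

definition diagram :: "nat list \<Rightarrow> (nat \<times> nat) set" where
  "diagram \<pi> = {(i, j). i < length \<pi> \<and> j < \<pi> ! i}"

definition boxes :: "nat list \<Rightarrow> nat" where
  "boxes \<pi> = card (diagram \<pi>)"

definition row_len :: "nat list \<Rightarrow> nat \<Rightarrow> nat" where
  "row_len \<pi> i = card {j. (i, j) \<in> diagram \<pi>}"

definition col_len :: "nat list \<Rightarrow> nat \<Rightarrow> nat" where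
  "col_len \<pi> j = card {i. (i, j) \<in> diagram \<pi>}"

definition conjugate :: "nat list \<Rightarrow> nat list" where
  "conjugate \<pi> = map (col_len \<pi>) [0..<row_len \<pi> 0]"

definition Par :: "nat \<Rightarrow> nat \<Rightarrow> nat list set" where
  "Par a b = {\<pi>. is_partition \<pi> \<and> diagram \<pi> \<subseteq> {..<a} \<times> {..<b}}"

definition rk :: "nat list \<Rightarrow> nat" where
  "rk \<pi> = card {i. (i, i) \<in> diagram \<pi>}"

text \<open>
  The two halves of the Frobenius symbol. They are integer lists so that a symbol may be shifted
  by a negative number; entries coming from a partition are nonnegative, so a shifted symbol with
  a negative entry is the symbol of no partition.
\<close>

definition arms :: "nat list \<Rightarrow> int list" where
  "arms \<pi> = map (\<lambda>i. int (card {j. i < j \<and> (i, j) \<in> diagram \<pi>})) [0..<rk \<pi>]"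

definition legs :: "nat list \<Rightarrow> int list" where
  "legs \<pi> = map (\<lambda>i. int (card {j. i < j \<and> (j, i) \<in> diagram \<pi>})) [0..<rk \<pi>]"

definition is_frobenius :: "nat list \<Rightarrow> int list \<Rightarrow> int list \<Rightarrow> bool" where
  "is_frobenius \<pi> \<alpha> \<beta> \<longleftrightarrow> is_partition \<pi> \<and> arms \<pi> = \<alpha> \<and> legs \<pi> = \<beta>"

text \<open>
  A partition is determined by its Frobenius symbol, and any two strictly decreasing lists of
  nonnegative integers of the same length form the symbol of a partition.
\<close>

definition frobenius :: "int list \<Rightarrow> int list \<Rightarrow> nat list" where
  "frobenius \<alpha> \<beta> = (THE \<pi>. is_frobenius \<pi> \<alpha> \<beta>)"

definition shift :: "int list \<Rightarrow> int \<Rightarrow> int list" where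
  "shift \<alpha> m = map (\<lambda>a. a + m) \<alpha>"

definition ssyt :: "nat \<Rightarrow> nat list \<Rightarrow> (nat \<times> nat \<Rightarrow> nat) set" where
  "ssyt n \<pi> = {T \<in> diagram \<pi> \<rightarrow>\<^sub>E {..<n}.
     (\<forall>i j. (i, j) \<in> diagram \<pi> \<and> (i, Suc j) \<in> diagram \<pi> \<longrightarrow> T (i, j) \<le> T (i, Suc j)) \<and>
     (\<forall>i j. (i, j) \<in> diagram \<pi> \<and> (Suc i, j) \<in> diagram \<pi> \<longrightarrow> T (i, j) < T (Suc i, j))}"

text \<open>
  The Schur polynomial in \<open>n\<close> variables, evaluated at \<open>x 0, \<dots>, x (n - 1)\<close> in an arbitrary commutative
  ring. Taking the ring to be a polynomial ring and \<open>x\<close> its indeterminates gives the polynomial itself.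
\<close>

definition schur :: "nat \<Rightarrow> nat list \<Rightarrow> (nat \<Rightarrow> 'a::comm_ring_1) \<Rightarrow> 'a" where
  "schur n \<pi> x = (\<Sum>T\<in>ssyt n \<pi>. \<Prod>c\<in>diagram \<pi>. x (T c))"

text \<open>
  In all the exponents of \<open>-1\<close> below, the subtraction on \<^typ>\<open>nat\<close> does not truncate and the division
  by 2 is exact: for \<open>\<pi> = (\<alpha> + m | \<beta>)\<close> the number of boxes is the sum of all entries of \<open>\<alpha>\<close> and \<open>\<beta>\<close>
  plus \<open>(m + 1) * rk \<pi>\<close>.
\<close>

definition pi_x :: "nat \<Rightarrow> nat list \<Rightarrow> nat list" where
  "pi_x k \<mu> = frobenius (shift (arms \<mu>) (int k)) (legs \<mu>)"

definition pi_y :: "nat \<Rightarrow> nat list \<Rightarrow> nat list" where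
  "pi_y k \<mu> = frobenius (shift (legs \<mu>) (int k)) (arms \<mu>)"

definition typeI_lhs ::
  "nat \<Rightarrow> nat \<Rightarrow> nat \<Rightarrow> (nat \<Rightarrow> 'a::comm_ring_1) \<Rightarrow> (nat \<Rightarrow> 'a) \<Rightarrow> 'a" where
  "typeI_lhs p q k x y =
     (\<Prod>(i, j)\<in>{..<p} \<times> {..<q}. 1 - x i * y j) *
     (\<Sum>\<nu>\<in>Par (min p q) k. schur p \<nu> x * schur q \<nu> y)"

definition typeI_rhs ::
  "nat \<Rightarrow> nat \<Rightarrow> nat \<Rightarrow> (nat \<Rightarrow> 'a::comm_ring_1) \<Rightarrow> (nat \<Rightarrow> 'a) \<Rightarrow> 'a" where
  "typeI_rhs p q k x y =
     (\<Sum>\<mu>\<in>Par p q. (- 1) ^ (boxes (pi_x k \<mu>) - k * rk (pi_x k \<mu>)) *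
        schur p (pi_x k \<mu>) x * schur q (pi_y k \<mu>) y)"

definition prod_le :: "nat \<Rightarrow> (nat \<Rightarrow> 'a::comm_ring_1) \<Rightarrow> 'a" where
  "prod_le n x = (\<Prod>(i, j)\<in>{(i, j). i \<le> j \<and> j < n}. 1 - x i * x j)"

definition prod_less :: "nat \<Rightarrow> (nat \<Rightarrow> 'a::comm_ring_1) \<Rightarrow> 'a" where
  "prod_less n x = (\<Prod>(i, j)\<in>{(i, j). i < j \<and> j < n}. 1 - x i * x j)"

definition shifted_frobs :: "int \<Rightarrow> nat \<Rightarrow> nat list set" where
  "shifted_frobs m n =
     {\<pi>. \<exists>\<alpha>. is_frobenius \<pi> (shift \<alpha> m) \<alpha> \<and> (\<alpha> \<noteq> [] \<longrightarrow> hd \<alpha> < int n)}"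

definition typeII_lhs :: "nat \<Rightarrow> nat \<Rightarrow> (nat \<Rightarrow> 'a::comm_ring_1) \<Rightarrow> 'a" where
  "typeII_lhs n k x =
     prod_le n x * (\<Sum>\<nu> | \<nu> \<in> Par n (2 * k) \<and> (\<forall>i<length \<nu>. even (row_len \<nu> i)). schur n \<nu> x)"

definition typeII_rhs :: "nat \<Rightarrow> nat \<Rightarrow> (nat \<Rightarrow> 'a::comm_ring_1) \<Rightarrow> 'a" where
  "typeII_rhs n k x =
     (\<Sum>\<pi>\<in>shifted_frobs (2 * int k + 1) n.
        (- 1) ^ ((boxes \<pi> - 2 * k * rk \<pi>) div 2) * schur n \<pi> x)"

definition typeIIIa_lhs :: "nat \<Rightarrow> nat \<Rightarrow> (nat \<Rightarrow> 'a::comm_ring_1) \<Rightarrow> 'a" where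
  "typeIIIa_lhs n k x =
     prod_less n x * (\<Sum>\<nu> | \<nu> \<in> Par n k \<and> (\<forall>j<k. even (col_len \<nu> j)). schur n \<nu> x)"

definition typeIIIa_rhs :: "nat \<Rightarrow> nat \<Rightarrow> (nat \<Rightarrow> 'a::comm_ring_1) \<Rightarrow> 'a" where
  "typeIIIa_rhs n k x =
     (\<Sum>\<pi> | \<pi> \<in> shifted_frobs (int k - 1) n \<and> (k = 0 \<or> even (rk \<pi>)).
        (- 1) ^ ((boxes \<pi> - k * rk \<pi>) div 2) * schur n \<pi> x)"

definition typeIIIb_lhs :: "nat \<Rightarrow> nat \<Rightarrow> (nat \<Rightarrow> 'a::comm_ring_1) \<Rightarrow> 'a" where
  "typeIIIb_lhs n k x =
     prod_less n x * (\<Sum>\<nu> | \<nu> \<in> Par n k \<and> (\<forall>j<k. odd (col_len \<nu> j)). schur n \<nu> x)"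

definition typeIIIb_rhs :: "nat \<Rightarrow> nat \<Rightarrow> (nat \<Rightarrow> 'a::comm_ring_1) \<Rightarrow> 'a" where
  "typeIIIb_rhs n k x =
     (\<Sum>\<pi> | \<pi> \<in> shifted_frobs (int k - 1) n \<and> (k = 0 \<or> odd (rk \<pi>)).
        (- 1) ^ ((boxes \<pi> - k * rk \<pi>) div 2) * schur n \<pi> x)"

definition dual_cauchy_lhs ::
  "nat \<Rightarrow> nat \<Rightarrow> (nat \<Rightarrow> 'a::comm_ring_1) \<Rightarrow> (nat \<Rightarrow> 'a) \<Rightarrow> 'a" where
  "dual_cauchy_lhs p q x y = (\<Prod>(i, j)\<in>{..<p} \<times> {..<q}. 1 + x i * y j)"

definition dual_cauchy_rhs ::
  "nat \<Rightarrow> nat \<Rightarrow> (nat \<Rightarrow> 'a::comm_ring_1) \<Rightarrow> (nat \<Rightarrow> 'a) \<Rightarrow> 'a" where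
  "dual_cauchy_rhs p q x y = (\<Sum>\<pi>\<in>Par p q. schur p \<pi> x * schur q (conjugate \<pi>) y)"

definition classicalII_rhs :: "nat \<Rightarrow> (nat \<Rightarrow> 'a::comm_ring_1) \<Rightarrow> 'a" where
  "classicalII_rhs n x =
     (\<Sum>\<pi> | (\<exists>\<alpha>. is_frobenius \<pi> (shift \<alpha> 1) \<alpha>) \<and> length \<pi> \<le> n.
        (- 1) ^ (boxes \<pi> div 2) * schur n \<pi> x)"

definition classicalIII_rhs :: "nat \<Rightarrow> (nat \<Rightarrow> 'a::comm_ring_1) \<Rightarrow> 'a" where
  "classicalIII_rhs n x =
     (\<Sum>\<pi> | is_partition \<pi> \<and> (\<exists>\<alpha>. is_frobenius (conjugate \<pi>) (shift \<alpha> 1) \<alpha>) \<and> length \<pi> \<le> n.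
        (- 1) ^ (boxes \<pi> div 2) * schur n \<pi> x)"

definition littlewood_lhs :: "nat \<Rightarrow> (nat \<Rightarrow> 'a::comm_ring_1) \<Rightarrow> 'a" where
  "littlewood_lhs n x = (\<Prod>i<n. 1 - x i) * prod_less n x"

definition littlewood_rhs :: "nat \<Rightarrow> (nat \<Rightarrow> 'a::comm_ring_1) \<Rightarrow> 'a" where
  "littlewood_rhs n x =
     (\<Sum>\<pi> | is_partition \<pi> \<and> conjugate \<pi> = \<pi> \<and> length \<pi> \<le> n.
        (- 1) ^ ((boxes \<pi> + rk \<pi>) div 2) * schur n \<pi> x)"

end

theory Submission
  imports Defs "HOL-Library.Poly_Mapping" "Jordan_Normal_Form.Determinant"
begin

text \<open>
  All identities compare alternants \<open>det (x i ^ e j)\<close>. By Jacobi's bialternant formula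
  (\<open>bialternant\<close>) the Vandermonde product times the Schur polynomial of a partition is the alternant
  whose exponents are the beta numbers of the partition, and the Frobenius symbol can be read off the set
  of beta numbers (\<open>beta_set\<close>). The identities have integer coefficients. It therefore
  suffices to prove them for indeterminates in the ring of Laurent polynomials over the integers, where
  the Vandermonde product can be cancelled and the variables can be inverted, and then to specialise.

  Type I. In the variables \<open>(x, 1 / y)\<close> the Schur polynomial of a \<open>q \<times> k\<close> rectangle equals, up to the factor
  \<open>\<Prod>j<q. y j ^ k\<close>, the sum of \<open>s\<^sub>\<nu>(x) s\<^sub>\<nu>(y)\<close> (\<open>rect_split\<close>), and the Vandermonde product contains all
  factors \<open>1 - x i * y j\<close> (\<open>vandermonde_split\<close>). Hence the left-hand side is a single
  alternant divided by the Vandermonde products of \<open>x\<close> and \<open>y\<close>. Laplace expansion along the rows of \<open>x\<close>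
  is indexed by the partitions \<open>\<mu>\<close> in the \<open>p \<times> q\<close> rectangle. The beta numbers of \<open>\<mu>\<close> that encode arms
  are raised by \<open>k\<close>, which turns \<open>(\<alpha> | \<beta>)\<close> into \<open>(\<alpha> + k | \<beta>)\<close>.

  Types II and III. The right-hand side times the Vandermonde product is a determinant with entries
  \<open>x i ^ (n - 1 - j) \<plusminus> x i ^ (K - (n - 1 - j))\<close> (\<open>shifted_frobs_sum\<close>): choosing the second summand in the
  columns \<open>j\<close> of a set \<open>L\<close> gives the exponents of the partition with legs \<open>L\<close> and arms \<open>L + m\<close>, where
  \<open>K = 2 * n - 1 + m\<close>. The difference of the two sides is an antisymmetric polynomial that reproduces
  itself up to sign when a variable is inverted and its degree \<open>K\<close> is restored. Littlewood's identities,
  truncated to shapes with bounded rows (\<open>littlewood_cols\<close>, \<open>littlewood_rows\<close>), show that each of its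
  monomials has an exponent above \<open>K / 2\<close>. Such a polynomial vanishes (\<open>laurent_flip_zero\<close>), because
  reflecting an exponent above \<open>K / 2\<close> would lead to monomials with ever fewer exponents of this kind. The two
  versions of type III are separated by the choice of the sign in the determinant, as inverting a variable
  exchanges even and odd columns.

  For \<open>k = 0\<close> only the empty shape occurs on the left, and for \<open>k = 1\<close> the sum over all columns, of even
  and of odd length, is \<open>\<Prod>i<n. 1 + x i\<close>. This gives the classical identities.
\<close>

section \<open>Partitions as functions and the branching rule\<close>

text \<open>
  Partitions are handled as functions giving the row lengths, zero beyond the last row. Interlacing
  and adding boxes then become pointwise conditions, with no case distinction on the number of rows.
\<close>

definition part :: "nat list \<Rightarrow> nat \<Rightarrow> nat" where
  "part \<pi> i = (if i < length \<pi> then \<pi> ! i else 0)"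

definition shapes :: "nat \<Rightarrow> nat \<Rightarrow> (nat \<Rightarrow> nat) set" where
  "shapes n k = {f. (\<forall>i. f (Suc i) \<le> f i) \<and> f 0 \<le> k \<and> (\<forall>i\<ge>n. f i = 0)}"

definition cells :: "(nat \<Rightarrow> nat) \<Rightarrow> (nat \<times> nat) set" where
  "cells f = {(i, j). j < f i}"

definition fillings :: "nat \<Rightarrow> (nat \<times> nat) set \<Rightarrow> (nat \<times> nat \<Rightarrow> nat) set" where
  "fillings n D = {T \<in> D \<rightarrow>\<^sub>E {..<n}.
     (\<forall>i j. (i, j) \<in> D \<and> (i, Suc j) \<in> D \<longrightarrow> T (i, j) \<le> T (i, Suc j)) \<and>
     (\<forall>i j. (i, j) \<in> D \<and> (Suc i, j) \<in> D \<longrightarrow> T (i, j) < T (Suc i, j))}"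

definition schur_fun :: "nat \<Rightarrow> (nat \<Rightarrow> nat) \<Rightarrow> (nat \<Rightarrow> 'a::comm_ring_1) \<Rightarrow> 'a" where
  "schur_fun n f x = (\<Sum>T\<in>fillings n (cells f). \<Prod>c\<in>cells f. x (T c))"

definition weight :: "nat \<Rightarrow> (nat \<Rightarrow> nat) \<Rightarrow> nat" where
  "weight n f = (\<Sum>i<n. f i)"

text \<open>
  For \<open>f\<close> with at most \<open>n + 1\<close> rows these are the shapes with at most \<open>n\<close> rows that are obtained
  from \<open>f\<close> by removing a horizontal strip.
\<close>

definition interlacing :: "nat \<Rightarrow> (nat \<Rightarrow> nat) \<Rightarrow> (nat \<Rightarrow> nat) set" where
  "interlacing n f = {g. (\<forall>i<n. f (Suc i) \<le> g i \<and> g i \<le> f i) \<and> (\<forall>i\<ge>n. g i = 0)}"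

lemma diagram_cells: "diagram \<pi> = cells (part \<pi>)"
  by (auto simp: diagram_def cells_def part_def split: if_splits)

lemma schur_eq_schur_fun: "schur n \<pi> x = schur_fun n (part \<pi>) x"
  by (simp add: schur_def schur_fun_def ssyt_def fillings_def diagram_cells)

lemma shapes_antimono: "f \<in> shapes n k \<Longrightarrow> i \<le> j \<Longrightarrow> f j \<le> f i"
  unfolding shapes_def by (auto intro: lift_Suc_antimono_le)

lemma shapes_mono: "n \<le> m \<Longrightarrow> k \<le> l \<Longrightarrow> shapes n k \<subseteq> shapes m l"
  unfolding shapes_def by auto

lemma shapes_zero: "f \<in> shapes n k \<Longrightarrow> n \<le> i \<Longrightarrow> f i = 0"
  unfolding shapes_def by auto

lemma shapes_le: "f \<in> shapes n k \<Longrightarrow> f i \<le> k"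
  using shapes_antimono[of f n k 0 i] unfolding shapes_def by auto

lemma finite_fun_bounded: "finite {f :: nat \<Rightarrow> nat. (\<forall>i<n. f i \<le> k) \<and> (\<forall>i\<ge>n. f i = 0)}"
proof -
  have "finite {f. \<forall>i. (i \<in> {..<n} \<longrightarrow> f i \<in> {..k}) \<and> (i \<notin> {..<n} \<longrightarrow> f i = (0::nat))}"
    by (rule finite_set_of_finite_funs) auto
  then show ?thesis by (rule rev_finite_subset) auto
qed

lemma finite_shapes [simp]: "finite (shapes n k)"
  by (rule finite_subset[OF _ finite_fun_bounded[of n k]]) (auto intro: shapes_le shapes_zero)

lemma interlacing_shapes: "f \<in> shapes (Suc n) k \<Longrightarrow> interlacing n f \<subseteq> shapes n k"
proof
  fix g assume f: "f \<in> shapes (Suc n) k" and g: "g \<in> interlacing n f"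
  have "g (Suc i) \<le> g i" for i
  proof (cases "Suc i < n")
    case True
    then show ?thesis using g unfolding interlacing_def by (auto intro: order_trans)
  next
    case False
    then show ?thesis using g unfolding interlacing_def by auto
  qed
  moreover have "g 0 \<le> k"
    using g f unfolding interlacing_def shapes_def by (cases n) (auto intro: order_trans)
  ultimately show "g \<in> shapes n k" using g unfolding interlacing_def shapes_def by auto
qed

lemma finite_interlacing: "f \<in> shapes (Suc n) k \<Longrightarrow> finite (interlacing n f)"
  by (rule finite_subset[OF interlacing_shapes finite_shapes])

lemma finite_cells: assumes "f \<in> shapes n k" shows "finite (cells f)"
proof -
  have "i < n" if "j < f i" for i j
    using shapes_zero[OF assms, of i] that by (cases "i < n") auto
  moreover have "j < k" if "j < f i" for i j using shapes_le[OF assms, of i] that by auto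
  ultimately have "cells f \<subseteq> {..<n} \<times> {..<k}" unfolding cells_def by auto
  then show ?thesis by (rule finite_subset) auto
qed

lemma card_cells: assumes "f \<in> shapes n k" shows "card (cells f) = weight n f"
proof -
  have "cells f = (SIGMA i:{..<n}. {..<f i})"
    using shapes_zero[OF assms] unfolding cells_def by (auto simp: not_less) (metis not_less less_zeroE)
  then show ?thesis by (simp add: weight_def)
qed

lemma fillings_row_mono: 
  assumes "T \<in> fillings n (cells f)" "j \<le> j'" "j' < f i"
  shows "T (i, j) \<le> T (i, j')"
  using assms(2,3)
proof (induction j' rule: dec_induct)
  case (step m)
  then have "T (i, m) \<le> T (i, Suc m)" using assms(1) unfolding fillings_def cells_def by auto
  with step show ?case by auto
qed simp

lemma fillings_col_ge:
  assumes "T \<in> fillings n (cells f)" "f \<in> shapes m k" "j < f i"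
  shows "i \<le> T (i, j)"
  using assms(3)
proof (induction i)
  case (Suc i)
  then have "j < f i" using shapes_antimono[OF assms(2), of i "Suc i"] by auto
  moreover from this Suc.prems have "T (i, j) < T (Suc i, j)" using assms(1) unfolding fillings_def cells_def by auto
  ultimately show ?case using Suc.IH by auto
qed simp

lemma fillings_less: "T \<in> fillings n D \<Longrightarrow> c \<in> D \<Longrightarrow> T c < n"
  unfolding fillings_def by (auto dest!: PiE_mem)

text \<open>
  The entries of a column increase strictly, so a column with more than \<open>n\<close> boxes has no filling with
  \<open>n\<close> letters.
\<close>

lemma schur_fun_too_long: assumes "f \<in> shapes m k" "f n \<noteq> 0" shows "schur_fun n f x = 0"
proof -
  have "fillings n (cells f) = {}"
  proof (rule ccontr)
    assume "fillings n (cells f) \<noteq> {}"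
    then obtain T where T: "T \<in> fillings n (cells f)" by auto
    have "(n, 0) \<in> cells f" using assms by (auto simp: cells_def)
    with fillings_less[OF T this] fillings_col_ge[OF T assms(1), of 0 n] show False by (auto simp: cells_def)
  qed
  then show ?thesis by (simp add: schur_fun_def)
qed

lemma schur_fun_empty: "schur_fun n (\<lambda>_. 0) x = 1"
  by (simp add: schur_fun_def cells_def fillings_def)

lemma downset_lessThan:
  fixes A :: "nat set"
  assumes "finite A" "\<And>i j. j \<in> A \<Longrightarrow> i \<le> j \<Longrightarrow> i \<in> A"
  shows "A = {..<card A}"
proof -
  have "A = {..<Suc (Max A)}" if "A \<noteq> {}"
    using assms(1) assms(2)[of "Max A"] Max_in[OF assms(1) that] by (auto simp: less_Suc_eq_le)
  then show ?thesis by (cases "A = {}") (simp, metis card_lessThan)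
qed

lemma interlacing_sum:
  assumes "g \<in> interlacing n f"
  shows "weight (Suc n) f - weight n g = (\<Sum>i<Suc n. f i - g i)" "weight n g \<le> weight (Suc n) f"
proof -
  have z: "weight n g = weight (Suc n) g" using assms by (auto simp: weight_def interlacing_def)
  have le: "g i \<le> f i" if "i < Suc n" for i using assms that by (cases "i = n") (auto simp: interlacing_def)
  show "weight (Suc n) f - weight n g = (\<Sum>i<Suc n. f i - g i)"
    unfolding z unfolding weight_def by (rule sum_subtractf_nat[symmetric]) (use le in auto)
  show "weight n g \<le> weight (Suc n) f" unfolding z unfolding weight_def by (rule sum_mono) (use le in auto)
qed

text \<open>
  In a filling with the letters \<open>0, \<dots>, n\<close> the boxes with entry below \<open>n\<close> form a smaller shape. Its
  rows are \<open>small n f T\<close>; conversely \<open>extend\<close> puts the letter \<open>n\<close> into all boxes of \<open>f\<close> outside \<open>g\<close>.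
\<close>

definition small :: "nat \<Rightarrow> (nat \<Rightarrow> nat) \<Rightarrow> (nat \<times> nat \<Rightarrow> nat) \<Rightarrow> nat \<Rightarrow> nat" where
  "small n f T i = card {j. j < f i \<and> T (i, j) < n}"

lemma small_eq:
  assumes "T \<in> fillings (Suc n) (cells f)"
  shows "{j. j < f i \<and> T (i, j) < n} = {..<small n f T i}"
  unfolding small_def
proof (rule downset_lessThan)
  fix j j' assume "j' \<in> {j. j < f i \<and> T (i, j) < n}" "j \<le> j'"
  then show "j \<in> {j. j < f i \<and> T (i, j) < n}" using fillings_row_mono[OF assms, of j j' i] by simp
qed simp

lemma small_iff:
  assumes "T \<in> fillings (Suc n) (cells f)"
  shows "j < small n f T i \<longleftrightarrow> j < f i \<and> T (i, j) < n"
  using small_eq[OF assms, of i] by auto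

lemma small_interlacing:
  assumes T: "T \<in> fillings (Suc n) (cells f)" and f: "f \<in> shapes (Suc n) k"
  shows "small n f T \<in> interlacing n f"
proof -
  have "f (Suc i) \<le> small n f T i" for i
  proof (rule ccontr)
    assume "\<not> f (Suc i) \<le> small n f T i"
    then have j: "small n f T i < f (Suc i)" by simp
    let ?j = "small n f T i"
    have j2: "?j < f i" using j shapes_antimono[OF f, of i "Suc i"] by auto
    then have "T (i, ?j) < T (Suc i, ?j)" using T j unfolding fillings_def cells_def by auto
    moreover have "T (Suc i, ?j) < Suc n" using fillings_less[OF T, of "(Suc i, ?j)"] j by (auto simp: cells_def)
    ultimately have "T (i, ?j) < n" by simp
    with small_iff[OF T, of ?j i] j2 show False by simp
  qed
  moreover have "small n f T i \<le> f i" for i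
    using small_iff[OF T, of "f i" i] by (auto simp: not_less[symmetric])
  moreover have "small n f T i = 0" if "i \<ge> n" for i
  proof (rule ccontr)
    assume "small n f T i \<noteq> 0"
    then have "0 < f i \<and> T (i, 0) < n" using small_iff[OF T, of 0 i] by auto
    with fillings_col_ge[OF T f, of 0 i] that show False by auto
  qed
  ultimately show ?thesis unfolding interlacing_def by auto
qed

lemma cells_interlacing: assumes "g \<in> interlacing n f" shows "cells g \<subseteq> cells f"
proof -
  have "g i \<le> f i" for i using assms unfolding interlacing_def by (cases "i < n") auto
  then show ?thesis unfolding cells_def by (auto intro: less_le_trans)
qed

lemma small_fillings:
  assumes T: "T \<in> fillings (Suc n) (cells f)" and f: "f \<in> shapes (Suc n) k"
  shows "restrict T (cells (small n f T)) \<in> fillings n (cells (small n f T))"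
proof -
  have sub: "c \<in> cells (small n f T) \<longleftrightarrow> c \<in> cells f \<and> T c < n" for c
    by (cases c) (simp add: cells_def small_iff[OF T])
  have "T (i, j) \<le> T (i, Suc j)" if "(i, j) \<in> cells f" "(i, Suc j) \<in> cells f" for i j
    using T that unfolding fillings_def by simp
  moreover have "T (i, j) < T (Suc i, j)" if "(i, j) \<in> cells f" "(Suc i, j) \<in> cells f" for i j
    using T that unfolding fillings_def by simp
  ultimately show ?thesis unfolding fillings_def by (simp add: sub)
qed

definition extend :: "nat \<Rightarrow> (nat \<Rightarrow> nat) \<Rightarrow> (nat \<Rightarrow> nat) \<Rightarrow> (nat \<times> nat \<Rightarrow> nat) \<Rightarrow> (nat \<times> nat \<Rightarrow> nat)" where
  "extend n f g T = (\<lambda>c\<in>cells f. if c \<in> cells g then T c else n)"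

lemma extend_fillings:
  assumes g: "g \<in> interlacing n f" and f: "f \<in> shapes (Suc n) k" and T: "T \<in> fillings n (cells g)"
  shows "extend n f g T \<in> fillings (Suc n) (cells f)"
proof -
  have lt: "T c < n" if "c \<in> cells g" for c using fillings_less[OF T that] .
  have 1: "extend n f g T \<in> cells f \<rightarrow>\<^sub>E {..<Suc n}"
    using lt unfolding extend_def by (auto simp: less_Suc_eq)
  have 2: "extend n f g T (i, j) \<le> extend n f g T (i, Suc j)" if "(i, j) \<in> cells f" "(i, Suc j) \<in> cells f" for i j
  proof (cases "(i, Suc j) \<in> cells g")
    case True
    then have "(i, j) \<in> cells g" by (auto simp: cells_def)
    with True T that show ?thesis unfolding extend_def fillings_def by auto
  next
    case False
    then show ?thesis using that lt[of "(i, j)"] unfolding extend_def by auto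
  qed
  have 3: "extend n f g T (i, j) < extend n f g T (Suc i, j)" if "(i, j) \<in> cells f" "(Suc i, j) \<in> cells f" for i j
  proof -
    have i: "i < n" using that(2) shapes_zero[OF f, of "Suc i"] by (cases "i < n") (auto simp: cells_def)
    have "(i, j) \<in> cells g" using that(2) g i unfolding interlacing_def cells_def by (auto intro: less_le_trans)
    then show ?thesis using T that lt[of "(i, j)"] unfolding extend_def fillings_def by auto
  qed
  show ?thesis unfolding fillings_def using 1 2 3 by auto
qed

lemma small_extend:
  assumes g: "g \<in> interlacing n f" and f: "f \<in> shapes (Suc n) k" and T: "T \<in> fillings n (cells g)"
  shows "small n f (extend n f g T) = g"
proof
  fix i
  have "{j. j < f i \<and> extend n f g T (i, j) < n} = {..<g i}"
    using fillings_less[OF T] cells_interlacing[OF g] unfolding extend_def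
    by (force simp: cells_def)
  then show "small n f (extend n f g T) i = g i" unfolding small_def by simp
qed

lemma finite_fillings: "finite D \<Longrightarrow> finite (fillings n D)"
  unfolding fillings_def by (rule finite_subset[of _ "D \<rightarrow>\<^sub>E {..<n}"]) (auto intro: finite_PiE)

text \<open>
  The branching rule: the boxes with the largest letter form a horizontal strip, since no column
  contains that letter twice, and the remaining boxes form a filling of an interlacing shape.
\<close>

theorem schur_fun_branching:
  assumes f: "f \<in> shapes (Suc n) k"
  shows "schur_fun (Suc n) f x = (\<Sum>g\<in>interlacing n f. schur_fun n g x * x n ^ (weight (Suc n) f - weight n g))"
proof -
  have fin: "finite (cells g)" if "g \<in> interlacing n f" for g by (rule finite_cells[OF subsetD[OF interlacing_shapes[OF f] that]])
  have "schur_fun (Suc n) f x = (\<Sum>(g, T)\<in>(SIGMA g:interlacing n f. fillings n (cells g)).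
      (\<Prod>c\<in>cells g. x (T c)) * x n ^ (weight (Suc n) f - weight n g))"
    unfolding schur_fun_def
  proof (rule sum.reindex_bij_witness[where i = "\<lambda>(g, T). extend n f g T"
        and j = "\<lambda>T. (small n f T, restrict T (cells (small n f T)))"])
    fix T assume T: "T \<in> fillings (Suc n) (cells f)"
    note interlacing = small_interlacing[OF T f]
    show "(case (small n f T, restrict T (cells (small n f T))) of (g, T) \<Rightarrow> extend n f g T) = T"
    proof -
      have "T c = n" if "c \<in> cells f" "c \<notin> cells (small n f T)" for c
        using that small_iff[OF T] fillings_less[OF T, of c] by (cases c) (auto simp: cells_def less_Suc_eq)
      moreover have "T c = undefined" if "c \<notin> cells f" for c
        using PiE_arb[of T "cells f" "\<lambda>_. {..<Suc n}" c] T that unfolding fillings_def by blast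
      ultimately show ?thesis unfolding extend_def by (auto simp: fun_eq_iff)
    qed
    show "(small n f T, restrict T (cells (small n f T))) \<in> (SIGMA g:interlacing n f. fillings n (cells g))"
      using interlacing small_fillings[OF T f] by simp
    have "(\<Prod>c\<in>cells f. x (T c)) = (\<Prod>c\<in>cells f - cells (small n f T). x (T c)) * (\<Prod>c\<in>cells (small n f T). x (T c))"
      by (rule prod.subset_diff[OF cells_interlacing[OF interlacing] finite_cells[OF f]])
    also have "(\<Prod>c\<in>cells f - cells (small n f T). x (T c)) = (\<Prod>c\<in>cells f - cells (small n f T). x n)"
    proof (rule prod.cong[OF refl])
      fix c assume "c \<in> cells f - cells (small n f T)"
      then have "T c = n"
        using small_iff[OF T] fillings_less[OF T, of c] by (cases c) (auto simp: cells_def less_Suc_eq)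
      then show "x (T c) = x n" by simp
    qed
    also have "\<dots> = x n ^ (weight (Suc n) f - weight n (small n f T))"
    proof -
      have "card (cells f - cells (small n f T)) = card (cells f) - card (cells (small n f T))"
        by (rule card_Diff_subset[OF fin[OF interlacing] cells_interlacing[OF interlacing]])
      also have "\<dots> = weight (Suc n) f - weight n (small n f T)"
        using card_cells[OF f] card_cells interlacing_shapes[OF f] interlacing by (metis subsetD)
      finally show ?thesis by simp
    qed
    finally show "(case (small n f T, restrict T (cells (small n f T))) of (g, T) \<Rightarrow>
        (\<Prod>c\<in>cells g. x (T c)) * x n ^ (weight (Suc n) f - weight n g)) = (\<Prod>c\<in>cells f. x (T c))"
      by (simp add: mult.commute)
  next
    fix b assume "b \<in> (SIGMA g:interlacing n f. fillings n (cells g))"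
    then obtain g T where b: "b = (g, T)" and g: "g \<in> interlacing n f" and T: "T \<in> fillings n (cells g)" by auto
    show "(case b of (g, T) \<Rightarrow> extend n f g T) \<in> fillings (Suc n) (cells f)"
      using extend_fillings[OF g f T] b by simp
    have "restrict (extend n f g T) (cells g) = T"
    proof
      fix c
      show "restrict (extend n f g T) (cells g) c = T c"
        using cells_interlacing[OF g] T PiE_arb[of T "cells g" "\<lambda>_. {..<n}" c] unfolding extend_def fillings_def
        by (cases "c \<in> cells g") auto
    qed
    then show "(small n f (case b of (g, T) \<Rightarrow> extend n f g T),
          restrict (case b of (g, T) \<Rightarrow> extend n f g T)
           (cells (small n f (case b of (g, T) \<Rightarrow> extend n f g T)))) = b"
      by (simp add: b small_extend[OF g f T])
  qed
  also have "\<dots> = (\<Sum>g\<in>interlacing n f. schur_fun n g x * x n ^ (weight (Suc n) f - weight n g))"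
    by (subst sum.Sigma[symmetric])
       (use finite_interlacing[OF f] fin in \<open>auto simp: schur_fun_def sum_distrib_right intro: finite_fillings\<close>)
  finally show ?thesis .
qed

lemma shapes_nonzero_iff:
  assumes f: "f \<in> shapes n k"
  shows "f i \<noteq> 0 \<longleftrightarrow> i < card {i. f i \<noteq> 0}"
proof -
  have "{i. f i \<noteq> 0} = {..<card {i. f i \<noteq> 0}}"
  proof (rule downset_lessThan)
    have "i < n" if "f i \<noteq> 0" for i
      using shapes_zero[OF f, of i] that by (cases "n \<le> i") auto
    then show "finite {i. f i \<noteq> 0}"
      by (intro finite_subset[of "{i. f i \<noteq> 0}" "{..<n}"]) auto
    fix i j assume "j \<in> {i. f i \<noteq> 0}" "i \<le> j"
    then show "i \<in> {i. f i \<noteq> 0}" using shapes_antimono[OF f, of i j] by auto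
  qed
  then show ?thesis by blast
qed

lemma part_eq_0_iff: "is_partition \<pi> \<Longrightarrow> part \<pi> i = 0 \<longleftrightarrow> length \<pi> \<le> i"
proof (cases "i < length \<pi>")
  case True
  assume "is_partition \<pi>"
  then have "0 \<notin> set \<pi>" unfolding is_partition_def by blast
  then have "\<pi> ! i \<noteq> 0" using nth_mem[OF True] by metis
  then show ?thesis using True by (simp add: part_def)
qed (simp add: part_def)

lemma part_inject:
  assumes "is_partition \<pi>" "is_partition \<sigma>" "part \<pi> = part \<sigma>"
  shows "\<pi> = \<sigma>"
proof (rule nth_equalityI)
  show len: "length \<pi> = length \<sigma>"
  proof (rule le_antisym)
    have "part \<pi> (length \<sigma>) = 0" unfolding assms(3) by (simp add: part_def)
    then show "length \<pi> \<le> length \<sigma>" using part_eq_0_iff[OF assms(1)] by blast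
    have "part \<sigma> (length \<pi>) = 0" unfolding assms(3)[symmetric] by (simp add: part_def)
    then show "length \<sigma> \<le> length \<pi>" using part_eq_0_iff[OF assms(2)] by blast
  qed
  fix i assume "i < length \<pi>"
  then show "\<pi> ! i = \<sigma> ! i" using fun_cong[OF assms(3), of i] len by (simp add: part_def)
qed

lemma part_bij_Par: "bij_betw part (Par n k) (shapes n k)"
  unfolding Par_def
proof (rule bij_betwI')
  let ?P = "{\<pi>. is_partition \<pi> \<and> diagram \<pi> \<subseteq> {..<n} \<times> {..<k}}"
  fix \<pi> \<sigma> assume p: "\<pi> \<in> ?P" and s: "\<sigma> \<in> ?P"
  show "(part \<pi> = part \<sigma>) = (\<pi> = \<sigma>)"
    using part_inject[of \<pi> \<sigma>] p s by auto
next
  fix \<pi> assume p: "\<pi> \<in> {\<pi>. is_partition \<pi> \<and> diagram \<pi> \<subseteq> {..<n} \<times> {..<k}}"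
  have d: "cells (part \<pi>) \<subseteq> {..<n} \<times> {..<k}" using p by (simp add: diagram_cells)
  have "part \<pi> (Suc i) \<le> part \<pi> i" for i
    using p unfolding part_def is_partition_def by (auto simp: sorted_wrt_iff_nth_less)
  moreover have "part \<pi> 0 \<le> k"
  proof (cases "part \<pi> 0")
    case (Suc m)
    then have "(0, m) \<in> cells (part \<pi>)" by (auto simp: cells_def)
    then show ?thesis using d Suc by auto
  qed simp
  moreover have "part \<pi> i = 0" if "i \<ge> n" for i
  proof (rule ccontr)
    assume "part \<pi> i \<noteq> 0"
    then have "(i, 0) \<in> cells (part \<pi>)" by (auto simp: cells_def)
    then show False using d that by auto
  qed
  ultimately show "part \<pi> \<in> shapes n k" unfolding shapes_def by auto
next
  fix f assume f: "f \<in> shapes n k"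
  define m where "m = card {i. f i \<noteq> 0}"
  have m: "f i \<noteq> 0 \<longleftrightarrow> i < m" for i unfolding m_def by (rule shapes_nonzero_iff[OF f])
  define \<pi> where "\<pi> = map f [0..<m]"
  have part: "part \<pi> = f"
  proof
    fix i show "part \<pi> i = f i" using m[of i] by (cases "i < m") (simp_all add: \<pi>_def part_def)
  qed
  have "sorted_wrt (\<ge>) \<pi>" unfolding \<pi>_def
    by (simp add: sorted_wrt_iff_nth_less shapes_antimono[OF f])
  moreover have "0 \<notin> set \<pi>" 
  proof
    assume "0 \<in> set \<pi>"
    then obtain i where "i < m" "f i = 0" unfolding \<pi>_def by auto
    then show False using m[of i] by blast
  qed
  moreover have "diagram \<pi> \<subseteq> {..<n} \<times> {..<k}"
  proof -
    have "i < n \<and> j < k" if "j < f i" for i j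
      using shapes_zero[OF f, of i] shapes_le[OF f, of i] that by (cases "n \<le> i") auto
    then show ?thesis unfolding diagram_cells part cells_def by auto
  qed
  ultimately show "\<exists>\<pi>\<in>{\<pi>. is_partition \<pi> \<and> diagram \<pi> \<subseteq> {..<n} \<times> {..<k}}. f = part \<pi>"
    using part by (intro bexI[of _ \<pi>]) (simp_all add: is_partition_def)
qed

section \<open>Alternants\<close>

definition Det :: "nat \<Rightarrow> (nat \<Rightarrow> nat \<Rightarrow> 'a::comm_ring_1) \<Rightarrow> 'a" where
  "Det n M = (\<Sum>\<sigma> | \<sigma> permutes {..<n}. of_int (sign \<sigma>) * (\<Prod>i<n. M i (\<sigma> i)))"

definition alternant :: "nat \<Rightarrow> (nat \<Rightarrow> 'a::comm_ring_1) \<Rightarrow> (nat \<Rightarrow> nat) \<Rightarrow> 'a" where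
  "alternant n x e = Det n (\<lambda>i j. x i ^ e j)"

definition vandermonde :: "nat \<Rightarrow> (nat \<Rightarrow> 'a::comm_ring_1) \<Rightarrow> 'a" where
  "vandermonde n x = (\<Prod>j<n. \<Prod>i<j. x i - x j)"

text \<open>
  The decreasing exponents \<open>f 0 + n - 1 > \<dots> > f (n - 1)\<close> of the alternant that belongs to \<open>f\<close>,
  also known as beta numbers.
\<close>

definition beta :: "nat \<Rightarrow> (nat \<Rightarrow> nat) \<Rightarrow> nat \<Rightarrow> nat" where
  "beta n f j = f j + (n - 1 - j)"

lemma finite_perms [simp]: "finite {\<sigma>. \<sigma> permutes {..<n::nat}}"
  by (rule finite_permutations) simp

lemma sign_comp:
  assumes "\<sigma> permutes {..<n::nat}" "\<tau> permutes {..<n}"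
  shows "sign (\<sigma> \<circ> \<tau>) = sign \<sigma> * sign \<tau>"
proof (rule sign_compose)
  show "permutation \<sigma>" "permutation \<tau>"
    using assms permutation_permutes by blast+
qed

lemma Det_cong:
  assumes "\<And>i j. i < n \<Longrightarrow> j < n \<Longrightarrow> M i j = N i j"
  shows "Det n M = Det n N"
  unfolding Det_def
proof (rule sum.cong[OF refl])
  fix \<sigma> assume "\<sigma> \<in> {\<sigma>. \<sigma> permutes {..<n}}"
  then have "\<sigma> i < n" if "i < n" for i using that permutes_in_image[of \<sigma> "{..<n}" i] by simp
  then show "of_int (sign \<sigma>) * (\<Prod>i<n. M i (\<sigma> i)) = of_int (sign \<sigma>) * (\<Prod>i<n. N i (\<sigma> i))"
    by (simp add: assms)
qed

lemma alternant_cong: "(\<And>i. i < n \<Longrightarrow> x i = y i) \<Longrightarrow> (\<And>j. j < n \<Longrightarrow> e j = e' j) \<Longrightarrow> alternant n x e = alternant n y e'"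
  unfolding alternant_def by (rule Det_cong) simp

lemma Det_eq_det: "Det n M = det (mat n n (\<lambda>(i, j). M i j))"
proof -
  have "det (mat n n (\<lambda>(i, j). M i j)) =
    (\<Sum>p | p permutes {0..<n}. of_int (sign p) * (\<Prod>i = 0..<n. mat n n (\<lambda>(i, j). M i j) $$ (i, p i)))"
    by (rule det_def') simp
  also have "\<dots> = Det n M"
    unfolding Det_def lessThan_atLeast0
  proof (rule sum.cong[OF refl])
    fix \<sigma> assume "\<sigma> \<in> {\<sigma>. \<sigma> permutes {0..<n}}"
    then have "\<sigma> i < n" if "i < n" for i using that permutes_in_image[of \<sigma> "{0..<n}" i] by simp
    then show "of_int (sign \<sigma>) * (\<Prod>i = 0..<n. mat n n (\<lambda>(i, j). M i j) $$ (i, \<sigma> i)) =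
      of_int (sign \<sigma>) * (\<Prod>i = 0..<n. M i (\<sigma> i))"
      by simp
  qed
  finally show ?thesis by simp
qed

lemma prod_perm: "\<sigma> permutes {..<n::nat} \<Longrightarrow> (\<Prod>i<n. g (\<sigma> i)) = (\<Prod>i<n. g i)"
  using prod.permute[of \<sigma> "{..<n}" g] by (simp add: comp_def)

lemma Det_scale_rows: "Det n (\<lambda>i j. c i * M i j) = (\<Prod>i<n. c i) * Det n M"
  by (simp add: Det_def prod.distrib sum_distrib_left mult.left_commute)

lemma Det_scale_cols: "Det n (\<lambda>i j. c j * M i j) = (\<Prod>i<n. c i) * Det n M"
proof -
  have "Det n (\<lambda>i j. c j * M i j) =
    (\<Sum>\<sigma> | \<sigma> permutes {..<n}. (\<Prod>i<n. c i) * (of_int (sign \<sigma>) * (\<Prod>i<n. M i (\<sigma> i))))"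
    unfolding Det_def by (rule sum.cong[OF refl]) (simp add: prod.distrib prod_perm[of _ n c] mult.left_commute)
  then show ?thesis by (simp add: Det_def sum_distrib_left)
qed

lemma sign_square: "of_int (sign \<sigma>) * (of_int (sign \<sigma>) * a) = (a :: 'a::comm_ring_1)"
  by (simp add: sign_def)

lemma Det_perm_cols:
  assumes \<tau>: "\<tau> permutes {..<n}"
  shows "Det n (\<lambda>i j. M i (\<tau> j)) = of_int (sign \<tau>) * Det n M"
proof -
  have "Det n M = (\<Sum>\<sigma> | \<sigma> permutes {..<n}. of_int (sign (\<tau> \<circ> \<sigma>)) * (\<Prod>i<n. M i ((\<tau> \<circ> \<sigma>) i)))"
    unfolding Det_def by (rule setum_permutations_compose_left[OF \<tau>])
  also have "\<dots> = (\<Sum>\<sigma> | \<sigma> permutes {..<n}. of_int (sign \<tau>) * (of_int (sign \<sigma>) * (\<Prod>i<n. M i (\<tau> (\<sigma> i)))))"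
    by (rule sum.cong[OF refl]) (simp add: sign_comp[OF \<tau>] mult.assoc)
  also have "\<dots> = of_int (sign \<tau>) * Det n (\<lambda>i j. M i (\<tau> j))"
    by (simp add: Det_def sum_distrib_left)
  finally show ?thesis by (simp add: sign_square)
qed

lemma Det_perm_rows:
  assumes \<tau>: "\<tau> permutes {..<n}"
  shows "Det n (\<lambda>i j. M (\<tau> i) j) = of_int (sign \<tau>) * Det n M"
proof -
  have "Det n (\<lambda>i j. M (\<tau> i) j) =
    (\<Sum>\<sigma> | \<sigma> permutes {..<n}. of_int (sign (\<sigma> \<circ> \<tau>)) * (\<Prod>i<n. M (\<tau> i) ((\<sigma> \<circ> \<tau>) i)))"
    unfolding Det_def by (rule sum_permutations_compose_right[OF \<tau>])
  also have "\<dots> = (\<Sum>\<sigma> | \<sigma> permutes {..<n}. of_int (sign \<tau>) * (of_int (sign \<sigma>) * (\<Prod>i<n. M i (\<sigma> i))))"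
    by (rule sum.cong[OF refl])
       (simp add: sign_comp[OF _ \<tau>] mult.assoc mult.left_commute prod_perm[OF \<tau>, of "\<lambda>i. M i (_ i)"])
  finally show ?thesis by (simp add: Det_def sum_distrib_left)
qed

lemma alternant_perm_cols: "\<tau> permutes {..<n} \<Longrightarrow> alternant n x (\<lambda>j. e (\<tau> j)) = of_int (sign \<tau>) * alternant n x e"
  unfolding alternant_def by (rule Det_perm_cols)

lemma alternant_perm_rows: "\<tau> permutes {..<n} \<Longrightarrow> alternant n (\<lambda>i. x (\<tau> i)) e = of_int (sign \<tau>) * alternant n x e"
  unfolding alternant_def by (rule Det_perm_rows[where M = "\<lambda>i j. x i ^ e j"])

lemma Det_sum_cols:
  assumes "\<And>j. j < n \<Longrightarrow> finite (A j)"
  shows "Det n (\<lambda>i j. \<Sum>a\<in>A j. M i j a) = (\<Sum>f\<in>PiE {..<n} A. Det n (\<lambda>i j. M i j (f j)))"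
proof -
  have "(\<Prod>i<n. \<Sum>a\<in>A (\<sigma> i). M i (\<sigma> i) a) = (\<Sum>f\<in>PiE {..<n} A. \<Prod>i<n. M i (\<sigma> i) (f (\<sigma> i)))"
    if \<sigma>: "\<sigma> permutes {..<n}" for \<sigma>
  proof -
    have [simp]: "inv_into UNIV \<sigma> (\<sigma> i) = i" for i using permutes_inverses(2)[OF \<sigma>] by simp
    have "(\<Prod>i<n. \<Sum>a\<in>A (\<sigma> i). M i (\<sigma> i) a) = (\<Prod>j<n. \<Sum>a\<in>A j. M (inv_into UNIV \<sigma> j) j a)"
      using prod_perm[OF \<sigma>, of "\<lambda>j. \<Sum>a\<in>A j. M (inv_into UNIV \<sigma> j) j a"] by simp
    also have "\<dots> = (\<Sum>f\<in>PiE {..<n} A. \<Prod>j<n. M (inv_into UNIV \<sigma> j) j (f j))"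
      by (rule prod_sum_PiE) (use assms in auto)
    also have "\<dots> = (\<Sum>f\<in>PiE {..<n} A. \<Prod>i<n. M i (\<sigma> i) (f (\<sigma> i)))"
    proof (rule sum.cong[OF refl])
      fix f show "(\<Prod>j<n. M (inv_into UNIV \<sigma> j) j (f j)) = (\<Prod>i<n. M i (\<sigma> i) (f (\<sigma> i)))"
        using prod_perm[OF \<sigma>, of "\<lambda>j. M (inv_into UNIV \<sigma> j) j (f j)"] by simp
    qed
    finally show ?thesis .
  qed
  then have "Det n (\<lambda>i j. \<Sum>a\<in>A j. M i j a) =
    (\<Sum>\<sigma> | \<sigma> permutes {..<n}. \<Sum>f\<in>PiE {..<n} A. of_int (sign \<sigma>) * (\<Prod>i<n. M i (\<sigma> i) (f (\<sigma> i))))"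
    unfolding Det_def by (intro sum.cong[OF refl]) (simp add: sum_distrib_left)
  also have "\<dots> = (\<Sum>f\<in>PiE {..<n} A. Det n (\<lambda>i j. M i j (f j)))"
    unfolding Det_def by (rule sum.swap)
  finally show ?thesis .
qed

lemma alternant_eq_cols:
  assumes "i < n" "j < n" "i \<noteq> j" "e i = e j"
  shows "alternant n x e = 0"
  unfolding alternant_def Det_eq_det
  by (rule det_identical_columns[of _ n i j]) (use assms in \<open>auto intro!: eq_vecI\<close>)

text \<open>
  Subtracting \<open>c j\<close> times column \<open>j + 1\<close> from column \<open>j\<close> clears the last row except for its final
  entry; these column operations are multiplication by a unitriangular matrix.
\<close>

lemma Det_clear_last_row:
  fixes c :: "nat \<Rightarrow> 'a::comm_ring_1"
  assumes "\<And>j. j < n \<Longrightarrow> M n j = c j * M n (Suc j)"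
  shows "Det (Suc n) M = M n n * Det n (\<lambda>i j. M i j - c j * M i (Suc j))"
proof -
  define A where "A = mat (Suc n) (Suc n) (\<lambda>(i, j). M i j)"
  define U where "U = mat (Suc n) (Suc n) (\<lambda>(i, j). if i = j then 1 else if i = Suc j then - c j else 0)"
  define B where "B = mat (Suc n) (Suc n) (\<lambda>(i, j). if j = n then M i n else M i j - c j * M i (Suc j))"
  have cA: "A \<in> carrier_mat (Suc n) (Suc n)" and cU: "U \<in> carrier_mat (Suc n) (Suc n)"
    and cB: "B \<in> carrier_mat (Suc n) (Suc n)" unfolding A_def U_def B_def by auto
  have "det U = prod_list (diag_mat U)"
    by (rule det_lower_triangular[OF _ cU]) (auto simp: U_def)
  also have "diag_mat U = replicate (Suc n) 1"
    unfolding diag_mat_def U_def by (rule nth_equalityI) (auto simp del: replicate_Suc upt_Suc)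
  finally have dU: "det U = 1" by simp
  have "A * U = B"
  proof (rule eq_matI)
    fix i j assume "i < dim_row B" "j < dim_col B"
    then have ij: "i < Suc n" "j < Suc n" by (auto simp: B_def)
    have "(A * U) $$ (i, j) = (\<Sum>l<Suc n. M i l * (if l = j then 1 else if l = Suc j then - c j else 0))"
      using ij by (simp add: A_def U_def scalar_prod_def lessThan_atLeast0)
    also have "\<dots> = (\<Sum>l<Suc n. (if l = j then M i l else 0) + (if l = Suc j then - c j * M i l else 0))"
      by (rule sum.cong) auto
    also have "\<dots> = B $$ (i, j)"
      using ij unfolding sum.distrib by (auto simp: B_def)
    finally show "(A * U) $$ (i, j) = B $$ (i, j)" .
  qed (auto simp: A_def U_def B_def)
  then have "det A = det B" using det_mult[OF cA cU] dU by simp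
  also have "\<dots> = (\<Sum>j<Suc n. B $$ (n, j) * cofactor B n j)"
    by (rule laplace_expansion_row[OF cB]) simp
  also have "\<dots> = M n n * cofactor B n n"
    by (simp add: B_def assms)
  also have "cofactor B n n = det (mat n n (\<lambda>(i, j). M i j - c j * M i (Suc j)))"
  proof -
    have "mat_delete B n n = mat n n (\<lambda>(i, j). M i j - c j * M i (Suc j))"
      unfolding mat_delete_def B_def by (rule eq_matI) auto
    then show ?thesis unfolding cofactor_def by (simp flip: power_add mult_2)
  qed
  finally show ?thesis unfolding Det_eq_det A_def .
qed

lemma diff_power_interval:
  fixes a b :: "'a::comm_ring_1"
  assumes "k \<le> l"
  shows "a ^ l - b ^ (l - k) * a ^ k = (a - b) * (\<Sum>m\<in>{k..<l}. b ^ (l - 1 - m) * a ^ m)"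
proof (cases "k = l")
  case False
  define d where "d = l - k - 1"
  have l: "l = Suc d + k" using assms False by (simp add: d_def)
  have "(\<Sum>m\<in>{k..<l}. b ^ (l - 1 - m) * a ^ m) = (\<Sum>m<Suc d. b ^ (l - 1 - (m + k)) * a ^ (m + k))"
    using sum.shift_bounds_nat_ivl[of "\<lambda>m. b ^ (l - 1 - m) * a ^ m" 0 k "Suc d"]
    by (simp add: l lessThan_atLeast0 del: sum.op_ivl_Suc)
  also have "\<dots> = a ^ k * (\<Sum>m<Suc d. a ^ m * b ^ (d - m))"
    unfolding sum_distrib_left by (rule sum.cong[OF refl]) (simp add: l power_add mult_ac)
  finally have "(a - b) * (\<Sum>m\<in>{k..<l}. b ^ (l - 1 - m) * a ^ m) = a ^ k * (a ^ Suc d - b ^ Suc d)"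
    unfolding diff_power_eq_sum by (simp only: mult_ac)
  then show ?thesis by (simp add: l power_add algebra_simps)
qed simp

lemma vandermonde_Suc: "vandermonde (Suc n) x = vandermonde n x * (\<Prod>i<n. x i - x n)"
  by (simp add: vandermonde_def)

text \<open>
  Clearing the last row replaces \<open>x i ^ l j\<close> by
  \<open>x i ^ l j - x n ^ (l j - l (j + 1)) * x i ^ l (j + 1)\<close>, which is \<open>x i - x n\<close> times a geometric sum.
  The exponents in that sum lie between consecutive exponents \<open>l (j + 1)\<close> and \<open>l j\<close>, so alternants obey
  the same recursion in the number of variables as Schur polynomials do by the branching rule.
\<close>

lemma alternant_Suc:
  assumes l: "\<And>j. j < n \<Longrightarrow> l (Suc j) \<le> l j"
  shows "alternant (Suc n) x l = (\<Sum>m\<in>PiE {..<n} (\<lambda>j. {l (Suc j)..<l j}).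
     (\<Prod>i<n. x i - x n) * (x n ^ ((\<Sum>j<n. l j - 1 - m j) + l n) * alternant n x m))"
proof -
  have "alternant (Suc n) x l = x n ^ l n * Det n (\<lambda>i j. x i ^ l j - x n ^ (l j - l (Suc j)) * x i ^ l (Suc j))"
    unfolding alternant_def by (rule Det_clear_last_row) (simp add: l flip: power_add)
  also have "Det n (\<lambda>i j. x i ^ l j - x n ^ (l j - l (Suc j)) * x i ^ l (Suc j)) =
    Det n (\<lambda>i j. (x i - x n) * (\<Sum>m\<in>{l (Suc j)..<l j}. x n ^ (l j - 1 - m) * x i ^ m))"
    by (rule Det_cong) (simp add: l diff_power_interval)
  also have "\<dots> = (\<Prod>i<n. x i - x n) *
     (\<Sum>m\<in>PiE {..<n} (\<lambda>j. {l (Suc j)..<l j}). Det n (\<lambda>i j. x n ^ (l j - 1 - m j) * x i ^ m j))"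
    unfolding Det_scale_rows by (subst Det_sum_cols) auto
  also have "(\<lambda>m. Det n (\<lambda>i j. x n ^ (l j - 1 - m j) * x i ^ m j)) =
     (\<lambda>m. x n ^ (\<Sum>j<n. l j - 1 - m j) * alternant n x m)"
    by (simp add: Det_scale_cols alternant_def power_sum)
  finally show ?thesis
    by (simp add: sum_distrib_left power_add mult_ac)
qed

text \<open>
  Jacobi's bialternant formula, valid in every commutative ring because no division takes place:
  both sides satisfy the same recursion.
\<close>

theorem bialternant: "f \<in> shapes n k \<Longrightarrow> alternant n x (beta n f) = vandermonde n x * schur_fun n f x"
proof (induction n arbitrary: f)
  case 0
  then have "f = (\<lambda>_. 0)" by (auto simp: shapes_def fun_eq_iff)
  then show ?case by (simp add: alternant_def Det_def vandermonde_def schur_fun_empty sign_id)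
next
  case (Suc n)
  let ?l = "beta (Suc n) f"
  have dec: "f (Suc j) \<le> f j" for j using Suc.prems by (simp add: shapes_def)
  have l: "?l (Suc j) \<le> ?l j" if "j < n" for j using dec[of j] by (simp add: beta_def)
  have "alternant (Suc n) x ?l = (\<Sum>m\<in>PiE {..<n} (\<lambda>j. {?l (Suc j)..<?l j}).
     (\<Prod>i<n. x i - x n) * (x n ^ ((\<Sum>j<n. ?l j - 1 - m j) + ?l n) * alternant n x m))"
    by (rule alternant_Suc) (rule l)
  also have "\<dots> = (\<Sum>g\<in>interlacing n f.
     (\<Prod>i<n. x i - x n) * (x n ^ (weight (Suc n) f - weight n g) * alternant n x (beta n g)))"
  (* Exponents m j between l (j + 1) and l j - 1 are the beta numbers of a shape interlacing f. *)
  proof (rule sum.reindex_bij_witness[where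
        i = "\<lambda>g. restrict (beta n g) {..<n}" and
        j = "\<lambda>m i. if i < n then m i - (n - 1 - i) else 0"])
    fix m assume m: "m \<in> PiE {..<n} (\<lambda>j. {?l (Suc j)..<?l j})"
    let ?g = "\<lambda>i. if i < n then m i - (n - 1 - i) else 0"
    have mi: "f (Suc i) + (n - 1 - i) \<le> m i \<and> m i < f i + (n - i)" if "i < n" for i
      using PiE_mem[OF m, of i] that by (simp add: beta_def)
    show g: "?g \<in> interlacing n f"
    proof -
      have "f (Suc i) \<le> m i - (n - 1 - i) \<and> m i - (n - 1 - i) \<le> f i" if "i < n" for i
        using mi[OF that] that by arith
      then show ?thesis unfolding interlacing_def by simp
    qed
    have bg: "beta n ?g i = m i" if "i < n" for i
    proof -
      have "m i - (n - 1 - i) + (n - 1 - i) = m i" using mi[OF that] that by arith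
      then show ?thesis using that by (simp only: beta_def if_True)
    qed
    show "restrict (beta n ?g) {..<n} = m"
    proof
      fix i show "restrict (beta n ?g) {..<n} i = m i"
        using bg PiE_arb[OF m, of i] by (cases "i < n") auto
    qed
    have "weight (Suc n) f - weight n ?g = (\<Sum>j<n. ?l j - 1 - m j) + ?l n"
    proof -
      have "weight (Suc n) f - weight n ?g = (\<Sum>i<n. f i - ?g i) + f n"
        unfolding interlacing_sum(1)[OF g] by simp
      also have "(\<Sum>i<n. f i - ?g i) = (\<Sum>j<n. ?l j - 1 - m j)"
      proof (rule sum.cong[OF refl])
        fix i assume "i \<in> {..<n}"
        then show "f i - ?g i = ?l i - 1 - m i" using mi[of i] by (auto simp: beta_def)
      qed
      finally show ?thesis by (simp add: beta_def)
    qed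
    moreover have "alternant n x (beta n ?g) = alternant n x m" using bg by (intro alternant_cong) auto
    ultimately show "(\<Prod>i<n. x i - x n) * (x n ^ (weight (Suc n) f - weight n ?g) * alternant n x (beta n ?g)) =
      (\<Prod>i<n. x i - x n) * (x n ^ ((\<Sum>j<n. ?l j - 1 - m j) + ?l n) * alternant n x m)" by simp
  next
    fix g assume g: "g \<in> interlacing n f"
    show "(\<lambda>i. if i < n then restrict (beta n g) {..<n} i - (n - 1 - i) else 0) = g"
      using g by (auto simp: fun_eq_iff beta_def interlacing_def)
    show "restrict (beta n g) {..<n} \<in> PiE {..<n} (\<lambda>j. {?l (Suc j)..<?l j})"
    proof (rule restrict_PiE_iff[THEN iffD2], rule ballI)
      fix i assume "i \<in> {..<n}"
      then have "f (Suc i) \<le> g i" "g i \<le> f i" "i < n" using g by (auto simp: interlacing_def)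
      then show "beta n g i \<in> {?l (Suc i)..<?l i}" unfolding beta_def atLeastLessThan_iff by arith
    qed
  qed
  also have "\<dots> = (\<Sum>g\<in>interlacing n f. vandermonde (Suc n) x * (schur_fun n g x * x n ^ (weight (Suc n) f - weight n g)))"
  proof (rule sum.cong[OF refl])
    fix g assume "g \<in> interlacing n f"
    then have "g \<in> shapes n k" using interlacing_shapes[OF Suc.prems] by blast
    from Suc.IH[OF this] show "(\<Prod>i<n. x i - x n) * (x n ^ (weight (Suc n) f - weight n g) * alternant n x (beta n g)) =
      vandermonde (Suc n) x * (schur_fun n g x * x n ^ (weight (Suc n) f - weight n g))"
      by (simp add: vandermonde_Suc mult_ac)
  qed
  also have "\<dots> = vandermonde (Suc n) x * schur_fun (Suc n) f x"
    unfolding schur_fun_branching[OF Suc.prems] by (simp add: sum_distrib_left)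
  finally show ?case .
qed

lemma vandermonde_alternant: "vandermonde n x = alternant n x (\<lambda>j. n - 1 - j)"
proof -
  have "alternant n x (beta n (\<lambda>_. 0)) = vandermonde n x * schur_fun n (\<lambda>_. 0) x"
    by (rule bialternant[of _ _ 0]) (simp add: shapes_def)
  then show ?thesis by (simp add: schur_fun_empty beta_def[abs_def])
qed

lemma sgn_vandermonde: "sgn (vandermonde n (x :: nat \<Rightarrow> int)) = (\<Prod>j<n. \<Prod>i<j. sgn (x i - x j))"
proof -
  have *: "sgn (prod f A) = (\<Prod>a\<in>A. sgn (f a))" if "finite A" for f :: "nat \<Rightarrow> int" and A
    using that by (induction A) (auto simp: sgn_mult)
  show ?thesis unfolding vandermonde_def by (simp add: *)
qed

text \<open>
  Permuting integer arguments multiplies the Vandermonde product by the sign of the permutation;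
  taking signs of both sides expresses the sign through the inversions.
\<close>

lemma sign_prod:
  assumes \<sigma>: "\<sigma> permutes {..<n}"
  shows "sign \<sigma> = (\<Prod>j<n. \<Prod>i<j. sgn (int (\<sigma> j) - int (\<sigma> i)))"
proof -
  have "vandermonde n (\<lambda>i. - int (\<sigma> i)) = sign \<sigma> * vandermonde n (\<lambda>i. - int i)"
    unfolding vandermonde_alternant using alternant_perm_rows[OF \<sigma>, of "\<lambda>i. - int i"] by simp
  then have "sgn (vandermonde n (\<lambda>i. - int (\<sigma> i))) = sgn (sign \<sigma>) * sgn (vandermonde n (\<lambda>i. - int i))"
    by (simp add: sgn_mult)
  moreover have "sgn (vandermonde n (\<lambda>i. - int i)) = 1"
    unfolding sgn_vandermonde by (rule prod.neutral, rule ballI, rule prod.neutral) auto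
  moreover have "sgn (sign \<sigma>) = sign \<sigma>" by (simp add: sign_def)
  ultimately show ?thesis unfolding sgn_vandermonde by simp
qed

lemma strict_inj_on:
  fixes b :: "nat \<Rightarrow> nat"
  assumes "\<And>i j. i < j \<Longrightarrow> j < n \<Longrightarrow> b j < b i"
  shows "inj_on b {..<n}"
proof (rule inj_onI)
  fix i j assume "i \<in> {..<n}" "j \<in> {..<n}" "b i = b j"
  then show "i = j" using assms[of i j] assms[of j i] by (cases i j rule: linorder_cases) auto
qed

text \<open>
  The inversions of the permutation that sorts the exponents are the pairs of positions that are in
  the wrong order.
\<close>

lemma alternant_sort:
  fixes h b :: "nat \<Rightarrow> nat" and x :: "nat \<Rightarrow> 'a::comm_ring_1"
  assumes b: "\<And>i j. i < j \<Longrightarrow> j < n \<Longrightarrow> b j < b i" and hb: "h ` {..<n} = b ` {..<n}"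
  shows "alternant n x h = of_int (\<Prod>j<n. \<Prod>i<j. sgn (int (h i) - int (h j))) * alternant n x b"
proof -
  have injb: "inj_on b {..<n}" using b by (rule strict_inj_on)
  have "card (h ` {..<n}) = n" unfolding hb using card_image[OF injb] by simp
  then have injh: "inj_on h {..<n}" by (intro eq_card_imp_inj_on) auto
  define \<sigma> where "\<sigma> i = (if i < n then the_inv_into {..<n} b (h i) else i)" for i
  have bs: "b (\<sigma> i) = h i" "\<sigma> i < n" if "i < n" for i
  proof -
    have hi: "h i \<in> b ` {..<n}" using hb that by blast
    show "b (\<sigma> i) = h i" unfolding \<sigma>_def using f_the_inv_into_f[OF injb hi] that by simp
    show "\<sigma> i < n" unfolding \<sigma>_def using the_inv_into_into[OF injb hi, of "{..<n}"] that by simp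
  qed
  have \<sigma>: "\<sigma> permutes {..<n}"
  proof (rule bij_imp_permutes)
    have "inj_on \<sigma> {..<n}"
      using bs injh by (intro inj_onI) (metis inj_onD lessThan_iff)
    moreover have "\<sigma> ` {..<n} \<subseteq> {..<n}" using bs by auto
    ultimately show "bij_betw \<sigma> {..<n} {..<n}"
      by (simp add: bij_betw_def endo_inj_surj)
  qed (simp add: \<sigma>_def)
  have sg: "sgn (int (\<sigma> j) - int (\<sigma> i)) = sgn (int (h i) - int (h j))" if "i < j" "j < n" for i j
  proof -
    have ne: "\<sigma> i \<noteq> \<sigma> j" using permutes_inj[OF \<sigma>] that by (auto dest: injD)
    show ?thesis
    proof (cases "\<sigma> i < \<sigma> j")
      case True
      then have "h j < h i" using b[of "\<sigma> i" "\<sigma> j"] bs that by simp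
      with True show ?thesis by simp
    next
      case False
      with ne have "\<sigma> j < \<sigma> i" by simp
      moreover from this have "h i < h j" using b[of "\<sigma> j" "\<sigma> i"] bs that by simp
      ultimately show ?thesis by simp
    qed
  qed
  have "alternant n x h = alternant n x (\<lambda>j. b (\<sigma> j))" using bs by (intro alternant_cong) auto
  also have "\<dots> = of_int (sign \<sigma>) * alternant n x b" by (rule alternant_perm_cols[OF \<sigma>])
  also have "sign \<sigma> = (\<Prod>j<n. \<Prod>i<j. sgn (int (h i) - int (h j)))"
    unfolding sign_prod[OF \<sigma>]
    by (intro prod.cong refl) (auto intro!: sg)
  finally show ?thesis .
qed

lemma beta_strict: "f \<in> shapes n k \<Longrightarrow> i < j \<Longrightarrow> j < n \<Longrightarrow> beta n f j < beta n f i"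
  using shapes_antimono[of f n k i j] by (simp add: beta_def)

section \<open>Laurent polynomials and specialisation\<close>

text \<open>
  Laurent polynomials over the integers are an integral domain in which the variables are invertible.
  An identity between Schur polynomials proved there specialises to every commutative ring.
\<close>

type_synonym laurent = "(nat \<Rightarrow>\<^sub>0 int) \<Rightarrow>\<^sub>0 int"

text \<open>
  A relation between two rings that is compatible with the ring operations. Every expression built
  from ring operations maps related arguments to related values. Relations serve better than homomorphisms
  here, because evaluation at arbitrary ring elements makes sense only on the Laurent polynomials without
  negative exponents, and a relation need not be defined everywhere.
\<close>

locale ring_rel =
  fixes R :: "'a::comm_ring_1 \<Rightarrow> 'b::comm_ring_1 \<Rightarrow> bool"
  assumes R_one: "R 1 1"
    and R_add: "R a b \<Longrightarrow> R c d \<Longrightarrow> R (a + c) (b + d)"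
    and R_mult: "R a b \<Longrightarrow> R c d \<Longrightarrow> R (a * c) (b * d)"
    and R_uminus: "R a b \<Longrightarrow> R (- a) (- b)"
begin

lemma R_zero: "R 0 0"
  using R_add[OF R_one R_uminus[OF R_one]] by simp

lemma R_diff: "R a b \<Longrightarrow> R c d \<Longrightarrow> R (a - c) (b - d)"
  using R_add[OF _ R_uminus, of a b c d] by simp

lemma R_sum: "(\<And>i. i \<in> I \<Longrightarrow> R (f i) (g i)) \<Longrightarrow> R (sum f I) (sum g I)"
  by (induction I rule: infinite_finite_induct) (auto intro: R_zero R_add)

lemma R_prod: "(\<And>i. i \<in> I \<Longrightarrow> R (f i) (g i)) \<Longrightarrow> R (prod f I) (prod g I)"
  by (induction I rule: infinite_finite_induct) (auto intro: R_one R_mult)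

lemma R_power: "R a b \<Longrightarrow> R (a ^ n) (b ^ n)"
  by (induction n) (auto intro: R_one R_mult)

lemma R_of_nat: "R (of_nat n) (of_nat n)"
  by (induction n) (auto intro: R_one R_zero R_add)

lemma R_of_int: "R (of_int k) (of_int k)"
  by (cases k rule: int_cases2) (auto intro: R_of_nat R_uminus)

lemma R_schur_fun: assumes "\<And>i. i < n \<Longrightarrow> R (x i) (y i)" shows "R (schur_fun n f x) (schur_fun n f y)"
  unfolding schur_fun_def by (intro R_sum R_prod assms) (rule fillings_less)

lemma R_schur: assumes "\<And>i. i < n \<Longrightarrow> R (x i) (y i)" shows "R (schur n \<pi> x) (schur n \<pi> y)"
  unfolding schur_eq_schur_fun by (rule R_schur_fun[OF assms])

lemma R_Det: 
  assumes "\<And>i j. i < n \<Longrightarrow> j < n \<Longrightarrow> R (M i j) (N i j)" shows "R (Det n M) (Det n N)"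
  unfolding Det_def
proof (intro R_sum R_mult R_of_int R_prod)
  fix \<sigma> i assume "\<sigma> \<in> {\<sigma>. \<sigma> permutes {..<n}}" "i \<in> {..<n}"
  then show "R (M i (\<sigma> i)) (N i (\<sigma> i))" using permutes_in_image[of \<sigma> "{..<n}" i] by (simp add: assms)
qed

lemma R_vandermonde: "(\<And>i. i < n \<Longrightarrow> R (x i) (y i)) \<Longrightarrow> R (vandermonde n x) (vandermonde n y)"
  unfolding vandermonde_def by (intro R_prod R_diff) auto

end

text \<open>
  The additive extension of a function on monomials. It is multiplicative as far as the function is.
\<close>

definition lin :: "((nat \<Rightarrow>\<^sub>0 int) \<Rightarrow> 'a::comm_ring_1) \<Rightarrow> laurent \<Rightarrow> 'a" where
  "lin \<chi> f = (\<Sum>m\<in>Poly_Mapping.keys f. of_int (Poly_Mapping.lookup f m) * \<chi> m)"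

lemma lin_superset:
  assumes "finite A" "Poly_Mapping.keys f \<subseteq> A"
  shows "lin \<chi> f = (\<Sum>m\<in>A. of_int (Poly_Mapping.lookup f m) * \<chi> m)"
  unfolding lin_def by (rule sum.mono_neutral_left) (use assms in \<open>auto simp: in_keys_iff\<close>)

lemma lin_add: "lin \<chi> (f + g) = lin \<chi> f + lin \<chi> g"
proof -
  let ?A = "Poly_Mapping.keys f \<union> Poly_Mapping.keys g"
  have "lin \<chi> h = (\<Sum>m\<in>?A. of_int (Poly_Mapping.lookup h m) * \<chi> m)"
    if "h \<in> {f, g, f + g}" for h
    by (rule lin_superset) (use that keys_add[of f g] in auto)
  then show ?thesis by (simp add: lookup_add algebra_simps sum.distrib)
qed

lemma lin_zero [simp]: "lin \<chi> 0 = 0"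
  by (simp add: lin_def)

lemma lin_uminus: "lin \<chi> (- f) = - lin \<chi> f"
  by (simp add: lin_def sum_negf)

lemma lin_sum: "lin \<chi> (sum f A) = (\<Sum>a\<in>A. lin \<chi> (f a))"
  by (induction A rule: infinite_finite_induct) (auto simp: lin_add)

lemma lin_single [simp]: "lin \<chi> (Poly_Mapping.single m c) = of_int c * \<chi> m"
  by (subst lin_superset[of "{m}"]) auto

lemma laurent_expand:
  fixes f :: laurent
  shows "f = (\<Sum>m\<in>Poly_Mapping.keys f. Poly_Mapping.single m (Poly_Mapping.lookup f m))"
proof (rule poly_mapping_eqI)
  fix k
  have "(\<Sum>m\<in>Poly_Mapping.keys f. Poly_Mapping.lookup (Poly_Mapping.single m (Poly_Mapping.lookup f m)) k)
      = (\<Sum>m\<in>Poly_Mapping.keys f. if m = k then Poly_Mapping.lookup f k else 0)"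
    by (rule sum.cong) (auto simp: lookup_single when_def)
  then show "Poly_Mapping.lookup f k =
    Poly_Mapping.lookup (\<Sum>m\<in>Poly_Mapping.keys f. Poly_Mapping.single m (Poly_Mapping.lookup f m)) k"
    by (simp add: lookup_sum in_keys_iff)
qed

lemma lin_mult:
  assumes "\<And>m m'. m \<in> Poly_Mapping.keys f \<Longrightarrow> m' \<in> Poly_Mapping.keys g \<Longrightarrow> \<chi> (m + m') = \<chi> m * \<chi> m'"
  shows "lin \<chi> (f * g) = lin \<chi> f * lin \<chi> g"
proof -
  let ?f = "Poly_Mapping.lookup f" and ?g = "Poly_Mapping.lookup g"
  let ?F = "Poly_Mapping.keys f" and ?G = "Poly_Mapping.keys g"
  have "f * g = (\<Sum>m\<in>?F. Poly_Mapping.single m (?f m)) * (\<Sum>m\<in>?G. Poly_Mapping.single m (?g m))"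
    by (simp flip: laurent_expand)
  also have "\<dots> = (\<Sum>m\<in>?F. \<Sum>m'\<in>?G. Poly_Mapping.single (m + m') (?f m * ?g m'))"
    by (simp add: sum_product mult_single)
  finally have "lin \<chi> (f * g) = (\<Sum>m\<in>?F. \<Sum>m'\<in>?G. of_int (?f m * ?g m') * \<chi> (m + m'))"
    by (simp add: lin_sum)
  also have "\<dots> = (\<Sum>m\<in>?F. \<Sum>m'\<in>?G. (of_int (?f m) * \<chi> m) * (of_int (?g m') * \<chi> m'))"
    by (intro sum.cong refl) (simp add: assms mult_ac)
  also have "\<dots> = lin \<chi> f * lin \<chi> g"
    unfolding lin_def by (rule sum_product[symmetric])
  finally show ?thesis .
qed

lemma ring_rel_lin:
  assumes N: "0 \<in> N" "\<And>m m'. m \<in> N \<Longrightarrow> m' \<in> N \<Longrightarrow> m + m' \<in> N"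
    and \<chi>: "\<chi> 0 = 1" "\<And>m m'. m \<in> N \<Longrightarrow> m' \<in> N \<Longrightarrow> \<chi> (m + m') = \<chi> m * \<chi> m'"
  shows "ring_rel (\<lambda>f b. Poly_Mapping.keys f \<subseteq> N \<and> lin \<chi> f = b)"
proof
  show "Poly_Mapping.keys (1::laurent) \<subseteq> N \<and> lin \<chi> 1 = 1"
    using N \<chi> by (simp add: lin_def)
next
  fix a c :: laurent and b d
  assume ab: "Poly_Mapping.keys a \<subseteq> N \<and> lin \<chi> a = b" and cd: "Poly_Mapping.keys c \<subseteq> N \<and> lin \<chi> c = d"
  show "Poly_Mapping.keys (a + c) \<subseteq> N \<and> lin \<chi> (a + c) = b + d"
    using ab cd keys_add[of a c] by (auto simp: lin_add)
  have "lin \<chi> (a * c) = lin \<chi> a * lin \<chi> c"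
    by (rule lin_mult) (use ab cd \<chi> in auto)
  then show "Poly_Mapping.keys (a * c) \<subseteq> N \<and> lin \<chi> (a * c) = b * d"
  proof -
    have "Poly_Mapping.keys (a * c) \<subseteq> N"
    proof
      fix m assume "m \<in> Poly_Mapping.keys (a * c)"
      then obtain u v where "m = u + v" "u \<in> Poly_Mapping.keys a" "v \<in> Poly_Mapping.keys c"
        using keys_mult[of a c] by blast
      then show "m \<in> N" using ab cd N(2)[of u v] by blast
    qed
    with \<open>lin \<chi> (a * c) = lin \<chi> a * lin \<chi> c\<close> ab cd show ?thesis by simp
  qed
next
  fix a :: laurent and b
  assume "Poly_Mapping.keys a \<subseteq> N \<and> lin \<chi> a = b"
  then show "Poly_Mapping.keys (- a) \<subseteq> N \<and> lin \<chi> (- a) = - b" by (simp add: lin_uminus)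
qed

definition var :: "nat \<Rightarrow> laurent" where
  "var i = Poly_Mapping.single (Poly_Mapping.single i 1) 1"

definition var_inv :: "nat \<Rightarrow> laurent" where
  "var_inv i = Poly_Mapping.single (Poly_Mapping.single i (- 1)) 1"

lemma var_var_inv: "var i * var_inv i = 1"
  unfolding var_def var_inv_def by (simp add: mult_single flip: single_add)

lemma var_power: "var i ^ e = Poly_Mapping.single (Poly_Mapping.single i (int e)) 1"
  by (induction e) (simp_all add: var_def mult_single flip: single_add)

lemma var_inject: "var i = var j \<longleftrightarrow> i = j"
proof
  assume "var i = var j"
  then have "Poly_Mapping.keys (var i) = Poly_Mapping.keys (var j)" by simp
  then have "Poly_Mapping.single i (1::int) = Poly_Mapping.single j 1" by (simp add: var_def)
  then have "Poly_Mapping.keys (Poly_Mapping.single i (1::int)) = Poly_Mapping.keys (Poly_Mapping.single j (1::int))" by simp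
  then show "i = j" by simp
qed simp

definition nonneg_exps :: "(nat \<Rightarrow>\<^sub>0 int) set" where
  "nonneg_exps = {m. \<forall>i. 0 \<le> Poly_Mapping.lookup m i}"

text \<open>
  The exponents are truncated at zero, so this is the value of a monomial only when all of them are
  nonnegative.
\<close>

definition eval_mono :: "(nat \<Rightarrow> 'a::comm_ring_1) \<Rightarrow> (nat \<Rightarrow>\<^sub>0 int) \<Rightarrow> 'a" where
  "eval_mono x m = (\<Prod>i\<in>Poly_Mapping.keys m. x i ^ nat (Poly_Mapping.lookup m i))"

lemma eval_mono_superset:
  assumes "finite A" "Poly_Mapping.keys m \<subseteq> A"
  shows "eval_mono x m = (\<Prod>i\<in>A. x i ^ nat (Poly_Mapping.lookup m i))"
  unfolding eval_mono_def by (rule prod.mono_neutral_left) (use assms in \<open>auto simp: in_keys_iff\<close>)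

lemma eval_mono_add:
  assumes "m \<in> nonneg_exps" "m' \<in> nonneg_exps"
  shows "eval_mono x (m + m') = eval_mono x m * eval_mono x m'"
proof -
  let ?A = "Poly_Mapping.keys m \<union> Poly_Mapping.keys m'"
  have "eval_mono x h = (\<Prod>i\<in>?A. x i ^ nat (Poly_Mapping.lookup h i))" if "h \<in> {m, m', m + m'}" for h
    by (rule eval_mono_superset) (use that keys_add[of m m'] in auto)
  then show ?thesis using assms
    by (simp add: lookup_add nonneg_exps_def nat_add_distrib power_add prod.distrib)
qed

definition eval_rel :: "(nat \<Rightarrow> 'a::comm_ring_1) \<Rightarrow> laurent \<Rightarrow> 'a \<Rightarrow> bool" where
  "eval_rel x f b \<longleftrightarrow> Poly_Mapping.keys f \<subseteq> nonneg_exps \<and> lin (eval_mono x) f = b"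

lemma eval_rel: "ring_rel (eval_rel x)"
  unfolding eval_rel_def[abs_def]
  by (rule ring_rel_lin) (auto simp: nonneg_exps_def lookup_add eval_mono_add, simp add: eval_mono_def)

lemma eval_rel_var: "eval_rel x (var i) (x i)"
  by (auto simp: eval_rel_def var_def nonneg_exps_def lookup_single when_def eval_mono_def)

lemma eval_rel_eq: "eval_rel x f a \<Longrightarrow> eval_rel x f b \<Longrightarrow> a = b"
  by (auto simp: eval_rel_def)

text \<open>
  The graph, for additive \<open>\<phi>\<close>, of the ring endomorphism that moves each monomial \<open>m\<close> to \<open>\<phi> m\<close>. Permutations of the
  variables and inversion of a variable are of this form.
\<close>

definition subst_rel :: "((nat \<Rightarrow>\<^sub>0 int) \<Rightarrow> (nat \<Rightarrow>\<^sub>0 int)) \<Rightarrow> laurent \<Rightarrow> laurent \<Rightarrow> bool" where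
  "subst_rel \<phi> f b \<longleftrightarrow> lin (\<lambda>m. Poly_Mapping.single (\<phi> m) 1) f = b"

lemma subst_rel:
  assumes "\<And>m m'. \<phi> (m + m') = \<phi> m + \<phi> m'"
  shows "ring_rel (subst_rel \<phi>)"
proof -
  have "\<phi> 0 = 0" using assms[of 0 0] by simp
  then have "ring_rel (\<lambda>f b. Poly_Mapping.keys f \<subseteq> UNIV \<and> lin (\<lambda>m. Poly_Mapping.single (\<phi> m) 1) f = (b :: laurent))"
    by (intro ring_rel_lin) (simp_all add: assms mult_single)
  then show ?thesis by (simp add: subst_rel_def[abs_def])
qed

lemma subst_rel_var: "\<phi> (Poly_Mapping.single i 1) = m \<Longrightarrow> subst_rel \<phi> (var i) (Poly_Mapping.single m 1)"
  by (simp add: subst_rel_def var_def)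

lemma subst_rel_lookup:
  assumes "subst_rel \<phi> f g" "inj \<phi>"
  shows "Poly_Mapping.lookup g (\<phi> m) = Poly_Mapping.lookup f m"
proof -
  have "g = (\<Sum>m\<in>Poly_Mapping.keys f. of_int (Poly_Mapping.lookup f m) * Poly_Mapping.single (\<phi> m) 1)"
    using assms(1) by (simp add: subst_rel_def lin_def)
  also have "\<dots> = (\<Sum>m\<in>Poly_Mapping.keys f. Poly_Mapping.single (\<phi> m) (Poly_Mapping.lookup f m))"
    by (rule sum.cong[OF refl]) (simp add: mult_single flip: single_of_int)
  finally have "Poly_Mapping.lookup g (\<phi> m) =
      (\<Sum>m'\<in>Poly_Mapping.keys f. Poly_Mapping.lookup (Poly_Mapping.single (\<phi> m') (Poly_Mapping.lookup f m')) (\<phi> m))"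
    by (simp add: lookup_sum)
  also have "\<dots> = (\<Sum>m'\<in>Poly_Mapping.keys f. if m' = m then Poly_Mapping.lookup f m else 0)"
    by (rule sum.cong) (use assms(2) in \<open>auto simp: lookup_single when_def inj_eq\<close>)
  finally show ?thesis by (simp add: in_keys_iff)
qed

text \<open>
  For fixed \<open>n\<close> and \<open>T\<close> this is an ideal of the polynomials with nonnegative exponents. Its elements
  act as negligible error terms in the truncated Littlewood identities.
\<close>

definition big :: "nat \<Rightarrow> int \<Rightarrow> laurent \<Rightarrow> bool" where
  "big n T f \<longleftrightarrow> (\<forall>m\<in>Poly_Mapping.keys f. m \<in> nonneg_exps \<and> (\<exists>i<n. T < Poly_Mapping.lookup m i))"

definition pos :: "laurent \<Rightarrow> bool" where
  "pos f \<longleftrightarrow> Poly_Mapping.keys f \<subseteq> nonneg_exps"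

lemma pos_rel: "ring_rel (\<lambda>f (g::laurent). pos f)"
proof
  show "pos 1" by (simp add: pos_def nonneg_exps_def)
  fix a c :: laurent
  show "pos (a + c)" if "pos a" "pos c" using that keys_add[of a c] by (auto simp: pos_def)
  show "pos (a * c)" if "pos a" "pos c"
    using that keys_mult[of a c] by (fastforce simp: pos_def nonneg_exps_def lookup_add)
  show "pos (- a)" if "pos a" using that by (simp add: pos_def)
qed

lemma pos_var: "pos (var i)"
  by (auto simp: pos_def var_def nonneg_exps_def lookup_single when_def)

lemma big_zero: "big n T 0" by (simp add: big_def)

lemma big_add: "big n T f \<Longrightarrow> big n T g \<Longrightarrow> big n T (f + g)"
  using keys_add[of f g] by (auto simp: big_def)

lemma big_uminus: "big n T f \<Longrightarrow> big n T (- f)"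
  by (simp add: big_def)

lemma big_diff: "big n T f \<Longrightarrow> big n T g \<Longrightarrow> big n T (f - g)"
  using big_add[OF _ big_uminus, of n T f g] by simp

lemma big_sum: "(\<And>i. i \<in> I \<Longrightarrow> big n T (f i)) \<Longrightarrow> big n T (sum f I)"
  by (induction I rule: infinite_finite_induct) (auto intro: big_zero big_add)

lemma big_mult:
  assumes f: "big n T f" and g: "pos g"
  shows "big n T (f * g)"
  unfolding big_def
proof
  fix m assume "m \<in> Poly_Mapping.keys (f * g)"
  then obtain a b where m: "m = a + b" and a: "a \<in> Poly_Mapping.keys f" and b: "b \<in> Poly_Mapping.keys g"
    using keys_mult[of f g] by blast
  obtain i where i: "i < n" "T < Poly_Mapping.lookup a i" and a': "a \<in> nonneg_exps" using f a by (auto simp: big_def)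
  have b': "b \<in> nonneg_exps" using g b by (auto simp: pos_def)
  have "T < Poly_Mapping.lookup m i" 
  proof -
    have "0 \<le> Poly_Mapping.lookup b i" using b' by (simp add: nonneg_exps_def)
    then show ?thesis using i by (simp add: m lookup_add)
  qed
  moreover have "m \<in> nonneg_exps" using a' b' by (simp add: m nonneg_exps_def lookup_add)
  ultimately show "m \<in> nonneg_exps \<and> (\<exists>i<n. T < Poly_Mapping.lookup m i)" using i by blast
qed

lemma big_mult_left: "big n T g \<Longrightarrow> pos f \<Longrightarrow> big n T (f * g)"
  using big_mult[of n T g f] by (simp add: mult.commute)

lemma big_mono: "big n T f \<Longrightarrow> n \<le> n' \<Longrightarrow> T' \<le> T \<Longrightarrow> big n' T' f"
  unfolding big_def by (meson le_less_trans less_le_trans)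

lemma big_var_power: "i < n \<Longrightarrow> T < int e \<Longrightarrow> big n T (var i ^ e)"
  unfolding var_power big_def by (auto simp: nonneg_exps_def lookup_single when_def)

text \<open>
  Every term of the Leibniz expansion contains one factor from column \<open>j\<close>.
\<close>

lemma big_alternant:
  assumes "j < n" "T < int (e j)"
  shows "big n T (alternant n var e)"
  unfolding alternant_def Det_def
proof (rule big_sum)
  fix \<sigma> assume "\<sigma> \<in> {\<sigma>. \<sigma> permutes {..<n}}"
  then have \<sigma>: "\<sigma> permutes {..<n}" by simp
  interpret P: ring_rel "\<lambda>f (g::laurent). pos f" by (rule pos_rel)
  obtain i where i: "\<sigma> i = j" using permutes_surj[OF \<sigma>] by (metis surjD)
  then have "i < n" using permutes_in_image[OF \<sigma>, of i] assms by simp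
  then have "(\<Prod>i<n. var i ^ e (\<sigma> i)) = var i ^ e j * (\<Prod>i\<in>{..<n} - {i}. var i ^ e (\<sigma> i))"
    by (subst prod.remove[of _ i]) (auto simp: i)
  moreover have "big n T (var i ^ e j * (\<Prod>i\<in>{..<n} - {i}. var i ^ e (\<sigma> i)))"
    by (intro big_mult big_var_power P.R_prod P.R_power pos_var assms \<open>i < n\<close>)
  ultimately show "big n T (of_int (sign \<sigma>) * (\<Prod>i<n. var i ^ e (\<sigma> i)))"
    by (auto intro: big_mult_left P.R_of_int)
qed

lemma laurent_vandermonde_nonzero: "inj_on X {..<n} \<Longrightarrow> vandermonde n X \<noteq> (0 :: laurent)"
  unfolding vandermonde_def by (auto simp: inj_on_def)

section \<open>Frobenius symbols and beta numbers\<close>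

text \<open>
  The entries of the Frobenius symbol as natural numbers, meaningful for \<open>i < rk \<pi>\<close>.
\<close>

definition arm :: "nat list \<Rightarrow> nat \<Rightarrow> nat" where
  "arm \<pi> i = part \<pi> i - Suc i"

definition leg :: "nat list \<Rightarrow> nat \<Rightarrow> nat" where
  "leg \<pi> i = col_len \<pi> i - Suc i"

lemma part_shapes:
  assumes "is_partition \<pi>" "length \<pi> \<le> n" "part \<pi> 0 \<le> k"
  shows "part \<pi> \<in> shapes n k"
proof -
  have "part \<pi> (Suc i) \<le> part \<pi> i" for i
    using assms unfolding part_def is_partition_def by (auto simp: sorted_wrt_iff_nth_less)
  then show ?thesis using assms unfolding shapes_def by (auto simp: part_def)
qed

lemma part_antimono: "is_partition \<pi> \<Longrightarrow> i \<le> j \<Longrightarrow> part \<pi> j \<le> part \<pi> i"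
  using shapes_antimono[OF part_shapes[of \<pi> "length \<pi>" "part \<pi> 0"], of i j] by simp

lemma mem_diagram: "(i, j) \<in> diagram \<pi> \<longleftrightarrow> j < part \<pi> i"
  by (simp add: diagram_cells cells_def)

lemma row_len_part: "row_len \<pi> i = part \<pi> i"
proof -
  have "{j. (i, j) \<in> diagram \<pi>} = {..<part \<pi> i}" by (auto simp: mem_diagram)
  then show ?thesis by (simp add: row_len_def)
qed

lemma col_iff:
  assumes "is_partition \<pi>"
  shows "i < col_len \<pi> j \<longleftrightarrow> j < part \<pi> i"
proof -
  have "{i. j < part \<pi> i} = {..<card {i. j < part \<pi> i}}"
  proof (rule downset_lessThan)
    have "{i. j < part \<pi> i} \<subseteq> {..<length \<pi>}" by (auto simp: part_def split: if_splits)
    then show "finite {i. j < part \<pi> i}" by (rule finite_subset) simp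
    fix i i' assume "i' \<in> {i. j < part \<pi> i}" "i \<le> i'"
    then show "i \<in> {i. j < part \<pi> i}" using part_antimono[OF assms, of i i'] by simp
  qed
  then have "{i. j < part \<pi> i} = {..<col_len \<pi> j}" by (simp add: col_len_def mem_diagram)
  then show ?thesis by (simp add: set_eq_iff)
qed

lemma rk_iff:
  assumes "is_partition \<pi>"
  shows "i < rk \<pi> \<longleftrightarrow> i < part \<pi> i"
proof -
  have "{i. i < part \<pi> i} = {..<card {i. i < part \<pi> i}}"
  proof (rule downset_lessThan)
    have "{i. i < part \<pi> i} \<subseteq> {..<length \<pi>}" by (auto simp: part_def split: if_splits)
    then show "finite {i. i < part \<pi> i}" by (rule finite_subset) simp
    fix i i' assume "i' \<in> {i. i < part \<pi> i}" "i \<le> i'"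
    then show "i \<in> {i. i < part \<pi> i}" using part_antimono[OF assms, of i i'] by simp
  qed
  then have "{i. i < part \<pi> i} = {..<rk \<pi>}" by (simp add: rk_def mem_diagram)
  then show ?thesis by (simp add: set_eq_iff)
qed

lemma col_len_antimono: "is_partition \<pi> \<Longrightarrow> i \<le> j \<Longrightarrow> col_len \<pi> j \<le> col_len \<pi> i"
  by (rule ccontr) (metis col_iff le_less_trans less_irrefl not_less)

lemma rk_less_col: assumes "is_partition \<pi>" "i < rk \<pi>" shows "i < col_len \<pi> i"
  using assms rk_iff[OF assms(1)] col_iff[OF assms(1)] by simp

lemma col_len_le: assumes "is_partition \<pi>" "length \<pi> \<le> n" shows "col_len \<pi> j \<le> n"
proof -
  have "\<not> length \<pi> < col_len \<pi> j" using col_iff[OF assms(1), of "length \<pi>" j] by (simp add: part_def)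
  then show ?thesis using assms by simp
qed

lemma arms_arm:
  assumes "is_partition \<pi>"
  shows "arms \<pi> = map (\<lambda>i. int (arm \<pi> i)) [0..<rk \<pi>]"
proof -
  have "{j. i < j \<and> (i, j) \<in> diagram \<pi>} = {Suc i..<part \<pi> i}" for i by (auto simp: mem_diagram)
  then show ?thesis by (simp add: arms_def arm_def)
qed

lemma legs_leg:
  assumes "is_partition \<pi>"
  shows "legs \<pi> = map (\<lambda>i. int (leg \<pi> i)) [0..<rk \<pi>]"
proof -
  have "{j. i < j \<and> (j, i) \<in> diagram \<pi>} = {Suc i..<col_len \<pi> i}" for i
    using col_iff[OF assms] by (auto simp: mem_diagram)
  then show ?thesis by (simp add: legs_def leg_def)
qed

lemma arm_strict:
  assumes "is_partition \<pi>" "i < j" "j < rk \<pi>"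
  shows "arm \<pi> j < arm \<pi> i"
  using part_antimono[OF assms(1), of i j] rk_iff[OF assms(1), of j] assms by (simp add: arm_def)

lemma leg_strict:
  assumes "is_partition \<pi>" "i < j" "j < rk \<pi>"
  shows "leg \<pi> j < leg \<pi> i"
  using col_len_antimono[OF assms(1), of i j] rk_less_col[OF assms(1), of j] assms by (simp add: leg_def)

lemma leg_less:
  assumes "is_partition \<pi>" "length \<pi> \<le> n" "i < rk \<pi>"
  shows "leg \<pi> i < n"
  using col_len_le[OF assms(1,2), of i] rk_less_col[OF assms(1,3)] by (simp add: leg_def)

text \<open>
  The beta numbers of the partition with rank \<open>r\<close>, arms \<open>a\<close> and legs \<open>l\<close>: those of the empty
  partition are \<open>n - 1 - j\<close> for \<open>j < n\<close>, and each diagonal hook moves the one with \<open>j = l i\<close> up to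
  \<open>n + a i\<close>.
\<close>

definition frob_set :: "nat \<Rightarrow> nat \<Rightarrow> (nat \<Rightarrow> nat) \<Rightarrow> (nat \<Rightarrow> nat) \<Rightarrow> nat set" where
  "frob_set n r a l = (\<lambda>i. n + a i) ` {..<r} \<union> (\<lambda>j. n - 1 - j) ` ({..<n} - l ` {..<r})"

lemma card_frob_set:
  assumes a: "\<And>i j. i < j \<Longrightarrow> j < r \<Longrightarrow> a j < a i"
    and l: "\<And>i j. i < j \<Longrightarrow> j < r \<Longrightarrow> l j < l i" and ln: "\<And>i. i < r \<Longrightarrow> l i < n"
  shows "card (frob_set n r a l) = n"
proof -
  have "inj_on (\<lambda>i. n + a i) {..<r}"
    using strict_inj_on[of r a] a by (auto simp: inj_on_def)
  then have 1: "card ((\<lambda>i. n + a i) ` {..<r}) = r" by (simp add: card_image)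
  have "inj_on (\<lambda>j. n - 1 - j) ({..<n} - l ` {..<r})" by (auto simp: inj_on_def)
  then have "card ((\<lambda>j. n - 1 - j) ` ({..<n} - l ` {..<r})) = card ({..<n} - l ` {..<r})"
    by (simp add: card_image)
  also have "\<dots> = n - r"
    using ln card_image[OF strict_inj_on[of r l]] l by (subst card_Diff_subset) auto
  finally have 2: "card ((\<lambda>j. n - 1 - j) ` ({..<n} - l ` {..<r})) = n - r" .
  have "r \<le> n"
    using card_mono[of "{..<n}" "l ` {..<r}"] card_image[OF strict_inj_on[of r l]] l ln by auto
  then show ?thesis unfolding frob_set_def
    by (subst card_Un_disjoint) (use 1 2 in auto)
qed

text \<open>
  Both sets have \<open>n\<close> elements, hence one inclusion suffices. Rows meeting the diagonal give the
  elements \<open>n + arm \<pi> i\<close>; a lower row \<open>i\<close> gives \<open>n - 1 - (i - part \<pi> i)\<close>.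
\<close>

lemma beta_set:
  assumes \<pi>: "is_partition \<pi>" and len: "length \<pi> \<le> n"
  shows "beta n (part \<pi>) ` {..<n} = frob_set n (rk \<pi>) (arm \<pi>) (leg \<pi>)"
proof (rule card_seteq)
  show "finite (frob_set n (rk \<pi>) (arm \<pi>) (leg \<pi>))" by (simp add: frob_set_def)
  have "inj_on (beta n (part \<pi>)) {..<n}"
    by (rule strict_inj_on) (rule beta_strict[OF part_shapes[OF \<pi> len order_refl]])
  then have "card (beta n (part \<pi>) ` {..<n}) = n" by (simp add: card_image)
  then show "card (frob_set n (rk \<pi>) (arm \<pi>) (leg \<pi>)) \<le> card (beta n (part \<pi>) ` {..<n})"
    by (subst card_frob_set) (use arm_strict[OF \<pi>] leg_strict[OF \<pi>] leg_less[OF \<pi> len] in auto)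
  show "beta n (part \<pi>) ` {..<n} \<subseteq> frob_set n (rk \<pi>) (arm \<pi>) (leg \<pi>)"
  proof (rule image_subsetI)
    fix i assume "i \<in> {..<n}"
    then have i: "i < n" by simp
    show "beta n (part \<pi>) i \<in> frob_set n (rk \<pi>) (arm \<pi>) (leg \<pi>)"
    proof (cases "i < rk \<pi>")
      case True
      then have "beta n (part \<pi>) i = n + arm \<pi> i"
        using rk_iff[OF \<pi>, of i] i unfolding beta_def arm_def by arith
      then show ?thesis using True unfolding frob_set_def by blast
    next
      case False
      then have le: "part \<pi> i \<le> i" using rk_iff[OF \<pi>, of i] by simp
      then have b: "beta n (part \<pi>) i = n - 1 - (i - part \<pi> i)" using i unfolding beta_def by arith
      (* The leg of j is larger or smaller than i - part \<pi> i according to whether (i, j) is a box. *)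
      have "i - part \<pi> i \<noteq> leg \<pi> j" if "j < rk \<pi>" for j
        using col_iff[OF \<pi>, of i j] rk_less_col[OF \<pi> that] le unfolding leg_def
        by (cases "j < part \<pi> i") auto
      then have "i - part \<pi> i \<notin> leg \<pi> ` {..<rk \<pi>}" by auto
      moreover have "i - part \<pi> i < n" using i by simp
      ultimately show ?thesis unfolding b frob_set_def by blast
    qed
  qed
qed

lemma strict_dec_unique:
  fixes b c :: "nat \<Rightarrow> nat"
  assumes b: "\<And>i j. i < j \<Longrightarrow> j < n \<Longrightarrow> b j < b i" and c: "\<And>i j. i < j \<Longrightarrow> j < n \<Longrightarrow> c j < c i"
    and eq: "b ` {..<n} = c ` {..<n}" and i: "i < n"
  shows "b i = c i"
proof -
  have srt: "sorted_wrt (<) (map d (rev [0..<n]))" if d: "\<And>i j. i < j \<Longrightarrow> j < n \<Longrightarrow> d j < d i" for d :: "nat \<Rightarrow> nat"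
    by (simp add: sorted_wrt_map sorted_wrt_rev) (simp add: sorted_wrt_iff_nth_less d)
  have "map b (rev [0..<n]) = map c (rev [0..<n])"
    by (rule strict_sorted_equal[OF srt[OF c] srt[OF b]]) (use eq in \<open>auto simp: lessThan_atLeast0\<close>)
  then show ?thesis using i by (simp add: map_eq_conv)
qed

lemma beta_inject:
  assumes "f \<in> shapes n k" "g \<in> shapes n l" "beta n f ` {..<n} = beta n g ` {..<n}"
  shows "f = g"
proof
  fix i show "f i = g i"
  proof (cases "i < n")
    case True
    then have "beta n f i = beta n g i"
      using strict_dec_unique[of n "beta n f" "beta n g" i] beta_strict[OF assms(1)] beta_strict[OF assms(2)] assms(3)
      by blast
    then show ?thesis by (simp add: beta_def)
  next
    case False
    then show ?thesis using shapes_zero[OF assms(1)] shapes_zero[OF assms(2)] by simp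
  qed
qed

lemma obtain_strict_dec:
  fixes R :: "nat set"
  assumes "finite R"
  obtains b where "\<And>i j. i < j \<Longrightarrow> j < card R \<Longrightarrow> b j < b i" "b ` {..<card R} = R"
proof -
  define xs where "xs = rev (sorted_list_of_set R)"
  have len: "length xs = card R" by (simp add: xs_def)
  have srt: "sorted_wrt (>) xs" unfolding xs_def sorted_wrt_rev by simp
  show thesis
  proof (rule that[of "\<lambda>i. xs ! i"])
    show "xs ! j < xs ! i" if "i < j" "j < card R" for i j
      using srt that len by (simp add: sorted_wrt_iff_nth_less)
    show "(\<lambda>i. xs ! i) ` {..<card R} = R"
      using nth_image[of "length xs" xs] assms unfolding len by (simp add: xs_def lessThan_atLeast0)
  qed
qed

lemma strict_dec_ge:
  fixes b :: "nat \<Rightarrow> nat"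
  assumes b: "\<And>i j. i < j \<Longrightarrow> j < n \<Longrightarrow> b j < b i" and i: "i < n"
  shows "n - 1 - i \<le> b i"
  using i
proof (induction "n - 1 - i" arbitrary: i)
  case (Suc d)
  have i': "d = n - 1 - Suc i" "Suc i < n" using Suc.hyps(2) by arith+
  have "d \<le> b (Suc i)" using Suc.hyps(1)[OF i'] i'(1) by simp
  moreover have "b (Suc i) < b i" using b[of i "Suc i"] Suc.hyps(2) by simp
  ultimately show ?case using Suc.hyps(2) by simp
qed simp

text \<open>
  Subtracting the staircase from the decreasing list of the elements of \<open>R\<close> leaves a partition.
\<close>

lemma obtain_partition_of_beta_set:
  assumes fin: "finite R" and card: "card R = n"
  obtains \<pi> where "is_partition \<pi>" "length \<pi> \<le> n" "beta n (part \<pi>) ` {..<n} = R"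
proof -
  obtain b where b: "\<And>i j. i < j \<Longrightarrow> j < n \<Longrightarrow> b j < b i" and bR: "b ` {..<n} = R"
    using obtain_strict_dec[OF fin] unfolding card by blast
  define f where "f i = (if i < n then b i - (n - 1 - i) else 0)" for i
  have "f \<in> shapes n (f 0)"
  proof -
    have "f (Suc i) \<le> f i" for i
    proof (cases "Suc i < n")
      case True
      then show ?thesis using b[of i "Suc i"] unfolding f_def by simp
    qed (simp add: f_def)
    then show ?thesis unfolding shapes_def by (auto simp: f_def)
  qed
  then have "f \<in> part ` Par n (f 0)" using bij_betw_imp_surj_on[OF part_bij_Par] by blast
  then obtain \<pi> where \<pi>P: "\<pi> \<in> Par n (f 0)" and part: "part \<pi> = f" by (metis imageE)
  have \<pi>: "is_partition \<pi>" using \<pi>P by (simp add: Par_def)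
  have len: "length \<pi> \<le> n"
    using part_eq_0_iff[OF \<pi>, of n] part by (simp add: f_def)
  have "beta n f i = b i" if "i < n" for i
    using strict_dec_ge[of n b i] b that by (simp add: beta_def f_def)
  then have "beta n f ` {..<n} = R" using bR by (metis (no_types, lifting) image_cong lessThan_iff)
  then show thesis using that[OF \<pi> len] part by simp
qed

text \<open>
  Beta numbers determine the symbol: the elements from \<open>n\<close> upwards are the arms shifted by \<open>n\<close>,
  and the gaps below \<open>n\<close> are the legs.
\<close>

lemma frob_exists:
  assumes a: "\<And>i j. i < j \<Longrightarrow> j < r \<Longrightarrow> a j < a i"
    and l: "\<And>i j. i < j \<Longrightarrow> j < r \<Longrightarrow> l j < l i" and ln: "\<And>i. i < r \<Longrightarrow> l i < n"
  obtains \<pi> where "is_partition \<pi>" "length \<pi> \<le> n" "rk \<pi> = r"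
    "\<And>i. i < r \<Longrightarrow> arm \<pi> i = a i" "\<And>i. i < r \<Longrightarrow> leg \<pi> i = l i"
proof -
  let ?R = "frob_set n r a l"
  have card: "card ?R = n" by (rule card_frob_set[OF a l ln])
  have fin: "finite ?R" by (simp add: frob_set_def)
  obtain \<pi> where \<pi>: "is_partition \<pi>" and len: "length \<pi> \<le> n" and "beta n (part \<pi>) ` {..<n} = ?R"
    by (rule obtain_partition_of_beta_set[OF fin card])
  then have eq: "frob_set n (rk \<pi>) (arm \<pi>) (leg \<pi>) = ?R" by (simp add: beta_set)
  have upper: "(\<lambda>e. e - n) ` {e \<in> frob_set n r' a' l'. n \<le> e} = a' ` {..<r'}" if "\<And>i. i < r' \<Longrightarrow> l' i < n" for r' a' l'
    by (force simp: frob_set_def image_iff)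
  have lower: "{j. j < n \<and> n - 1 - j \<notin> frob_set n r' a' l'} = l' ` {..<r'}" if "\<And>i. i < r' \<Longrightarrow> l' i < n" for r' a' l'
  proof (rule Set.set_eqI)
    fix j
    have "n - 1 - j \<in> frob_set n r' a' l' \<longleftrightarrow> j \<notin> l' ` {..<r'}" if "j < n"
    proof -
      have "n - 1 - j = n - 1 - j' \<longleftrightarrow> j = j'" if "j' < n" for j' using \<open>j < n\<close> that by arith
      moreover have "n - 1 - j \<noteq> n + c" for c using \<open>j < n\<close> by arith
      ultimately show ?thesis using \<open>j < n\<close> unfolding frob_set_def by blast
    qed
    then show "j \<in> {j. j < n \<and> n - 1 - j \<notin> frob_set n r' a' l'} \<longleftrightarrow> j \<in> l' ` {..<r'}"
      using that by auto
  qed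
  have L: "leg \<pi> ` {..<rk \<pi>} = l ` {..<r}"
    using lower[of "rk \<pi>" "leg \<pi>" "arm \<pi>"] lower[of r l a] leg_less[OF \<pi> len] ln eq by simp
  have A: "arm \<pi> ` {..<rk \<pi>} = a ` {..<r}"
    using upper[of "rk \<pi>" "leg \<pi>" "arm \<pi>"] upper[of r l a] leg_less[OF \<pi> len] ln eq by simp
  have rk: "rk \<pi> = r"
    using arg_cong[OF L, of card] card_image[OF strict_inj_on[of r l]] l
      card_image[OF strict_inj_on[of "rk \<pi>" "leg \<pi>"]] leg_strict[OF \<pi>] by simp
  show thesis
  proof (rule that[OF \<pi> len rk])
    show "arm \<pi> i = a i" if "i < r" for i
      using strict_dec_unique[of r "arm \<pi>" a i] arm_strict[OF \<pi>] a A that unfolding rk by blast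
    show "leg \<pi> i = l i" if "i < r" for i
      using strict_dec_unique[of r "leg \<pi>" l i] leg_strict[OF \<pi>] l L that unfolding rk by blast
  qed
qed

lemma frob_set_cong:
  assumes "\<And>i. i < r \<Longrightarrow> a i = a' i" "\<And>i. i < r \<Longrightarrow> l i = l' i"
  shows "frob_set n r a l = frob_set n r a' l'"
proof -
  have "(\<lambda>i. n + a i) ` {..<r} = (\<lambda>i. n + a' i) ` {..<r}" using assms(1) by (intro image_cong) auto
  moreover have "l ` {..<r} = l' ` {..<r}" using assms(2) by (intro image_cong) auto
  ultimately show ?thesis unfolding frob_set_def by simp
qed

lemma frob_unique:
  assumes \<pi>: "is_partition \<pi>" and \<sigma>: "is_partition \<sigma>" and rk: "rk \<pi> = rk \<sigma>"
    and a: "\<And>i. i < rk \<sigma> \<Longrightarrow> arm \<pi> i = arm \<sigma> i" and l: "\<And>i. i < rk \<sigma> \<Longrightarrow> leg \<pi> i = leg \<sigma> i"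
  shows "\<pi> = \<sigma>"
proof -
  define n where "n = max (length \<pi>) (length \<sigma>)"
  have len: "length \<pi> \<le> n" "length \<sigma> \<le> n" by (auto simp: n_def)
  have "beta n (part \<pi>) ` {..<n} = beta n (part \<sigma>) ` {..<n}"
    unfolding beta_set[OF \<pi> len(1)] beta_set[OF \<sigma> len(2)] rk by (rule frob_set_cong[OF a l])
  then have "part \<pi> = part \<sigma>"
    by (rule beta_inject[OF part_shapes[OF \<pi> len(1) order_refl] part_shapes[OF \<sigma> len(2) order_refl]])
  then show ?thesis by (rule part_inject[OF \<pi> \<sigma>])
qed

lemma is_frobenius_iff:
  "is_frobenius \<pi> (map (\<lambda>i. int (a i)) [0..<r]) (map (\<lambda>i. int (l i)) [0..<r]) \<longleftrightarrow>
   is_partition \<pi> \<and> rk \<pi> = r \<and> (\<forall>i<r. arm \<pi> i = a i \<and> leg \<pi> i = l i)" (is "?F \<longleftrightarrow> ?G")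
proof
  assume F: ?F
  then have \<pi>: "is_partition \<pi>" by (simp add: is_frobenius_def)
  have eqs: "map (\<lambda>i. int (arm \<pi> i)) [0..<rk \<pi>] = map (\<lambda>i. int (a i)) [0..<r]"
    "map (\<lambda>i. int (leg \<pi> i)) [0..<rk \<pi>] = map (\<lambda>i. int (l i)) [0..<r]"
    using F unfolding is_frobenius_def arms_arm[OF \<pi>] legs_leg[OF \<pi>] by auto
  from arg_cong[OF eqs(1), of length] have rk: "rk \<pi> = r" by simp
  with eqs \<pi> show ?G by auto
next
  assume G: ?G
  then have \<pi>: "is_partition \<pi>" by simp
  show ?F unfolding is_frobenius_def arms_arm[OF \<pi>] legs_leg[OF \<pi>] using G by auto
qed

lemma frobenius_eq:
  assumes "is_frobenius \<pi> \<alpha> \<beta>"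
  shows "frobenius \<alpha> \<beta> = \<pi>"
  unfolding frobenius_def
proof (rule the_equality[where P = "\<lambda>\<pi>. is_frobenius \<pi> \<alpha> \<beta>", OF assms])
  fix \<sigma> assume "is_frobenius \<sigma> \<alpha> \<beta>"
  then have \<sigma>: "is_partition \<sigma>" and s: "arms \<sigma> = \<alpha>" "legs \<sigma> = \<beta>" by (auto simp: is_frobenius_def)
  have \<pi>: "is_partition \<pi>" and p: "arms \<pi> = \<alpha>" "legs \<pi> = \<beta>" using assms by (auto simp: is_frobenius_def)
  have "is_frobenius \<sigma> (map (\<lambda>i. int (arm \<pi> i)) [0..<rk \<pi>]) (map (\<lambda>i. int (leg \<pi> i)) [0..<rk \<pi>])"
    using \<sigma> s p unfolding is_frobenius_def arms_arm[OF \<pi>] legs_leg[OF \<pi>] by simp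
  then show "\<sigma> = \<pi>" unfolding is_frobenius_iff using frob_unique[OF \<sigma> \<pi>] by auto
qed

text \<open>
  The boxes are counted above, below and on the diagonal.
\<close>

lemma boxes_frob:
  assumes \<pi>: "is_partition \<pi>"
  shows "boxes \<pi> = (\<Sum>i<rk \<pi>. arm \<pi> i + leg \<pi> i + 1)"
proof -
  have A: "card {c \<in> diagram \<pi>. fst c < snd c} = (\<Sum>i<rk \<pi>. arm \<pi> i)"
  proof -
    have "{c \<in> diagram \<pi>. fst c < snd c} = (SIGMA i:{..<rk \<pi>}. {Suc i..<part \<pi> i})"
      using rk_iff[OF \<pi>] by (auto simp: mem_diagram intro: less_trans)
    then show ?thesis by (simp add: arm_def)
  qed
  have L: "card {c \<in> diagram \<pi>. snd c < fst c} = (\<Sum>i<rk \<pi>. leg \<pi> i)"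
  proof -
    have "{c \<in> diagram \<pi>. snd c < fst c} = (\<lambda>(j, i). (i, j)) ` (SIGMA j:{..<rk \<pi>}. {Suc j..<col_len \<pi> j})"
    proof (intro Set.set_eqI iffI)
      fix c assume "c \<in> {c \<in> diagram \<pi>. snd c < fst c}"
      then obtain i j where c: "c = (i, j)" and ij: "j < part \<pi> i" "j < i" by (cases c) (auto simp: mem_diagram)
      have "j < rk \<pi>" using ij part_antimono[OF \<pi>, of j i] rk_iff[OF \<pi>, of j] by simp
      moreover have "i < col_len \<pi> j" using col_iff[OF \<pi>] ij by simp
      ultimately have "(j, i) \<in> (SIGMA j:{..<rk \<pi>}. {Suc j..<col_len \<pi> j})" using ij by simp
      then show "c \<in> (\<lambda>(j, i). (i, j)) ` (SIGMA j:{..<rk \<pi>}. {Suc j..<col_len \<pi> j})"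
        unfolding c by force
    next
      fix c assume "c \<in> (\<lambda>(j, i). (i, j)) ` (SIGMA j:{..<rk \<pi>}. {Suc j..<col_len \<pi> j})"
      then show "c \<in> {c \<in> diagram \<pi>. snd c < fst c}" using col_iff[OF \<pi>] by (auto simp: mem_diagram)
    qed
    moreover have "inj_on (\<lambda>(j, i). (i, j)) (SIGMA j:{..<rk \<pi>}. {Suc j..<col_len \<pi> j})"
      by (auto simp: inj_on_def)
    ultimately show ?thesis by (simp add: card_image leg_def)
  qed
  have D: "card {c \<in> diagram \<pi>. fst c = snd c} = rk \<pi>"
  proof -
    have "{c \<in> diagram \<pi>. fst c = snd c} = (\<lambda>i. (i, i)) ` {..<rk \<pi>}"
    proof -
      have "(i, i) \<in> diagram \<pi> \<longleftrightarrow> i < rk \<pi>" for i by (simp only: mem_diagram rk_iff[OF \<pi>])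
      then show ?thesis by force
    qed
    moreover have "inj_on (\<lambda>i. (i, i)) {..<rk \<pi>}" by (auto simp: inj_on_def)
    ultimately show ?thesis by (simp add: card_image)
  qed
  have fin: "finite (diagram \<pi>)"
    unfolding diagram_cells by (rule finite_cells[OF part_shapes[OF \<pi> order_refl order_refl]])
  have "diagram \<pi> = {c \<in> diagram \<pi>. fst c < snd c} \<union> ({c \<in> diagram \<pi>. snd c < fst c} \<union> {c \<in> diagram \<pi>. fst c = snd c})"
    by auto
  then have "boxes \<pi> = card ({c \<in> diagram \<pi>. fst c < snd c} \<union> ({c \<in> diagram \<pi>. snd c < fst c} \<union> {c \<in> diagram \<pi>. fst c = snd c}))"
    by (simp add: boxes_def)
  also have "\<dots> = card {c \<in> diagram \<pi>. fst c < snd c} + (card {c \<in> diagram \<pi>. snd c < fst c} + card {c \<in> diagram \<pi>. fst c = snd c})"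
    using fin by (subst card_Un_disjoint, simp, simp, force, subst card_Un_disjoint) auto
  finally show ?thesis using A L D by (simp only: sum.distrib) simp
qed

lemma boxes_weight: "is_partition \<pi> \<Longrightarrow> length \<pi> \<le> n \<Longrightarrow> boxes \<pi> = weight n (part \<pi>)"
  unfolding boxes_def diagram_cells by (rule card_cells[OF part_shapes[OF _ _ order_refl]])

text \<open>
  The beta numbers of a partition whose arms are a function \<open>A\<close> of its legs \<open>L\<close>, listed by position:
  the exponent \<open>n - 1 - j\<close> of the empty partition is replaced in place when \<open>j\<close> is a leg. This is the order in
  which such exponents come out of a determinant expanded column by column.
\<close>

definition flip_exp :: "nat \<Rightarrow> nat set \<Rightarrow> (nat \<Rightarrow> nat) \<Rightarrow> nat \<Rightarrow> nat" where
  "flip_exp n L A j = (if j \<in> L then n + A j else n - 1 - j)"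

definition leg_set :: "nat list \<Rightarrow> nat set" where
  "leg_set \<pi> = leg \<pi> ` {..<rk \<pi>}"

lemma leg_set_inj: "is_partition \<pi> \<Longrightarrow> inj_on (leg \<pi>) {..<rk \<pi>}"
  by (rule strict_inj_on) (rule leg_strict)

text \<open>
  A raised exponent at position \<open>j\<close> exceeds all \<open>j\<close> exponents before it, and the remaining
  positions are already in decreasing order. Sorting therefore costs the sign \<open>(-1)\<close> to the sum of
  the legs.
\<close>

lemma alternant_flip_exp:
  fixes x :: "nat \<Rightarrow> 'a::comm_ring_1"
  assumes \<pi>: "is_partition \<pi>" and len: "length \<pi> \<le> n"
    and A: "\<And>i. i < rk \<pi> \<Longrightarrow> arm \<pi> i = A (leg \<pi> i)"
  shows "alternant n x (flip_exp n (leg_set \<pi>) A) = (- 1) ^ (\<Sum>(leg_set \<pi>)) * (vandermonde n x * schur n \<pi> x)"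
proof -
  let ?L = "leg_set \<pi>" and ?h = "flip_exp n (leg_set \<pi>) A"
  have Ln: "?L \<subseteq> {..<n}" using leg_less[OF \<pi> len] by (auto simp: leg_set_def)
  have "?h ` {..<n} = (\<lambda>j. n + A j) ` ?L \<union> (\<lambda>j. n - 1 - j) ` ({..<n} - ?L)"
    using Ln by (auto simp: flip_exp_def image_iff)
  also have "(\<lambda>j. n + A j) ` ?L = (\<lambda>i. n + arm \<pi> i) ` {..<rk \<pi>}"
    unfolding leg_set_def image_image using A by (intro image_cong) auto
  finally have img: "?h ` {..<n} = beta n (part \<pi>) ` {..<n}"
    unfolding beta_set[OF \<pi> len] frob_set_def leg_set_def .
  have Amono: "A j < A j'" if jj: "j \<in> ?L" "j' \<in> ?L" "j < j'" for j j'
  proof -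
    obtain i i' where i: "j = leg \<pi> i" "i < rk \<pi>" "j' = leg \<pi> i'" "i' < rk \<pi>"
      using jj by (auto simp: leg_set_def)
    then have "i' < i" using jj leg_strict[OF \<pi>, of i i'] by (cases i i' rule: linorder_cases) auto
    then show ?thesis using arm_strict[OF \<pi>, of i' i] A i by simp
  qed
  have sg: "(\<Prod>i<j. sgn (int (?h i) - int (?h j))) = (if j \<in> ?L then (- 1) ^ j else 1)" if "j < n" for j
  proof (cases "j \<in> ?L")
    case True
    have "sgn (int (?h i) - int (?h j)) = - 1" if "i < j" for i
      using Amono[of i j] True that \<open>j < n\<close> by (auto simp: flip_exp_def)
    then show ?thesis using True by simp
  next
    case False
    have "sgn (int (?h i) - int (?h j)) = 1" if "i < j" for i
      using False that \<open>j < n\<close> by (auto simp: flip_exp_def)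
    then show ?thesis using False by simp
  qed
  have "(\<Prod>j<n. \<Prod>i<j. sgn (int (?h i) - int (?h j))) = (\<Prod>j<n. if j \<in> ?L then (- 1) ^ j else 1)"
    by (rule prod.cong[OF refl]) (simp add: sg)
  also have "\<dots> = (\<Prod>j\<in>?L. (- 1) ^ j)"
    using Ln by (simp add: prod.If_cases Int_absorb1)
  also have "\<dots> = (- 1) ^ (\<Sum>?L)" by (simp add: power_sum)
  finally have sgn: "(\<Prod>j<n. \<Prod>i<j. sgn (int (?h i) - int (?h j))) = (- 1) ^ (\<Sum>?L)" .
  have "alternant n x ?h = of_int ((- 1) ^ (\<Sum>?L)) * alternant n x (beta n (part \<pi>))"
    unfolding sgn[symmetric] by (rule alternant_sort[OF _ img]) (rule beta_strict[OF part_shapes[OF \<pi> len order_refl]])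
  then show ?thesis unfolding schur_eq_schur_fun by (simp add: bialternant[OF part_shapes[OF \<pi> len order_refl]])
qed

lemma Nil_partition: "is_partition []" by (simp add: is_partition_def)

lemma rk_0_iff: assumes "is_partition \<pi>" shows "rk \<pi> = 0 \<longleftrightarrow> \<pi> = []"
proof
  assume "rk \<pi> = 0"
  then have "part \<pi> 0 = 0" using rk_iff[OF assms, of 0] by simp
  then show "\<pi> = []" using part_eq_0_iff[OF assms, of 0] by simp
qed (simp add: rk_def diagram_def)

lemma length_le_legs:
  assumes \<pi>: "is_partition \<pi>"
  shows "length \<pi> \<le> n \<longleftrightarrow> (rk \<pi> = 0 \<or> leg \<pi> 0 < n)"
proof (cases "rk \<pi> = 0")
  case False
  then have "0 < col_len \<pi> 0" using rk_less_col[OF \<pi>, of 0] by simp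
  moreover have "col_len \<pi> 0 = length \<pi>"
  proof -
    have "i < col_len \<pi> 0 \<longleftrightarrow> i < length \<pi>" for i
      using col_iff[OF \<pi>, of i 0] part_eq_0_iff[OF \<pi>, of i] by auto
    then show ?thesis by (metis less_irrefl linorder_neqE_nat)
  qed
  ultimately show ?thesis using False unfolding leg_def by arith
qed (use rk_0_iff[OF \<pi>] in simp)

lemma hd_legs_less_iff:
  assumes "is_partition \<pi>"
  shows "(legs \<pi> \<noteq> [] \<longrightarrow> hd (legs \<pi>) < int n) \<longleftrightarrow> length \<pi> \<le> n"
  unfolding legs_leg[OF assms] length_le_legs[OF assms] by (cases "rk \<pi> = 0") (simp_all add: hd_map)

lemma shifted_frobs_iff:
  "\<pi> \<in> shifted_frobs m n \<longleftrightarrow> is_partition \<pi> \<and> length \<pi> \<le> n \<and>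
     (\<forall>i<rk \<pi>. int (arm \<pi> i) = int (leg \<pi> i) + m)"
proof -
  have "(\<exists>\<alpha>. is_frobenius \<pi> (shift \<alpha> m) \<alpha> \<and> (\<alpha> \<noteq> [] \<longrightarrow> hd \<alpha> < int n)) \<longleftrightarrow>
    is_partition \<pi> \<and> arms \<pi> = shift (legs \<pi>) m \<and> (legs \<pi> \<noteq> [] \<longrightarrow> hd (legs \<pi>) < int n)"
    unfolding is_frobenius_def by auto
  moreover have "arms \<pi> = shift (legs \<pi>) m \<longleftrightarrow> (\<forall>i<rk \<pi>. int (arm \<pi> i) = int (leg \<pi> i) + m)"
    if "is_partition \<pi>"
    unfolding arms_arm[OF that] legs_leg[OF that] shift_def by auto
  ultimately show ?thesis unfolding shifted_frobs_def using hd_legs_less_iff by auto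
qed

text \<open>
  In a symbol \<open>(\<alpha> + m | \<alpha>)\<close> the arms are a function of the legs, so the legs determine the partition.
  As shifting preserves the order, every set of legs whose shifts are nonnegative is realised.
\<close>

lemma shifted_frobs_bij:
  "bij_betw leg_set (shifted_frobs m n) {L. L \<subseteq> {..<n} \<and> (\<forall>j\<in>L. 0 \<le> int j + m)}"
proof (rule bij_betw_imageI)
  show "inj_on leg_set (shifted_frobs m n)"
  proof (rule inj_onI)
    fix \<pi> \<sigma> assume p: "\<pi> \<in> shifted_frobs m n" and s: "\<sigma> \<in> shifted_frobs m n" and eq: "leg_set \<pi> = leg_set \<sigma>"
    have \<pi>: "is_partition \<pi>" and \<sigma>: "is_partition \<sigma>" using p s by (auto simp: shifted_frobs_iff)
    have rk: "rk \<pi> = rk \<sigma>"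
      using arg_cong[OF eq, of card] card_image[OF leg_set_inj[OF \<pi>]] card_image[OF leg_set_inj[OF \<sigma>]]
      by (simp add: leg_set_def)
    have leg: "leg \<pi> i = leg \<sigma> i" if "i < rk \<sigma>" for i
      using strict_dec_unique[of "rk \<sigma>" "leg \<pi>" "leg \<sigma>" i] leg_strict[OF \<pi>] leg_strict[OF \<sigma>] eq that
      unfolding leg_set_def rk by blast
    moreover have "arm \<pi> i = arm \<sigma> i" if "i < rk \<sigma>" for i
    proof -
      have "int (arm \<pi> i) = int (arm \<sigma> i)"
        using p s leg[OF that] that rk unfolding shifted_frobs_iff by simp
      then show ?thesis by simp
    qed
    ultimately show "\<pi> = \<sigma>" by (intro frob_unique[OF \<pi> \<sigma> rk]) auto
  qed
  show "leg_set ` shifted_frobs m n = {L. L \<subseteq> {..<n} \<and> (\<forall>j\<in>L. 0 \<le> int j + m)}"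
  proof (intro Set.set_eqI iffI)
    fix L assume "L \<in> leg_set ` shifted_frobs m n"
    then obtain \<pi> where p: "\<pi> \<in> shifted_frobs m n" and L: "L = leg_set \<pi>" by auto
    have "0 \<le> int (leg \<pi> i) + m" if "i < rk \<pi>" for i
      using p that unfolding shifted_frobs_iff by (metis of_nat_0_le_iff)
    moreover have "leg \<pi> i < n" if "i < rk \<pi>" for i
      using p leg_less[of \<pi> n i] that unfolding shifted_frobs_iff by blast
    ultimately show "L \<in> {L. L \<subseteq> {..<n} \<and> (\<forall>j\<in>L. 0 \<le> int j + m)}"
      unfolding L leg_set_def by auto
  next
    fix L assume "L \<in> {L. L \<subseteq> {..<n} \<and> (\<forall>j\<in>L. 0 \<le> int j + m)}"
    then have L: "L \<subseteq> {..<n}" "\<And>j. j \<in> L \<Longrightarrow> 0 \<le> int j + m" by auto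
    then have fin: "finite L" by (auto intro: finite_subset)
    obtain l where l: "\<And>i j. i < j \<Longrightarrow> j < card L \<Longrightarrow> l j < l i" "l ` {..<card L} = L"
      using obtain_strict_dec[OF fin] by blast
    have lL: "l i \<in> L" if "i < card L" for i using l(2) that by blast
    obtain \<pi> where \<pi>: "is_partition \<pi>" "length \<pi> \<le> n" "rk \<pi> = card L"
      "\<And>i. i < card L \<Longrightarrow> arm \<pi> i = nat (int (l i) + m)" "\<And>i. i < card L \<Longrightarrow> leg \<pi> i = l i"
    proof (rule frob_exists[of "card L" "\<lambda>i. nat (int (l i) + m)" l n])
      show "nat (int (l j) + m) < nat (int (l i) + m)" if "i < j" "j < card L" for i j
        using l(1)[OF that] L(2)[OF lL, of i] L(2)[OF lL, of j] that by simp
      show "l i < n" if "i < card L" for i using lL[OF that] L(1) by auto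
    qed (use l in blast)+
    have "leg_set \<pi> = l ` {..<card L}" unfolding leg_set_def \<pi>(3) using \<pi>(5) by (intro image_cong) auto
    then have "leg_set \<pi> = L" using l(2) by simp
    moreover have "\<pi> \<in> shifted_frobs m n"
      unfolding shifted_frobs_iff using \<pi> L(2)[OF lL] by simp
    ultimately show "L \<in> leg_set ` shifted_frobs m n" by blast
  qed
qed

lemma shifted_frobs_alternant:
  assumes "\<pi> \<in> shifted_frobs m n"
  shows "alternant n x (flip_exp n (leg_set \<pi>) (\<lambda>j. nat (int j + m))) = (- 1) ^ (\<Sum>(leg_set \<pi>)) * (vandermonde n x * schur n \<pi> x)"
  using assms unfolding shifted_frobs_iff by (intro alternant_flip_exp) (auto simp: nat_eq_iff2)

lemma card_leg_set: "is_partition \<pi> \<Longrightarrow> card (leg_set \<pi>) = rk \<pi>"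
  unfolding leg_set_def by (simp add: card_image[OF leg_set_inj])

lemma shifted_frobs_boxes:
  assumes "\<pi> \<in> shifted_frobs m n"
  shows "int (boxes \<pi>) = 2 * int (\<Sum>(leg_set \<pi>)) + (m + 1) * int (rk \<pi>)"
proof -
  have \<pi>: "is_partition \<pi>" using assms by (simp add: shifted_frobs_iff)
  have "\<Sum>(leg_set \<pi>) = (\<Sum>i<rk \<pi>. leg \<pi> i)"
    unfolding leg_set_def by (rule sum.reindex_cong[OF leg_set_inj[OF \<pi>]]) auto
  moreover have "int (boxes \<pi>) = (\<Sum>i<rk \<pi>. 2 * int (leg \<pi> i) + (m + 1))"
    unfolding boxes_frob[OF \<pi>] of_nat_sum by (rule sum.cong) (use assms in \<open>auto simp: shifted_frobs_iff\<close>)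
  ultimately show ?thesis by (simp add: sum.distrib sum_distrib_left)
qed

section \<open>Schur polynomials of rectangles\<close>

lemma conjugate_partition:
  assumes \<pi>: "is_partition \<pi>"
  shows "is_partition (Defs.conjugate \<pi>)" "part (Defs.conjugate \<pi>) = col_len \<pi>"
    "length (Defs.conjugate \<pi>) = part \<pi> 0" "rk (Defs.conjugate \<pi>) = rk \<pi>"
    "arm (Defs.conjugate \<pi>) = leg \<pi>" "leg (Defs.conjugate \<pi>) = arm \<pi>"
proof -
  have pos: "0 < col_len \<pi> j \<longleftrightarrow> j < part \<pi> 0" for j by (rule col_iff[OF \<pi>])
  show len: "length (Defs.conjugate \<pi>) = part \<pi> 0" by (simp add: Defs.conjugate_def row_len_part)
  show part: "part (Defs.conjugate \<pi>) = col_len \<pi>"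
  proof
    fix j show "part (Defs.conjugate \<pi>) j = col_len \<pi> j"
      using pos[of j] by (cases "j < part \<pi> 0") (simp_all add: part_def Defs.conjugate_def row_len_part[unfolded part_def])
  qed
  show c: "is_partition (Defs.conjugate \<pi>)"
    unfolding is_partition_def
  proof
    show "sorted_wrt (\<ge>) (Defs.conjugate \<pi>)"
      by (simp add: Defs.conjugate_def sorted_wrt_iff_nth_less col_len_antimono[OF \<pi>])
    show "0 \<notin> set (Defs.conjugate \<pi>)"
    proof
      assume "0 \<in> set (Defs.conjugate \<pi>)"
      then obtain j where "j < part \<pi> 0" "col_len \<pi> j = 0" unfolding Defs.conjugate_def row_len_part by auto
      with pos[of j] show False by linarith
    qed
  qed
  have "i < rk (Defs.conjugate \<pi>) \<longleftrightarrow> i < rk \<pi>" for i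
    by (simp only: rk_iff[OF c] rk_iff[OF \<pi>] part col_iff[OF \<pi>])
  then show "rk (Defs.conjugate \<pi>) = rk \<pi>" by (metis less_irrefl linorder_neqE_nat)
  show "arm (Defs.conjugate \<pi>) = leg \<pi>" by (simp add: fun_eq_iff arm_def leg_def part)
  have "col_len (Defs.conjugate \<pi>) j = part \<pi> j" for j
  proof -
    have "i < col_len (Defs.conjugate \<pi>) j \<longleftrightarrow> i < part \<pi> j" for i
      by (simp only: col_iff[OF c] part col_iff[OF \<pi>])
    then show ?thesis by (metis less_irrefl linorder_neqE_nat)
  qed
  then show "leg (Defs.conjugate \<pi>) = arm \<pi>" by (simp add: fun_eq_iff arm_def leg_def)
qed

lemma Par_iff: "\<pi> \<in> Par n k \<longleftrightarrow> is_partition \<pi> \<and> length \<pi> \<le> n \<and> part \<pi> 0 \<le> k"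
proof
  assume "\<pi> \<in> Par n k"
  then have p: "is_partition \<pi>" and f: "part \<pi> \<in> shapes n k"
    using part_bij_Par[of n k] unfolding bij_betw_def by (auto simp: Par_def)
  show "is_partition \<pi> \<and> length \<pi> \<le> n \<and> part \<pi> 0 \<le> k"
    using p part_eq_0_iff[OF p, of n] shapes_zero[OF f, of n] shapes_le[OF f, of 0] by simp
next
  assume *: "is_partition \<pi> \<and> length \<pi> \<le> n \<and> part \<pi> 0 \<le> k"
  then have "part \<pi> \<in> part ` Par n k"
    using part_shapes[of \<pi> n k] bij_betw_imp_surj_on[OF part_bij_Par[of n k]] by simp
  then obtain \<sigma> where s: "part \<pi> = part \<sigma>" "\<sigma> \<in> Par n k" by (rule imageE)
  then have "\<pi> = \<sigma>" using * by (intro part_inject) (auto simp: Par_def)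
  then show "\<pi> \<in> Par n k" using s by simp
qed

lemma conjugate_Par: "\<pi> \<in> Par p q \<Longrightarrow> Defs.conjugate \<pi> \<in> Par q p"
  using conjugate_partition[of \<pi>] col_len_le[of \<pi> p 0] by (simp add: Par_iff)

lemma pi_x_frob:
  assumes \<mu>: "is_partition \<mu>" and len: "length \<mu> \<le> n"
  shows "is_partition (pi_x k \<mu>)" "length (pi_x k \<mu>) \<le> n" "rk (pi_x k \<mu>) = rk \<mu>"
    "\<And>i. i < rk \<mu> \<Longrightarrow> arm (pi_x k \<mu>) i = arm \<mu> i + k"
    "\<And>i. i < rk \<mu> \<Longrightarrow> leg (pi_x k \<mu>) i = leg \<mu> i"
proof -
  obtain \<pi> where \<pi>: "is_partition \<pi>" "length \<pi> \<le> n" "rk \<pi> = rk \<mu>"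
    "\<And>i. i < rk \<mu> \<Longrightarrow> arm \<pi> i = arm \<mu> i + k" "\<And>i. i < rk \<mu> \<Longrightarrow> leg \<pi> i = leg \<mu> i"
    using frob_exists[of "rk \<mu>" "\<lambda>i. arm \<mu> i + k" "leg \<mu>" n]
      arm_strict[OF \<mu>] leg_strict[OF \<mu>] leg_less[OF \<mu> len] by auto
  have "is_frobenius \<pi> (map (\<lambda>i. int (arm \<mu> i + k)) [0..<rk \<mu>]) (map (\<lambda>i. int (leg \<mu> i)) [0..<rk \<mu>])"
    unfolding is_frobenius_iff using \<pi> by simp
  moreover have "map (\<lambda>i. int (arm \<mu> i + k)) [0..<rk \<mu>] = shift (arms \<mu>) (int k)"
    by (simp add: arms_arm[OF \<mu>] shift_def)
  ultimately have "pi_x k \<mu> = \<pi>"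
    unfolding pi_x_def legs_leg[OF \<mu>] by (simp add: frobenius_eq)
  then show "is_partition (pi_x k \<mu>)" "length (pi_x k \<mu>) \<le> n" "rk (pi_x k \<mu>) = rk \<mu>"
    "\<And>i. i < rk \<mu> \<Longrightarrow> arm (pi_x k \<mu>) i = arm \<mu> i + k"
    "\<And>i. i < rk \<mu> \<Longrightarrow> leg (pi_x k \<mu>) i = leg \<mu> i"
    using \<pi> by auto
qed

lemma pi_y_conjugate:
  assumes "is_partition \<mu>" shows "pi_y k \<mu> = pi_x k (Defs.conjugate \<mu>)"
  unfolding pi_y_def pi_x_def arms_arm[OF assms] legs_leg[OF assms]
    arms_arm[OF conjugate_partition(1)[OF assms]] legs_leg[OF conjugate_partition(1)[OF assms]]
  by (simp add: conjugate_partition[OF assms])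

lemma boxes_pi_x:
  assumes \<mu>: "is_partition \<mu>"
  shows "boxes (pi_x k \<mu>) = boxes \<mu> + k * rk \<mu>"
proof -
  note p = pi_x_frob[OF \<mu> order_refl, where k = k]
  have "boxes (pi_x k \<mu>) = (\<Sum>i<rk \<mu>. (arm \<mu> i + leg \<mu> i + 1) + k)"
    unfolding boxes_frob[OF p(1)] p(3) by (rule sum.cong) (simp_all add: p)
  then show ?thesis unfolding boxes_frob[OF \<mu>] by (simp only: sum.distrib) simp
qed

lemma boxes_conjugate:
  assumes \<mu>: "is_partition \<mu>"
  shows "boxes (Defs.conjugate \<mu>) = boxes \<mu>"
  unfolding boxes_frob[OF \<mu>] boxes_frob[OF conjugate_partition(1)[OF \<mu>]] conjugate_partition[OF \<mu>]
  by (rule sum.cong) simp_all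

text \<open>
  Adding \<open>k\<close> to all arms adds \<open>k\<close> to the beta numbers from \<open>n\<close> upwards and leaves the others, which
  encode the legs.
\<close>

definition raise :: "nat \<Rightarrow> nat \<Rightarrow> nat \<Rightarrow> nat" where
  "raise n k e = (if e < n then e else e + k)"

lemma beta_pi_x:
  assumes \<mu>: "is_partition \<mu>" and len: "length \<mu> \<le> n" and i: "i < n"
  shows "beta n (part (pi_x k \<mu>)) i = raise n k (beta n (part \<mu>) i)"
proof -
  note p = pi_x_frob[OF \<mu> len, where k = k]
  have "raise n k ` frob_set n (rk \<mu>) (arm \<mu>) (leg \<mu>) = frob_set n (rk \<mu>) (\<lambda>i. arm \<mu> i + k) (leg \<mu>)"
    unfolding frob_set_def image_Un image_image
    by (intro arg_cong2[of _ _ _ _ "(\<union>)"] image_cong) (auto simp: raise_def)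
  also have "\<dots> = frob_set n (rk (pi_x k \<mu>)) (arm (pi_x k \<mu>)) (leg (pi_x k \<mu>))"
    unfolding p(3) by (rule frob_set_cong) (simp_all add: p)
  finally have "(\<lambda>i. raise n k (beta n (part \<mu>) i)) ` {..<n} = beta n (part (pi_x k \<mu>)) ` {..<n}"
    unfolding beta_set[OF p(1,2), symmetric] beta_set[OF \<mu> len, symmetric] image_image .
  moreover have "raise n k (beta n (part \<mu>) j) < raise n k (beta n (part \<mu>) i)" if "i < j" "j < n" for i j
    using beta_strict[OF part_shapes[OF \<mu> len order_refl] that] by (auto simp: raise_def)
  ultimately show ?thesis
    using strict_dec_unique[of n "beta n (part (pi_x k \<mu>))" "\<lambda>i. raise n k (beta n (part \<mu>) i)" i]
      beta_strict[OF part_shapes[OF p(1,2) order_refl]] i by metis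
qed

text \<open>
  The branching rule for shapes that may have more rows than there are letters. Shapes that are too
  long contribute zero on both sides.
\<close>

lemma schur_fun_branching_long:
  assumes f: "f \<in> shapes (Suc m) k" and nm: "n \<le> m"
  shows "schur_fun (Suc n) f x = (\<Sum>g\<in>interlacing m f. schur_fun n g x * x n ^ (weight (Suc m) f - weight m g))"
proof (cases "f (Suc n) = 0")
  case True
  have fz: "f i = 0" if "Suc n \<le> i" for i using shapes_antimono[OF f that] True by simp
  then have f': "f \<in> shapes (Suc n) k" using f by (auto simp: shapes_def)
  have wtf: "weight (Suc m) f = weight (Suc n) f"
    unfolding weight_def by (rule sum.mono_neutral_right) (use nm fz in auto)
  have sub: "interlacing n f \<subseteq> interlacing m f"
  proof
    fix g assume g: "g \<in> interlacing n f"
    have "f (Suc i) \<le> g i \<and> g i \<le> f i" for i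
      using g fz[of "Suc i"] by (cases "i < n") (simp_all add: interlacing_def)
    then show "g \<in> interlacing m f" using g nm by (simp add: interlacing_def)
  qed
  have zero: "schur_fun n g x * x n ^ (weight (Suc m) f - weight m g) = 0" if g: "g \<in> interlacing m f - interlacing n f" for g
  proof -
    have gD: "g \<in> shapes m k" using g interlacing_shapes[OF f] by blast
    have "g n \<noteq> 0"
    proof
      assume "g n = 0"
      then have "g i = 0" if "n \<le> i" for i using shapes_antimono[OF gD that] by simp
      then have "g \<in> interlacing n f" using g nm unfolding interlacing_def by auto
      with g show False by simp
    qed
    then show ?thesis by (simp add: schur_fun_too_long[OF gD])
  qed
  have "schur_fun (Suc n) f x = (\<Sum>g\<in>interlacing n f. schur_fun n g x * x n ^ (weight (Suc m) f - weight m g))"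
    unfolding schur_fun_branching[OF f'] wtf
  proof (rule sum.cong[OF refl])
    fix g assume "g \<in> interlacing n f"
    then have "weight m g = weight n g"
      unfolding weight_def by (intro sum.mono_neutral_right) (use nm in \<open>auto simp: interlacing_def\<close>)
    then show "schur_fun n g x * x n ^ (weight (Suc n) f - weight n g) = schur_fun n g x * x n ^ (weight (Suc n) f - weight m g)" by simp
  qed
  also have "\<dots> = (\<Sum>g\<in>interlacing m f. schur_fun n g x * x n ^ (weight (Suc m) f - weight m g))"
    by (rule sum.mono_neutral_left[OF finite_interlacing[OF f] sub]) (use zero in blast)
  finally show ?thesis .
next
  case False
  have "n < m" using shapes_zero[OF f, of "Suc n"] False by (cases "n < m") auto
  have "schur_fun n g x = 0" if g: "g \<in> interlacing m f" for g
  proof -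
    have "f (Suc n) \<le> g n" using g \<open>n < m\<close> by (simp add: interlacing_def)
    then show ?thesis using False interlacing_shapes[OF f] g by (intro schur_fun_too_long[of g m k]) auto
  qed
  then show ?thesis using schur_fun_too_long[OF f False] by simp
qed

definition under_rect :: "nat \<Rightarrow> nat \<Rightarrow> (nat \<Rightarrow> nat) \<Rightarrow> nat \<Rightarrow> nat" where
  "under_rect k m \<nu> i = (if i < m then k else \<nu> (i - m))"

lemma under_rect_shapes:
  assumes "\<nu> \<in> shapes j k" shows "under_rect k m \<nu> \<in> shapes (m + j) k"
proof -
  have "under_rect k m \<nu> (Suc i) \<le> under_rect k m \<nu> i" for i
    using shapes_antimono[OF assms, of "i - m" "Suc i - m"] shapes_le[OF assms] by (auto simp: under_rect_def)
  moreover have "under_rect k m \<nu> 0 \<le> k" using shapes_le[OF assms] by (simp add: under_rect_def)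
  ultimately show ?thesis using shapes_zero[OF assms] by (auto simp: shapes_def under_rect_def)
qed

lemma weight_under_rect: "weight (m + j) (under_rect k m \<nu>) = k * m + weight j \<nu>"
  by (induction j) (simp_all add: weight_def under_rect_def)

lemma weight_cong_zero: "n \<le> m \<Longrightarrow> (\<And>i. n \<le> i \<Longrightarrow> f i = 0) \<Longrightarrow> weight m f = weight n f"
  unfolding weight_def by (rule sum.mono_neutral_right) auto

text \<open>
  Removing a horizontal strip from \<open>m + 1\<close> full rows above \<open>\<tau>\<close> leaves \<open>m\<close> full rows above a shape
  \<open>\<nu>\<close>, whose first row comes from the last full row. The interlacing conditions say that \<open>\<tau>\<close> interlaces
  \<open>\<nu>\<close>.
\<close>

lemma interlacing_under_rect:
  assumes \<tau>: "\<tau> \<in> shapes j k" and M: "Suc m + j \<le> M"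
  shows "bij_betw (under_rect k m) {\<nu> \<in> shapes (Suc j) k. \<tau> \<in> interlacing j \<nu>} (interlacing M (under_rect k (Suc m) \<tau>))"
proof (rule bij_betw_byWitness[where f' = "\<lambda>g i. g (i + m)"])
  show "\<forall>\<nu>\<in>{\<nu> \<in> shapes (Suc j) k. \<tau> \<in> interlacing j \<nu>}. (\<lambda>i. under_rect k m \<nu> (i + m)) = \<nu>"
    by (simp add: under_rect_def)
  have gk: "g i = k" if "g \<in> interlacing M (under_rect k (Suc m) \<tau>)" "i < m" for g i
    using that M unfolding interlacing_def under_rect_def by (auto dest!: spec[of _ i])
  then show "\<forall>g\<in>interlacing M (under_rect k (Suc m) \<tau>). under_rect k m (\<lambda>i. g (i + m)) = g"
    by (auto simp: under_rect_def fun_eq_iff)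
  show "under_rect k m ` {\<nu> \<in> shapes (Suc j) k. \<tau> \<in> interlacing j \<nu>} \<subseteq> interlacing M (under_rect k (Suc m) \<tau>)"
  proof (rule image_subsetI)
    fix \<nu> assume "\<nu> \<in> {\<nu> \<in> shapes (Suc j) k. \<tau> \<in> interlacing j \<nu>}"
    then have \<nu>: "\<nu> \<in> shapes (Suc j) k" and interlacing: "\<tau> \<in> interlacing j \<nu>" by auto
    have a: "\<tau> i \<le> \<nu> i" for i using interlacing by (cases "i < j") (auto simp: interlacing_def)
    have b: "\<nu> (Suc i) \<le> \<tau> i" for i
      using interlacing shapes_zero[OF \<nu>, of "Suc i"] by (cases "i < j") (auto simp: interlacing_def)
    have "under_rect k (Suc m) \<tau> (Suc i) \<le> under_rect k m \<nu> i \<and> under_rect k m \<nu> i \<le> under_rect k (Suc m) \<tau> i" for i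
    proof (cases "i < m")
      case True
      then show ?thesis using shapes_le[OF \<tau>] by (simp add: under_rect_def)
    next
      case False
      then obtain d where d: "i = m + d" by (metis le_Suc_ex not_less)
      then show ?thesis using a[of d] b shapes_le[OF \<nu>, of 0] by (cases d) (auto simp: under_rect_def)
    qed
    moreover have "under_rect k m \<nu> i = 0" if "M \<le> i" for i
      using shapes_zero[OF under_rect_shapes[OF \<nu>], of m i] M that by simp
    ultimately show "under_rect k m \<nu> \<in> interlacing M (under_rect k (Suc m) \<tau>)" by (simp add: interlacing_def)
  qed
  show "(\<lambda>g i. g (i + m)) ` interlacing M (under_rect k (Suc m) \<tau>) \<subseteq> {\<nu> \<in> shapes (Suc j) k. \<tau> \<in> interlacing j \<nu>}"
  proof (rule image_subsetI)
    fix g assume g: "g \<in> interlacing M (under_rect k (Suc m) \<tau>)"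
    have DM: "under_rect k (Suc m) \<tau> \<in> shapes (Suc M) k"
      using under_rect_shapes[OF \<tau>, of "Suc m"] shapes_mono[of "Suc m + j" "Suc M" k k] M by auto
    then have gD: "g \<in> shapes M k" using g interlacing_shapes by blast
    have up: "g i \<le> under_rect k (Suc m) \<tau> i" for i
      using g by (cases "i < M") (auto simp: interlacing_def)
    have low: "under_rect k (Suc m) \<tau> (Suc i) \<le> g i" for i
      using g shapes_zero[OF DM, of "Suc i"] by (cases "i < M") (auto simp: interlacing_def)
    have a: "\<tau> i \<le> g (i + m)" for i using low[of "i + m"] by (simp add: under_rect_def)
    have b: "g (Suc i + m) \<le> \<tau> i" for i using up[of "Suc i + m"] by (simp add: under_rect_def)
    have "(\<lambda>i. g (i + m)) \<in> shapes (Suc j) k"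
    proof -
      have "g (i + m) = 0" if "Suc j \<le> i" for i
        using b[of "i - 1"] shapes_zero[OF \<tau>, of "i - 1"] that by (cases i) auto
      moreover have "g (Suc i + m) \<le> g (i + m)" for i using shapes_antimono[OF gD, of "i + m" "Suc i + m"] by simp
      ultimately show ?thesis using shapes_le[OF gD] by (auto simp: shapes_def)
    qed
    moreover have "\<tau> \<in> interlacing j (\<lambda>i. g (i + m))"
      using a b shapes_zero[OF \<tau>] by (simp add: interlacing_def)
    ultimately show "(\<lambda>i. g (i + m)) \<in> {\<nu> \<in> shapes (Suc j) k. \<tau> \<in> interlacing j \<nu>}" by simp
  qed
qed

text \<open>
  The left-hand side interpolates between the Schur polynomial of a \<open>q \<times> k\<close> rectangle, at \<open>j = 0\<close>,
  and the sum over \<open>\<nu>\<close> of the product of its Schur polynomials in the first \<open>p\<close> variables \<open>z\<close> and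
  in \<open>y\<close>, at \<open>j = q\<close>. Each step peels off the last variable \<open>1 / y j\<close> of
  the first factor by the branching rule. By \<open>interlacing_under_rect\<close> the shapes that occur are again of the form
  \<open>under_rect\<close>, and after multiplication with \<open>y j ^ k\<close> the power of \<open>y j\<close> is the one that occurs in the
  branching rule for the Schur polynomial in \<open>y\<close>.
\<close>

lemma rect_split:
  fixes y yi :: "nat \<Rightarrow> 'a::comm_ring_1"
  assumes inv: "\<And>j. j < q \<Longrightarrow> y j * yi j = 1"
    and z: "\<And>j. j < q \<Longrightarrow> z (p + j) = yi (q - 1 - j)" and jq: "j \<le> q" and p: "1 \<le> p"
  shows "(\<Sum>\<nu>\<in>shapes j k. schur_fun (p + q - j) (under_rect k (q - j) \<nu>) z * schur_fun j \<nu> y)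
    = (\<Prod>i<j. y i ^ k) * schur_fun (p + q) (under_rect k q (\<lambda>_. 0)) z"
  using jq
proof (induction j)
  case 0
  have "shapes 0 k = {\<lambda>_. 0}" by (auto simp: shapes_def)
  then show ?case by (simp add: schur_fun_empty)
next
  case (Suc j)
  define m where "m = q - Suc j"
  define N where "N = p + m"
  define M where "M = p + q - 1"
  have q: "q = Suc m + j" using Suc.prems by (simp add: m_def)
  have qj: "q - j = Suc m" "p + q - j = Suc N" "p + q - Suc j = N" "q - Suc j = m" "N \<le> M" "Suc M = p + q" "Suc m + j \<le> M"
    using q p by (simp_all add: N_def M_def)
  have zN: "z N = yi j" using z[of m] q by (simp add: N_def)
  have step: "schur_fun (Suc N) (under_rect k (Suc m) \<tau>) z * y j ^ k =
     (\<Sum>\<nu>\<in>{\<nu> \<in> shapes (Suc j) k. \<tau> \<in> interlacing j \<nu>}. schur_fun N (under_rect k m \<nu>) z * y j ^ (weight (Suc j) \<nu> - weight j \<tau>))"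
    if \<tau>: "\<tau> \<in> shapes j k" for \<tau>
  proof -
    have D: "under_rect k (Suc m) \<tau> \<in> shapes (Suc M) k"
      using under_rect_shapes[OF \<tau>, of "Suc m"] shapes_mono[of "Suc m + j" "Suc M" k k] q qj by auto
    have "schur_fun (Suc N) (under_rect k (Suc m) \<tau>) z * y j ^ k =
      (\<Sum>g\<in>interlacing M (under_rect k (Suc m) \<tau>). schur_fun N g z * yi j ^ (weight (Suc M) (under_rect k (Suc m) \<tau>) - weight M g) * y j ^ k)"
      unfolding schur_fun_branching_long[OF D \<open>N \<le> M\<close>] zN by (simp add: sum_distrib_right)
    also have "\<dots> = (\<Sum>\<nu>\<in>{\<nu> \<in> shapes (Suc j) k. \<tau> \<in> interlacing j \<nu>}. schur_fun N (under_rect k m \<nu>) z *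
       yi j ^ (weight (Suc M) (under_rect k (Suc m) \<tau>) - weight M (under_rect k m \<nu>)) * y j ^ k)"
      by (rule sum.reindex_bij_betw[OF interlacing_under_rect[OF \<tau>], symmetric]) (use q qj in simp)
    also have "\<dots> = (\<Sum>\<nu>\<in>{\<nu> \<in> shapes (Suc j) k. \<tau> \<in> interlacing j \<nu>}. schur_fun N (under_rect k m \<nu>) z * y j ^ (weight (Suc j) \<nu> - weight j \<tau>))"
    proof (rule sum.cong[OF refl])
      fix \<nu> assume \<nu>: "\<nu> \<in> {\<nu> \<in> shapes (Suc j) k. \<tau> \<in> interlacing j \<nu>}"
      have w1: "weight (Suc M) (under_rect k (Suc m) \<tau>) = k * Suc m + weight j \<tau>"
        unfolding weight_under_rect[symmetric]
        by (rule weight_cong_zero) (use q qj shapes_zero[OF under_rect_shapes[OF \<tau>]] in auto)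
      have D\<nu>: "under_rect k m \<nu> \<in> interlacing M (under_rect k (Suc m) \<tau>)"
        using bij_betwE[OF interlacing_under_rect[OF \<tau>, of m M]] \<nu> q qj by auto
      have "\<nu> \<in> shapes (Suc j) k" using \<nu> by simp
      then have w2: "weight (Suc M) (under_rect k m \<nu>) = k * m + weight (Suc j) \<nu>"
        unfolding weight_under_rect[symmetric]
        by (intro weight_cong_zero) (use q qj shapes_zero[OF under_rect_shapes] in auto)
      have "under_rect k m \<nu> M = 0" using D\<nu> by (simp add: interlacing_def)
      then have w3: "weight M (under_rect k m \<nu>) = k * m + weight (Suc j) \<nu>" using w2 by (simp add: weight_def)
      have le: "weight j \<tau> \<le> weight (Suc j) \<nu>" using interlacing_sum(2)[of \<tau> j \<nu>] \<nu> by simp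
      have le2: "weight M (under_rect k m \<nu>) \<le> weight (Suc M) (under_rect k (Suc m) \<tau>)" by (rule interlacing_sum(2)[OF D\<nu>])
      define d where "d = weight (Suc j) \<nu> - weight j \<tau>"
      have dk: "d \<le> k" using le le2 unfolding d_def w1 w3 by simp
      have e: "weight (Suc M) (under_rect k (Suc m) \<tau>) - weight M (under_rect k m \<nu>) = k - d"
        using le dk unfolding d_def w1 w3 by simp
      have "y j ^ k = y j ^ d * y j ^ (k - d)" using dk by (simp flip: power_add)
      then have "yi j ^ (k - d) * y j ^ k = (y j * yi j) ^ (k - d) * y j ^ d"
        by (simp add: power_mult_distrib mult_ac)
      then show "schur_fun N (under_rect k m \<nu>) z *
         yi j ^ (weight (Suc M) (under_rect k (Suc m) \<tau>) - weight M (under_rect k m \<nu>)) * y j ^ k =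
         schur_fun N (under_rect k m \<nu>) z * y j ^ (weight (Suc j) \<nu> - weight j \<tau>)"
        unfolding e d_def[symmetric] using inv[of j] Suc.prems by (simp add: mult.assoc)
    qed
    finally show ?thesis .
  qed
  have "(\<Prod>i<Suc j. y i ^ k) * schur_fun (p + q) (under_rect k q (\<lambda>_. 0)) z =
     (\<Sum>\<tau>\<in>shapes j k. (schur_fun (Suc N) (under_rect k (Suc m) \<tau>) z * y j ^ k) * schur_fun j \<tau> y)"
    using Suc.IH Suc.prems unfolding qj
    by (simp add: mult.assoc mult.left_commute flip: sum_distrib_left)
  also have "\<dots> = (\<Sum>\<tau>\<in>shapes j k. \<Sum>\<nu>\<in>{\<nu> \<in> shapes (Suc j) k. \<tau> \<in> interlacing j \<nu>}.
     schur_fun N (under_rect k m \<nu>) z * (schur_fun j \<tau> y * y j ^ (weight (Suc j) \<nu> - weight j \<tau>)))"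
  proof (rule sum.cong[OF refl])
    fix \<tau> assume \<tau>: "\<tau> \<in> shapes j k"
    show "(schur_fun (Suc N) (under_rect k (Suc m) \<tau>) z * y j ^ k) * schur_fun j \<tau> y =
      (\<Sum>\<nu>\<in>{\<nu> \<in> shapes (Suc j) k. \<tau> \<in> interlacing j \<nu>}.
        schur_fun N (under_rect k m \<nu>) z * (schur_fun j \<tau> y * y j ^ (weight (Suc j) \<nu> - weight j \<tau>)))"
      unfolding step[OF \<tau>] sum_distrib_right by (simp only: mult_ac)
  qed
  also have "\<dots> = (\<Sum>\<nu>\<in>shapes (Suc j) k. \<Sum>\<tau>\<in>{\<tau> \<in> shapes j k. \<tau> \<in> interlacing j \<nu>}.
     schur_fun N (under_rect k m \<nu>) z * (schur_fun j \<tau> y * y j ^ (weight (Suc j) \<nu> - weight j \<tau>)))"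
    by (rule sum.swap_restrict) auto
  also have "\<dots> = (\<Sum>\<nu>\<in>shapes (Suc j) k. schur_fun N (under_rect k m \<nu>) z * schur_fun (Suc j) \<nu> y)"
  proof (rule sum.cong[OF refl])
    fix \<nu> assume \<nu>: "\<nu> \<in> shapes (Suc j) k"
    have "{\<tau> \<in> shapes j k. \<tau> \<in> interlacing j \<nu>} = interlacing j \<nu>" using interlacing_shapes[OF \<nu>] by auto
    then show "(\<Sum>\<tau>\<in>{\<tau> \<in> shapes j k. \<tau> \<in> interlacing j \<nu>}. schur_fun N (under_rect k m \<nu>) z * (schur_fun j \<tau> y * y j ^ (weight (Suc j) \<nu> - weight j \<tau>)))
      = schur_fun N (under_rect k m \<nu>) z * schur_fun (Suc j) \<nu> y"
      unfolding schur_fun_branching[OF \<nu>] by (simp add: sum_distrib_left)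
  qed
  finally show ?case unfolding qj by simp
qed

section \<open>The identity of type I\<close>

lemma Det_block:
  fixes M :: "nat \<Rightarrow> nat \<Rightarrow> 'a::idom"
  shows "Det (p + q) (\<lambda>i j. if i < p \<longleftrightarrow> j < p then M i j else 0) =
    Det p M * Det q (\<lambda>i j. M (p + i) (p + j))"
proof -
  have "mat (p + q) (p + q) (\<lambda>(i, j). if i < p \<longleftrightarrow> j < p then M i j else 0) =
    four_block_mat (mat p p (\<lambda>(i, j). M i j)) (0\<^sub>m p q) (0\<^sub>m q p) (mat q q (\<lambda>(i, j). M (p + i) (p + j)))"
    by (rule eq_matI) auto
  then show ?thesis unfolding Det_eq_det
    by (simp add: det_four_block_mat_upper_right_zero[of _ p _ q])
qed

text \<open>
  Laplace expansion along the first \<open>p\<close> rows. The permutations are grouped by the set \<open>J\<close> of columns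
  that they assign to these rows. A group sums to the determinant of the matrix with all entries outside
  the two blocks deleted, and a permutation \<open>w\<close> that takes the first \<open>p\<close> columns to \<open>J\<close> turns that matrix into
  block diagonal form.
\<close>

lemma Det_laplace:
  fixes M :: "nat \<Rightarrow> nat \<Rightarrow> 'a::idom"
  assumes fin: "finite I" and w: "\<And>\<mu>. \<mu> \<in> I \<Longrightarrow> w \<mu> permutes {..<p + q}"
    and bij: "bij_betw (\<lambda>\<mu>. w \<mu> ` {..<p}) I {J. J \<subseteq> {..<p + q} \<and> card J = p}"
  shows "Det (p + q) M = (\<Sum>\<mu>\<in>I. of_int (sign (w \<mu>)) *
    (Det p (\<lambda>i j. M i (w \<mu> j)) * Det q (\<lambda>i j. M (p + i) (w \<mu> (p + j)))))"
proof -
  let ?N = "p + q"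
  let ?P = "{\<sigma>. \<sigma> permutes {..<?N}}"
  let ?T = "{J. J \<subseteq> {..<?N} \<and> card J = p}"
  let ?h = "\<lambda>\<sigma>. of_int (sign \<sigma>) * (\<Prod>i<?N. M i (\<sigma> i))"
  define MJ where "MJ J i j = (if i < p \<longleftrightarrow> j \<in> J then M i j else 0)" for J i j
  have imgP: "\<sigma> ` {..<p} \<in> ?T" if \<sigma>: "\<sigma> permutes {..<?N}" for \<sigma>
  proof -
    have "inj_on \<sigma> {..<p}" using permutes_inj[OF \<sigma>] by (rule inj_on_subset) simp
    then have "card (\<sigma> ` {..<p}) = p" by (simp add: card_image)
    moreover have "\<sigma> ` {..<p} \<subseteq> {..<?N}"
      using image_mono[of "{..<p}" "{..<?N}" \<sigma>] permutes_image[OF \<sigma>] by simp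
    ultimately show ?thesis by simp
  qed
  have part: "(\<Sum>\<sigma>\<in>{\<sigma> \<in> ?P. \<sigma> ` {..<p} = J}. ?h \<sigma>) = Det ?N (MJ J)" if J: "J \<in> ?T" for J
    unfolding Det_def
  proof (rule sum.mono_neutral_cong_left)
    show "\<forall>\<sigma>\<in>?P - {\<sigma> \<in> ?P. \<sigma> ` {..<p} = J}. of_int (sign \<sigma>) * (\<Prod>i<?N. MJ J i (\<sigma> i)) = 0"
    proof
      fix \<sigma> assume "\<sigma> \<in> ?P - {\<sigma> \<in> ?P. \<sigma> ` {..<p} = J}"
      then have \<sigma>: "\<sigma> permutes {..<?N}" and ne: "\<sigma> ` {..<p} \<noteq> J" by auto
      have "\<not> \<sigma> ` {..<p} \<subseteq> J"
      proof
        assume sub: "\<sigma> ` {..<p} \<subseteq> J"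
        have "finite J" using J finite_subset[of J "{..<?N}"] by blast
        moreover have "card (\<sigma> ` {..<p}) = card J" using J imgP[OF \<sigma>] by simp
        ultimately show False using card_subset_eq[OF _ sub] ne by blast
      qed
      then obtain i where "i < p" "\<sigma> i \<notin> J" by auto
      then have "MJ J i (\<sigma> i) = 0" "i < ?N" by (auto simp: MJ_def)
      then have "(\<Prod>i<?N. MJ J i (\<sigma> i)) = 0" by (intro prod_zero) auto
      then show "of_int (sign \<sigma>) * (\<Prod>i<?N. MJ J i (\<sigma> i)) = 0" by simp
    qed
    fix \<sigma> assume "\<sigma> \<in> {\<sigma> \<in> ?P. \<sigma> ` {..<p} = J}"
    then have \<sigma>: "\<sigma> permutes {..<?N}" and eq: "\<sigma> ` {..<p} = J" by auto
    have "i < p \<longleftrightarrow> \<sigma> i \<in> J" for i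
      unfolding eq[symmetric] using inj_image_mem_iff[OF permutes_inj[OF \<sigma>], of i "{..<p}"] by simp
    then have "(\<Prod>i<?N. M i (\<sigma> i)) = (\<Prod>i<?N. MJ J i (\<sigma> i))"
      by (intro prod.cong) (auto simp: MJ_def)
    then show "?h \<sigma> = of_int (sign \<sigma>) * (\<Prod>i<?N. MJ J i (\<sigma> i))" by simp
  qed auto
  have "Det ?N M = (\<Sum>J\<in>?T. \<Sum>\<sigma>\<in>{\<sigma> \<in> ?P. \<sigma> ` {..<p} = J}. ?h \<sigma>)"
    unfolding Det_def by (rule sum.group[symmetric]) (use imgP in \<open>auto simp: finite_Collect_subsets\<close>)
  also have "\<dots> = (\<Sum>J\<in>?T. Det ?N (MJ J))" by (rule sum.cong[OF refl]) (rule part)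
  also have "\<dots> = (\<Sum>\<mu>\<in>I. Det ?N (MJ (w \<mu> ` {..<p})))"
    by (rule sum.reindex_bij_betw[OF bij, symmetric])
  also have "\<dots> = (\<Sum>\<mu>\<in>I. of_int (sign (w \<mu>)) *
    (Det p (\<lambda>i j. M i (w \<mu> j)) * Det q (\<lambda>i j. M (p + i) (w \<mu> (p + j)))))"
  proof (rule sum.cong[OF refl])
    fix \<mu> assume "\<mu> \<in> I"
    note w = w[OF this]
    have "Det p (\<lambda>i j. M i (w \<mu> j)) * Det q (\<lambda>i j. M (p + i) (w \<mu> (p + j))) =
      Det ?N (\<lambda>i j. if i < p \<longleftrightarrow> j < p then M i (w \<mu> j) else 0)"
      by (rule Det_block[symmetric])
    also have "\<dots> = Det ?N (\<lambda>i j. MJ (w \<mu> ` {..<p}) i (w \<mu> j))"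
      by (rule Det_cong) (simp add: MJ_def inj_image_mem_iff[OF permutes_inj[OF w]])
    also have "\<dots> = of_int (sign (w \<mu>)) * Det ?N (MJ (w \<mu> ` {..<p}))" by (rule Det_perm_cols[OF w])
    finally show "Det ?N (MJ (w \<mu> ` {..<p})) = of_int (sign (w \<mu>)) *
      (Det p (\<lambda>i j. M i (w \<mu> j)) * Det q (\<lambda>i j. M (p + i) (w \<mu> (p + j))))"
      by (simp add: sign_square)
  qed
  finally show ?thesis .
qed

text \<open>
  The permutation that lists first the \<open>p\<close>-set of columns belonging to \<open>\<mu>\<close> and then its complement,
  both increasingly. The \<open>p\<close>-set consists of the numbers \<open>p + q - 1 - b\<close> for the beta numbers \<open>b\<close> of
  \<open>\<mu>\<close>, and its complement of the beta numbers of the conjugate of \<open>\<mu>\<close>.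
\<close>

definition shuffle :: "nat \<Rightarrow> nat \<Rightarrow> nat list \<Rightarrow> nat \<Rightarrow> nat" where
  "shuffle p q \<mu> i = (if i < p then q + i - part \<mu> i
     else if i < p + q then (i - p) + col_len \<mu> (q - 1 - (i - p)) else i)"

text \<open>
  Walking along the boundary of \<open>\<mu>\<close>, the step that closes row \<open>i\<close> comes after the step that closes
  column \<open>j\<close> exactly if the box \<open>(i, j)\<close> lies outside \<open>\<mu>\<close>.
\<close>

lemma shuffle_cross:
  assumes \<mu>: "\<mu> \<in> Par p q" and ij: "i < p" "j < q"
  shows "shuffle p q \<mu> (p + (q - 1 - j)) < shuffle p q \<mu> i \<longleftrightarrow> part \<mu> i \<le> j"
    "shuffle p q \<mu> (p + (q - 1 - j)) \<noteq> shuffle p q \<mu> i"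
proof -
  have m: "is_partition \<mu>" using \<mu> by (simp add: Par_iff)
  have "part \<mu> i \<le> q" using \<mu> part_antimono[OF m, of 0 i] by (simp add: Par_iff)
  then have si: "shuffle p q \<mu> i + part \<mu> i = q + i" using ij by (simp add: shuffle_def)
  have sj: "shuffle p q \<mu> (p + (q - 1 - j)) + (j + 1) = q + col_len \<mu> j"
  proof -
    define s where "s = q - 1 - j"
    have s: "s < q" "q - 1 - s = j" "s + (j + 1) = q" using ij by (simp_all add: s_def)
    have "shuffle p q \<mu> (p + s) = s + col_len \<mu> (q - 1 - s)" using s(1) by (simp add: shuffle_def)
    then show ?thesis unfolding s(2) s_def[symmetric] using s(3) by linarith
  qed
  have c: "i < col_len \<mu> j \<longleftrightarrow> j < part \<mu> i" by (rule col_iff[OF m])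
  show "shuffle p q \<mu> (p + (q - 1 - j)) < shuffle p q \<mu> i \<longleftrightarrow> part \<mu> i \<le> j"
    "shuffle p q \<mu> (p + (q - 1 - j)) \<noteq> shuffle p q \<mu> i"
    using si sj c by (cases "j < part \<mu> i"; linarith)+
qed

lemma shuffle_mono:
  assumes \<mu>: "\<mu> \<in> Par p q"
  shows "i < j \<Longrightarrow> j < p \<Longrightarrow> shuffle p q \<mu> i < shuffle p q \<mu> j"
    "p \<le> i \<Longrightarrow> i < j \<Longrightarrow> j < p + q \<Longrightarrow> shuffle p q \<mu> i < shuffle p q \<mu> j"
proof -
  have m: "is_partition \<mu>" using \<mu> by (simp add: Par_iff)
  have le: "part \<mu> i \<le> q" for i using \<mu> part_antimono[OF m, of 0 i] by (simp add: Par_iff)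
  show "shuffle p q \<mu> i < shuffle p q \<mu> j" if "i < j" "j < p"
    using that part_antimono[OF m, of i j] le[of i] by (simp add: shuffle_def)
  show "shuffle p q \<mu> i < shuffle p q \<mu> j" if "p \<le> i" "i < j" "j < p + q"
  proof -
    define a b where "a = i - p" and "b = j - p"
    have ab: "i = p + a" "j = p + b" "a < b" "b < q" using that by (simp_all add: a_def b_def)
    have "col_len \<mu> (q - 1 - a) \<le> col_len \<mu> (q - 1 - b)" using ab by (intro col_len_antimono[OF m]) simp
    then show ?thesis using ab by (simp add: shuffle_def)
  qed
qed

lemma shuffle_permutes:
  assumes \<mu>: "\<mu> \<in> Par p q"
  shows "shuffle p q \<mu> permutes {..<p + q}"
proof (rule bij_imp_permutes)
  have m: "is_partition \<mu>" "length \<mu> \<le> p" using \<mu> by (auto simp: Par_iff)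
  have ne: "shuffle p q \<mu> i \<noteq> shuffle p q \<mu> j" if "i < j" "j < p + q" for i j
  proof (cases "j < p \<or> p \<le> i")
    case True
    then show ?thesis using shuffle_mono[OF \<mu>, of i j] that by force
  next
    case False
    define j' where "j' = q - 1 - (j - p)"
    have "j = p + (q - 1 - j')" "j' < q" "i < p" using False that by (auto simp: j'_def)
    then show ?thesis using shuffle_cross(2)[OF \<mu>, of i j'] by simp
  qed
  have "inj_on (shuffle p q \<mu>) {..<p + q}"
  proof (rule inj_onI)
    fix i j assume "i \<in> {..<p + q}" "j \<in> {..<p + q}" "shuffle p q \<mu> i = shuffle p q \<mu> j"
    then show "i = j" using ne[of i j] ne[of j i] by (cases i j rule: linorder_cases) auto
  qed
  moreover have "shuffle p q \<mu> ` {..<p + q} \<subseteq> {..<p + q}"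
  proof (rule image_subsetI)
    fix i assume "i \<in> {..<p + q}"
    then show "shuffle p q \<mu> i \<in> {..<p + q}"
      using col_len_le[OF m, of "q - 1 - (i - p)"] by (auto simp: shuffle_def)
  qed
  ultimately show "bij_betw (shuffle p q \<mu>) {..<p + q} {..<p + q}" by (simp add: bij_betw_def endo_inj_surj)
  show "shuffle p q \<mu> i = i" if "i \<notin> {..<p + q}" for i using that by (simp add: shuffle_def)
qed

lemma prod_lessThan_add:
  fixes p q :: nat
  shows "(\<Prod>i<p + q. h i) = (\<Prod>i<p. h i) * (\<Prod>i<q. h (p + i) :: 'a::comm_monoid_mult)"
  by (induction q) (simp_all add: mult.assoc)

lemma prod_split_pairs:
  fixes p q :: nat
  shows "(\<Prod>j<p + q. \<Prod>i<j. g i j) = (\<Prod>j<p. \<Prod>i<j. g i j) * (\<Prod>j<q. \<Prod>i<p. g i (p + j)) *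
     (\<Prod>j<q. \<Prod>i<j. g (p + i) (p + j) :: 'a::comm_monoid_mult)"
  unfolding prod_lessThan_add[of _ p q] prod_lessThan_add[of "\<lambda>i. g i (p + _)" p] prod.distrib
  by (simp only: mult.assoc)

text \<open>
  The inversions correspond to the boxes of the \<open>p \<times> q\<close> rectangle outside \<open>\<mu>\<close>.
\<close>

lemma sign_shuffle:
  assumes \<mu>: "\<mu> \<in> Par p q"
  shows "sign (shuffle p q \<mu>) = (- 1) ^ (p * q) * (- 1) ^ boxes \<mu>"
proof -
  have m: "is_partition \<mu>" "length \<mu> \<le> p" using \<mu> by (auto simp: Par_iff)
  have le: "part \<mu> i \<le> q" for i using \<mu> part_antimono[OF m(1), of 0 i] by (simp add: Par_iff)
  let ?g = "\<lambda>i j. sgn (int (shuffle p q \<mu> j) - int (shuffle p q \<mu> i))"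
  have "sign (shuffle p q \<mu>) = (\<Prod>j<p + q. \<Prod>i<j. ?g i j)" by (rule sign_prod[OF shuffle_permutes[OF \<mu>]])
  also have "\<dots> = (\<Prod>j<p. \<Prod>i<j. ?g i j) * (\<Prod>j<q. \<Prod>i<p. ?g i (p + j)) * (\<Prod>j<q. \<Prod>i<j. ?g (p + i) (p + j))"
    by (rule prod_split_pairs)
  also have "(\<Prod>j<p. \<Prod>i<j. ?g i j) = 1"
    by (intro prod.neutral ballI) (use shuffle_mono(1)[OF \<mu>] in auto)
  also have "(\<Prod>j<q. \<Prod>i<j. ?g (p + i) (p + j)) = 1"
    by (intro prod.neutral ballI) (use shuffle_mono(2)[OF \<mu>] in auto)
  also have "(\<Prod>j<q. \<Prod>i<p. ?g i (p + j)) = (\<Prod>j<q. \<Prod>i<p. ?g i (p + (q - Suc j)))"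
    by (rule prod.nat_diff_reindex[symmetric])
  also have "\<dots> = (\<Prod>j<q. \<Prod>i<p. if j < part \<mu> i then 1 else - 1)"
  proof (intro prod.cong refl)
    fix i j assume "j \<in> {..<q}" "i \<in> {..<p}"
    then show "?g i (p + (q - Suc j)) = (if j < part \<mu> i then 1 else - 1)"
      using shuffle_cross[OF \<mu>, of i j] by (cases "j < part \<mu> i") (auto simp: not_less)
  qed
  also have "\<dots> = (\<Prod>i<p. \<Prod>j<q. if j < part \<mu> i then 1 else - 1)" by (rule prod.swap)
  also have "\<dots> = (\<Prod>i<p. (- 1) ^ q * (- 1) ^ part \<mu> i)"
  proof (rule prod.cong[OF refl])
    fix i
    have "{..<q} \<inter> - {j. j < part \<mu> i} = {part \<mu> i..<q}" by auto
    then have "(\<Prod>j<q. if j < part \<mu> i then 1 else - 1 :: int) = (- 1) ^ (q - part \<mu> i)"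
      by (simp add: prod.If_cases)
    also have "\<dots> = (- 1) ^ q * (- 1) ^ part \<mu> i"
      using le[of i] by (simp add: minus_one_power_iff)
    finally show "(\<Prod>j<q. if j < part \<mu> i then 1 else - 1 :: int) = (- 1) ^ q * (- 1) ^ part \<mu> i" .
  qed
  also have "\<dots> = (- 1) ^ (p * q) * (- 1) ^ boxes \<mu>"
    unfolding boxes_weight[OF m] weight_def by (simp add: prod.distrib power_sum mult.commute flip: power_mult)
  finally show ?thesis by simp
qed

lemma shuffle_beta:
  assumes \<mu>: "\<mu> \<in> Par p q" and i: "i < p"
  shows "shuffle p q \<mu> i + beta p (part \<mu>) i = p + q - 1"
proof -
  have "part \<mu> i \<le> q" using \<mu> part_antimono[of \<mu> 0 i] by (simp add: Par_iff)
  then show ?thesis using i by (simp add: shuffle_def beta_def)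
qed

lemma shuffle_bij: "bij_betw (\<lambda>\<mu>. shuffle p q \<mu> ` {..<p}) (Par p q) {J. J \<subseteq> {..<p + q} \<and> card J = p}"
proof (rule bij_betw_imageI)
  have img: "shuffle p q \<mu> ` {..<p} = (\<lambda>e. p + q - 1 - e) ` (beta p (part \<mu>) ` {..<p})" if "\<mu> \<in> Par p q" for \<mu>
    unfolding image_image by (rule image_cong) (use shuffle_beta[OF that] in force)+
  have img': "beta p (part \<mu>) ` {..<p} = (\<lambda>e. p + q - 1 - e) ` (shuffle p q \<mu> ` {..<p})" if "\<mu> \<in> Par p q" for \<mu>
    unfolding image_image by (rule image_cong) (use shuffle_beta[OF that] in force)+
  show "inj_on (\<lambda>\<mu>. shuffle p q \<mu> ` {..<p}) (Par p q)"
  proof (rule inj_onI)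
    fix \<mu> \<nu> assume m: "\<mu> \<in> Par p q" and n: "\<nu> \<in> Par p q" and eq: "shuffle p q \<mu> ` {..<p} = shuffle p q \<nu> ` {..<p}"
    have "beta p (part \<mu>) ` {..<p} = beta p (part \<nu>) ` {..<p}"
      unfolding img'[OF m] img'[OF n] eq ..
    then have "part \<mu> = part \<nu>"
      using m n by (intro beta_inject[of "part \<mu>" p "part \<mu> 0" "part \<nu>" "part \<nu> 0"] part_shapes) (auto simp: Par_iff)
    then show "\<mu> = \<nu>" using m n by (intro part_inject) (auto simp: Par_iff)
  qed
  show "(\<lambda>\<mu>. shuffle p q \<mu> ` {..<p}) ` Par p q = {J. J \<subseteq> {..<p + q} \<and> card J = p}"
  proof (intro Set.set_eqI iffI)
    fix J assume "J \<in> (\<lambda>\<mu>. shuffle p q \<mu> ` {..<p}) ` Par p q"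
    then obtain \<mu> where m: "\<mu> \<in> Par p q" and J: "J = shuffle p q \<mu> ` {..<p}" by auto
    have "inj_on (shuffle p q \<mu>) {..<p}" using permutes_inj[OF shuffle_permutes[OF m]] by (rule inj_on_subset) simp
    then show "J \<in> {J. J \<subseteq> {..<p + q} \<and> card J = p}"
      unfolding J using image_mono[of "{..<p}" "{..<p + q}" "shuffle p q \<mu>"] permutes_image[OF shuffle_permutes[OF m]]
      by (simp add: card_image)
  next
    fix J assume "J \<in> {J. J \<subseteq> {..<p + q} \<and> card J = p}"
    then have J: "J \<subseteq> {..<p + q}" "card J = p" by auto
    let ?R = "(\<lambda>e. p + q - 1 - e) ` J"
    have lt: "e < p + q" if "e \<in> J" for e using J(1) that by blast
    have "inj_on (\<lambda>e. p + q - 1 - e) J"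
    proof (rule inj_onI)
      fix d e assume "d \<in> J" "e \<in> J" "p + q - 1 - d = p + q - 1 - e"
      then show "d = e" using lt[of d] lt[of e] by linarith
    qed
    then have cR: "card ?R = p" using J(2) by (simp add: card_image)
    have fR: "finite ?R" using J(1) by (auto intro: finite_subset)
    obtain \<mu> where \<mu>: "is_partition \<mu>" "length \<mu> \<le> p" and bR: "beta p (part \<mu>) ` {..<p} = ?R"
      by (rule obtain_partition_of_beta_set[OF fR cR])
    have "part \<mu> 0 \<le> q"
    proof (cases "0 < p")
      case True
      then have "beta p (part \<mu>) 0 \<in> ?R" using bR by blast
      then have "beta p (part \<mu>) 0 \<le> p + q - 1" by auto
      then show ?thesis using True by (simp add: beta_def)
    next
      case False
      then show ?thesis using part_eq_0_iff[OF \<mu>(1), of 0] \<mu>(2) by simp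
    qed
    then have m: "\<mu> \<in> Par p q" using \<mu> by (simp add: Par_iff)
    have "shuffle p q \<mu> ` {..<p} = (\<lambda>e. p + q - 1 - e) ` ?R" using img[OF m] bR by simp
    also have "\<dots> = (\<lambda>e. e) ` J"
      unfolding image_image
    proof (rule image_cong[OF refl])
      fix e assume "e \<in> J"
      then show "p + q - 1 - (p + q - 1 - e) = e" using lt[of e] by linarith
    qed
    also have "\<dots> = J" by simp
    finally show "J \<in> (\<lambda>\<mu>. shuffle p q \<mu> ` {..<p}) ` Par p q" using m by blast
  qed
qed

text \<open>
  Reversing both the rows and the columns does not change the sign of a determinant, so inverting
  and reversing the variables just complements the exponents.
\<close>

lemma alternant_inverse_reverse:
  fixes y yi :: "nat \<Rightarrow> 'a::comm_ring_1"
  assumes inv: "\<And>j. j < q \<Longrightarrow> y j * yi j = 1" and e: "\<And>j. j < q \<Longrightarrow> e j \<le> m"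
  shows "(\<Prod>j<q. y j ^ m) * alternant q (\<lambda>j. yi (q - 1 - j)) e = alternant q y (\<lambda>j. m - e (q - 1 - j))"
proof -
  define r where "r j = (if j < q then q - 1 - j else j)" for j
  have r: "r permutes {..<q}"
  proof (rule bij_imp_permutes)
    show "bij_betw r {..<q} {..<q}"
      by (rule bij_betw_byWitness[where f' = r]) (auto simp: r_def)
  qed (simp add: r_def)
  have "alternant q (\<lambda>j. yi (q - 1 - j)) e = alternant q (\<lambda>j. yi (r j)) (\<lambda>j. (e \<circ> r) (r j))"
    by (rule alternant_cong) (auto simp: r_def)
  also have "\<dots> = of_int (sign r) * (of_int (sign r) * alternant q yi (e \<circ> r))"
    unfolding alternant_perm_rows[OF r, of yi] alternant_perm_cols[OF r, of yi "e \<circ> r"] ..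
  also have "\<dots> = alternant q yi (e \<circ> r)" by (rule sign_square)
  finally have "(\<Prod>j<q. y j ^ m) * alternant q (\<lambda>j. yi (q - 1 - j)) e = Det q (\<lambda>i j. y i ^ m * yi i ^ (e \<circ> r) j)"
    unfolding Det_scale_rows alternant_def by simp
  also have "\<dots> = alternant q y (\<lambda>j. m - e (q - 1 - j))"
    unfolding alternant_def
  proof (rule Det_cong)
    fix i j assume ij: "i < q" "j < q"
    define d where "d = e (q - 1 - j)"
    have d: "d \<le> m" using e[of "q - 1 - j"] ij by (simp add: d_def)
    have "y i ^ m * yi i ^ d = (y i * yi i) ^ d * y i ^ (m - d)"
    proof -
      have "y i ^ m = y i ^ d * y i ^ (m - d)" using d by (simp flip: power_add)
      then show ?thesis by (simp add: power_mult_distrib mult_ac)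
    qed
    then show "y i ^ m * yi i ^ (e \<circ> r) j = y i ^ (m - e (q - 1 - j))"
      using inv[OF ij(1)] ij by (simp add: d_def r_def)
  qed
  finally show ?thesis .
qed

text \<open>
  The factors \<open>x i - 1 / y j\<close> of the joint Vandermonde product become \<open>-(1 - x i * y j)\<close> after
  multiplication with \<open>y j\<close>.
\<close>

lemma vandermonde_split:
  fixes y yi x z :: "nat \<Rightarrow> 'a::comm_ring_1"
  assumes inv: "\<And>j. j < q \<Longrightarrow> y j * yi j = 1"
    and zx: "\<And>i. i < p \<Longrightarrow> z i = x i" and zy: "\<And>j. j < q \<Longrightarrow> z (p + j) = yi (q - 1 - j)"
  shows "(\<Prod>j<q. y j ^ (p + q - 1)) * vandermonde (p + q) z =
    (- 1) ^ (p * q) * vandermonde p x * vandermonde q y * (\<Prod>(i, j)\<in>{..<p} \<times> {..<q}. 1 - x i * y j)"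
proof (cases "q = 0")
  case True
  then show ?thesis using zx by (simp add: vandermonde_def)
next
  case False
  have "vandermonde (p + q) z = vandermonde p z * (\<Prod>j<q. \<Prod>i<p. z i - z (p + j)) * vandermonde q (\<lambda>j. z (p + j))"
    unfolding vandermonde_def by (rule prod_split_pairs)
  also have "vandermonde p z = vandermonde p x" unfolding vandermonde_def by (intro prod.cong refl) (simp add: zx)
  also have "vandermonde q (\<lambda>j. z (p + j)) = alternant q (\<lambda>j. yi (q - 1 - j)) (\<lambda>j. q - 1 - j)"
    unfolding vandermonde_alternant by (rule alternant_cong) (simp_all add: zy)
  also have "(\<Prod>j<q. \<Prod>i<p. z i - z (p + j)) = (\<Prod>j<q. \<Prod>i<p. x i - yi (q - Suc j))"
    by (intro prod.cong refl) (simp add: zx zy)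
  also have "\<dots> = (\<Prod>j<q. \<Prod>i<p. x i - yi j)"
    by (rule prod.nat_diff_reindex)
  finally have v: "vandermonde (p + q) z = vandermonde p x * (\<Prod>j<q. \<Prod>i<p. x i - yi j) * alternant q (\<lambda>j. yi (q - 1 - j)) (\<lambda>j. q - 1 - j)" .
  have y1: "(\<Prod>j<q. y j ^ (q - 1)) * alternant q (\<lambda>j. yi (q - 1 - j)) (\<lambda>j. q - 1 - j) = vandermonde q y"
  proof -
    have "(\<Prod>j<q. y j ^ (q - 1)) * alternant q (\<lambda>j. yi (q - 1 - j)) (\<lambda>j. q - 1 - j) =
      alternant q y (\<lambda>j. q - 1 - (q - 1 - (q - 1 - j)))"
      by (rule alternant_inverse_reverse) (simp_all add: inv)
    also have "\<dots> = vandermonde q y" unfolding vandermonde_alternant by (rule alternant_cong) auto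
    finally show ?thesis .
  qed
  have y2: "(\<Prod>j<q. y j ^ p) * (\<Prod>j<q. \<Prod>i<p. x i - yi j) =
      (- 1) ^ (p * q) * (\<Prod>(i, j)\<in>{..<p} \<times> {..<q}. 1 - x i * y j)"
  proof -
    have "(\<Prod>j<q. y j ^ p) * (\<Prod>j<q. \<Prod>i<p. x i - yi j) = (\<Prod>j<q. \<Prod>i<p. y j * (x i - yi j))"
      by (simp add: prod.distrib)
    also have "\<dots> = (\<Prod>j<q. \<Prod>i<p. - 1 * (1 - x i * y j))"
      by (intro prod.cong refl) (simp add: right_diff_distrib inv mult.commute)
    also have "\<dots> = (- 1) ^ (p * q) * (\<Prod>j<q. \<Prod>i<p. 1 - x i * y j)"
      unfolding prod.distrib by (simp add: power_mult)
    also have "(\<Prod>j<q. \<Prod>i<p. 1 - x i * y j) = (\<Prod>i<p. \<Prod>j<q. 1 - x i * y j)" by (rule prod.swap)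
    also have "\<dots> = (\<Prod>(i, j)\<in>{..<p} \<times> {..<q}. 1 - x i * y j)" by (rule prod.cartesian_product)
    finally show ?thesis .
  qed
  have y3: "(\<Prod>j<q. y j ^ (p + q - 1)) = (\<Prod>j<q. y j ^ p) * (\<Prod>j<q. y j ^ (q - 1))"
    using False by (simp add: Nat.add_diff_assoc flip: prod.distrib power_add)
  have "(\<Prod>j<q. y j ^ (p + q - 1)) * vandermonde (p + q) z =
    ((\<Prod>j<q. y j ^ p) * (\<Prod>j<q. \<Prod>i<p. x i - yi j)) *
    ((\<Prod>j<q. y j ^ (q - 1)) * alternant q (\<lambda>j. yi (q - 1 - j)) (\<lambda>j. q - 1 - j)) * vandermonde p x"
    unfolding v y3 by (simp only: mult_ac)
  then show ?thesis unfolding y1 y2 by (simp only: mult_ac)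
qed

text \<open>
  For invertible \<open>y\<close> the left-hand side times the two Vandermonde products is, up to the sign
  \<open>(-1) ^ (p * q)\<close> and a power of each \<open>y j\<close>, one alternant in the variables \<open>z = (x, 1 / y)\<close>: the Schur polynomial of the \<open>q \<times> k\<close>
  rectangle times the Vandermonde product of \<open>z\<close>. Its exponents are \<open>0, \<dots>, p - 1\<close> and
  \<open>p + k, \<dots>, p + q + k - 1\<close>. Laplace expansion produces minors with exponents
  \<open>raise p k (beta p \<mu>)\<close> in \<open>x\<close> and, after complementing, \<open>raise q k (beta q \<mu>')\<close> in \<open>y\<close>, which belong to
  \<open>pi_x k \<mu>\<close> and \<open>pi_y k \<mu>\<close>.
\<close>

theorem typeI_units:
  fixes x y yi :: "nat \<Rightarrow> 'a::idom"
  assumes p: "1 \<le> p" and q: "1 \<le> q" and inv: "\<And>j. j < q \<Longrightarrow> y j * yi j = 1"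
    and nz: "vandermonde p x \<noteq> 0" "vandermonde q y \<noteq> 0"
  shows "typeI_lhs p q k x y = typeI_rhs p q k x y"
proof -
  (* The inverted variables come in reverse order, so that branching peels off 1 / y 0 first. *)
  define z where "z i = (if i < p then x i else yi (q - 1 - (i - p)))" for i
  have zx: "z i = x i" if "i < p" for i using that by (simp add: z_def)
  have zy: "z (p + j) = yi (q - 1 - j)" for j by (simp add: z_def)
  (* The largest exponent, hence the power of y that clears the negative exponents. *)
  define m where "m = k + p + q - 1"
  define r where "r = under_rect k q (\<lambda>_. 0)"
  have z0: "(\<lambda>_. 0) \<in> shapes 0 k" by (simp add: shapes_def)
  have rD: "r \<in> shapes (p + q) k"
    using under_rect_shapes[OF z0, of q] shapes_mono[of "q + 0" "p + q" k k] unfolding r_def by auto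
  define e where "e = beta (p + q) r"
  have e: "e j = raise p k (p + q - 1 - j)" if "j < p + q" for j
    using that by (auto simp: e_def beta_def r_def under_rect_def raise_def)
  define F where "F = (\<Sum>\<nu>\<in>Par (min p q) k. schur p \<nu> x * schur q \<nu> y)"
  have F: "F = (\<Prod>i<q. y i ^ k) * schur_fun (p + q) r z"
  proof -
    (* Shapes with more than p rows may be included: their Schur polynomial in x vanishes. *)
    have "F = (\<Sum>f\<in>shapes (min p q) k. schur_fun p f x * schur_fun q f y)"
      unfolding F_def schur_eq_schur_fun by (rule sum.reindex_bij_betw[OF part_bij_Par])
    also have "\<dots> = (\<Sum>f\<in>shapes q k. schur_fun p f x * schur_fun q f y)"
    proof (rule sum.mono_neutral_left)
      show "shapes (min p q) k \<subseteq> shapes q k" by (rule shapes_mono) auto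
      show "\<forall>f\<in>shapes q k - shapes (min p q) k. schur_fun p f x * schur_fun q f y = 0"
      proof
        fix f assume f: "f \<in> shapes q k - shapes (min p q) k"
        then have fq: "f \<in> shapes q k" by simp
        have "f p \<noteq> 0"
        proof
          assume "f p = 0"
          then have "f i = 0" if "p \<le> i" for i using shapes_antimono[OF fq that] by simp
          then have "f \<in> shapes (min p q) k" using fq by (auto simp: shapes_def min_def)
          with f show False by simp
        qed
        then show "schur_fun p f x * schur_fun q f y = 0" by (simp add: schur_fun_too_long[OF fq])
      qed
    qed simp
    also have "\<dots> = (\<Sum>f\<in>shapes q k. schur_fun (p + q - q) (under_rect k (q - q) f) z * schur_fun q f y)"
    proof (rule sum.cong[OF refl])
      fix f assume "f \<in> shapes q k"
      have "schur_fun p f z = schur_fun p f x" unfolding schur_fun_def using fillings_less by (intro sum.cong prod.cong refl zx) auto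
      moreover have "under_rect k 0 f = f" by (simp add: under_rect_def fun_eq_iff)
      ultimately show "schur_fun p f x * schur_fun q f y = schur_fun (p + q - q) (under_rect k (q - q) f) z * schur_fun q f y" by simp
    qed
    also have "\<dots> = (\<Prod>i<q. y i ^ k) * schur_fun (p + q) r z"
      unfolding r_def by (rule rect_split[where yi = yi]) (use inv zy p in auto)
    finally show ?thesis .
  qed
  have vs: "(\<Prod>j<q. y j ^ (p + q - 1)) * vandermonde (p + q) z =
    (- 1) ^ (p * q) * vandermonde p x * vandermonde q y * (\<Prod>(i, j)\<in>{..<p} \<times> {..<q}. 1 - x i * y j)"
    by (rule vandermonde_split[where yi = yi]) (use inv zx zy in auto)
  let ?D = "\<lambda>a. vandermonde p x * vandermonde q y * a"
  have "(- 1) ^ (p * q) * ?D (typeI_lhs p q k x y) =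
    ((\<Prod>j<q. y j ^ (p + q - 1)) * vandermonde (p + q) z) * F"
    unfolding vs typeI_lhs_def F_def by (simp only: mult_ac)
  also have "\<dots> = (\<Prod>j<q. y j ^ m) * alternant (p + q) z e"
  proof -
    have "(\<Prod>j<q. y j ^ m) = (\<Prod>j<q. y j ^ (p + q - 1)) * (\<Prod>j<q. y j ^ k)"
      using p by (simp add: m_def add_ac flip: prod.distrib power_add)
    then show ?thesis unfolding F e_def bialternant[OF rD] by (simp only: mult_ac)
  qed
  also have "alternant (p + q) z e = (\<Sum>\<mu>\<in>Par p q. of_int (sign (shuffle p q \<mu>)) *
     (Det p (\<lambda>i j. z i ^ e (shuffle p q \<mu> j)) * Det q (\<lambda>i j. z (p + i) ^ e (shuffle p q \<mu> (p + j)))))"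
    unfolding alternant_def
    by (rule Det_laplace[OF _ shuffle_permutes shuffle_bij]) (use bij_betw_finite[OF part_bij_Par] in auto)
  also have "(\<Prod>j<q. y j ^ m) * \<dots> = (\<Sum>\<mu>\<in>Par p q. (- 1) ^ (p * q) * ?D ((- 1) ^ (boxes (pi_x k \<mu>) - k * rk (pi_x k \<mu>)) *
        schur p (pi_x k \<mu>) x * schur q (pi_y k \<mu>) y))"
    unfolding sum_distrib_left
  proof (rule sum.cong[OF refl])
    fix \<mu> assume \<mu>: "\<mu> \<in> Par p q"
    have m1: "is_partition \<mu>" "length \<mu> \<le> p" using \<mu> by (auto simp: Par_iff)
    have \<mu>': "Defs.conjugate \<mu> \<in> Par q p" by (rule conjugate_Par[OF \<mu>])
    have m2: "is_partition (Defs.conjugate \<mu>)" "length (Defs.conjugate \<mu>) \<le> q" using \<mu>' by (auto simp: Par_iff)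
    note px = pi_x_frob[OF m1, where k = k] and py = pi_x_frob[OF m2, where k = k]
    have "Det p (\<lambda>i j. z i ^ e (shuffle p q \<mu> j)) = alternant p x (beta p (part (pi_x k \<mu>)))"
      unfolding alternant_def
    proof (rule Det_cong)
      fix i j assume ij: "i < p" "j < p"
      have "shuffle p q \<mu> j < p + q" "p + q - 1 - shuffle p q \<mu> j = beta p (part \<mu>) j"
        using shuffle_beta[OF \<mu> ij(2)] p by linarith+
      then have "e (shuffle p q \<mu> j) = raise p k (beta p (part \<mu>) j)" by (simp add: e)
      then show "z i ^ e (shuffle p q \<mu> j) = x i ^ beta p (part (pi_x k \<mu>)) j"
        using ij by (simp add: beta_pi_x[OF m1] zx)
    qed
    also have "\<dots> = vandermonde p x * schur p (pi_x k \<mu>) x"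
      unfolding schur_eq_schur_fun by (rule bialternant[OF part_shapes[OF px(1,2) order_refl]])
    finally have A: "Det p (\<lambda>i j. z i ^ e (shuffle p q \<mu> j)) = vandermonde p x * schur p (pi_x k \<mu>) x" .
    have ey: "e (shuffle p q \<mu> (p + (q - 1 - j))) \<le> m \<and>
      m - e (shuffle p q \<mu> (p + (q - 1 - j))) = beta q (part (pi_y k \<mu>)) j" if j: "j < q" for j
    proof -
      have cl: "part (Defs.conjugate \<mu>) j = col_len \<mu> j" by (simp add: conjugate_partition(2)[OF m1(1)])
      have clp: "col_len \<mu> j \<le> p" by (rule col_len_le[OF m1])
      have s: "shuffle p q \<mu> (p + (q - 1 - j)) = q - 1 - j + col_len \<mu> j" using j by (simp add: shuffle_def)
      have b: "beta q (part (Defs.conjugate \<mu>)) j = col_len \<mu> j + (q - 1 - j)" by (simp add: beta_def cl)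
      have lt: "shuffle p q \<mu> (p + (q - 1 - j)) < p + q" unfolding s using j clp by linarith
      have "e (shuffle p q \<mu> (p + (q - 1 - j))) + raise q k (beta q (part (Defs.conjugate \<mu>)) j) = m"
        unfolding e[OF lt] unfolding s b raise_def m_def using j clp by auto
      moreover have "beta q (part (pi_y k \<mu>)) j = raise q k (beta q (part (Defs.conjugate \<mu>)) j)"
        unfolding pi_y_conjugate[OF m1(1)] by (rule beta_pi_x[OF m2 j])
      ultimately show ?thesis by linarith
    qed
    have "(\<Prod>j<q. y j ^ m) * Det q (\<lambda>i j. z (p + i) ^ e (shuffle p q \<mu> (p + j))) =
      (\<Prod>j<q. y j ^ m) * alternant q (\<lambda>j. yi (q - 1 - j)) (\<lambda>j. e (shuffle p q \<mu> (p + j)))"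
      by (simp add: alternant_def zy)
    also have "\<dots> = alternant q y (\<lambda>j. m - e (shuffle p q \<mu> (p + (q - 1 - j))))"
    proof (rule alternant_inverse_reverse[OF inv])
      show "e (shuffle p q \<mu> (p + j)) \<le> m" if "j < q" for j
        using ey[of "q - 1 - j"] that by simp
    qed
    also have "\<dots> = alternant q y (beta q (part (pi_y k \<mu>)))"
    proof (rule alternant_cong)
      fix j assume "j < q"
      from ey[OF this] show "m - e (shuffle p q \<mu> (p + (q - 1 - j))) = beta q (part (pi_y k \<mu>)) j" by blast
    qed simp
    also have "\<dots> = vandermonde q y * schur q (pi_y k \<mu>) y"
      unfolding schur_eq_schur_fun pi_y_conjugate[OF m1(1)] by (rule bialternant[OF part_shapes[OF py(1,2) order_refl]])
    finally have B: "(\<Prod>j<q. y j ^ m) * Det q (\<lambda>i j. z (p + i) ^ e (shuffle p q \<mu> (p + j))) =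
      vandermonde q y * schur q (pi_y k \<mu>) y" .
    have sg: "of_int (sign (shuffle p q \<mu>)) = (- 1 :: 'a) ^ (p * q) * (- 1) ^ (boxes (pi_x k \<mu>) - k * rk (pi_x k \<mu>))"
      unfolding sign_shuffle[OF \<mu>] by (simp add: boxes_pi_x[OF m1(1)] px(3))
    show "(\<Prod>j<q. y j ^ m) * (of_int (sign (shuffle p q \<mu>)) *
       (Det p (\<lambda>i j. z i ^ e (shuffle p q \<mu> j)) * Det q (\<lambda>i j. z (p + i) ^ e (shuffle p q \<mu> (p + j))))) =
       (- 1) ^ (p * q) * ?D ((- 1) ^ (boxes (pi_x k \<mu>) - k * rk (pi_x k \<mu>)) *
        schur p (pi_x k \<mu>) x * schur q (pi_y k \<mu>) y)"
    proof -
      have "(\<Prod>j<q. y j ^ m) * (of_int (sign (shuffle p q \<mu>)) *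
       (Det p (\<lambda>i j. z i ^ e (shuffle p q \<mu> j)) * Det q (\<lambda>i j. z (p + i) ^ e (shuffle p q \<mu> (p + j))))) =
       of_int (sign (shuffle p q \<mu>)) * Det p (\<lambda>i j. z i ^ e (shuffle p q \<mu> j)) *
        ((\<Prod>j<q. y j ^ m) * Det q (\<lambda>i j. z (p + i) ^ e (shuffle p q \<mu> (p + j))))"
        by (simp only: mult_ac)
      then show ?thesis unfolding A B sg by (simp only: mult_ac)
    qed
  qed
  also have "\<dots> = (- 1) ^ (p * q) * ?D (typeI_rhs p q k x y)"
    unfolding typeI_rhs_def by (simp only: sum_distrib_left)
  finally show ?thesis using nz by simp
qed

text \<open>
  Disjoint sets of indeterminates make all Vandermonde products nonzero; evaluation then reaches
  every commutative ring.
\<close>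

lemma typeI_identity:
  fixes x y :: "nat \<Rightarrow> 'a::comm_ring_1"
  assumes p: "1 \<le> p" and q: "1 \<le> q"
  shows "typeI_lhs p q k x y = typeI_rhs p q k x y"
proof -
  (* The indeterminates from p onwards play the role of y. *)
  define w where "w i = (if i < p then x i else y (i - p))" for i
  interpret ring_rel "eval_rel w" by (rule eval_rel)
  have X: "eval_rel w (var i) (x i)" if "i < p" for i using eval_rel_var[of w i] that by (simp add: w_def)
  have Y: "eval_rel w (var (p + j)) (y j)" for j using eval_rel_var[of w "p + j"] by (simp add: w_def)
  let ?Y = "\<lambda>j. var (p + j)"
  have "typeI_lhs p q k var ?Y = typeI_rhs p q k var ?Y"
  proof (rule typeI_units[OF p q var_var_inv])
    show "vandermonde p var \<noteq> 0" by (rule laurent_vandermonde_nonzero) (simp add: inj_on_def var_inject)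
    show "vandermonde q ?Y \<noteq> 0" by (rule laurent_vandermonde_nonzero) (simp add: inj_on_def var_inject)
  qed
  moreover have "eval_rel w (typeI_lhs p q k var ?Y) (typeI_lhs p q k x y)"
    unfolding typeI_lhs_def
    by (intro R_mult R_prod R_sum R_schur) (auto intro!: R_diff R_mult R_one X Y)
  moreover have "eval_rel w (typeI_rhs p q k var ?Y) (typeI_rhs p q k x y)"
    unfolding typeI_rhs_def
    by (intro R_sum R_mult R_schur R_power R_uminus R_one X Y)
  ultimately show ?thesis using eval_rel_eq by metis
qed

section \<open>Even columns, odd columns and even rows\<close>

text \<open>
  Column lengths are even if and only if rows come in pairs of equal length; they are all odd, for all
  \<open>k\<close> columns, if and only if the first row is full and the remaining rows come in such pairs.
\<close>

definition even_cols :: "(nat \<Rightarrow> nat) \<Rightarrow> bool" where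
  "even_cols f \<longleftrightarrow> (\<forall>i. f (2 * i) = f (2 * i + 1))"

definition odd_cols :: "nat \<Rightarrow> (nat \<Rightarrow> nat) \<Rightarrow> bool" where
  "odd_cols k f \<longleftrightarrow> f 0 = k \<and> (\<forall>i. f (2 * i + 1) = f (2 * i + 2))"

definition even_rows :: "(nat \<Rightarrow> nat) \<Rightarrow> bool" where
  "even_rows f \<longleftrightarrow> (\<forall>i. even (f i))"

definition sum_even_cols :: "nat \<Rightarrow> nat \<Rightarrow> (nat \<Rightarrow> 'a::comm_ring_1) \<Rightarrow> 'a" where
  "sum_even_cols n k x = (\<Sum>f\<in>{f \<in> shapes n k. even_cols f}. schur_fun n f x)"

definition sum_odd_cols :: "nat \<Rightarrow> nat \<Rightarrow> (nat \<Rightarrow> 'a::comm_ring_1) \<Rightarrow> 'a" where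
  "sum_odd_cols n k x = (\<Sum>f\<in>{f \<in> shapes n k. odd_cols k f}. schur_fun n f x)"

definition sum_even_rows :: "nat \<Rightarrow> nat \<Rightarrow> (nat \<Rightarrow> 'a::comm_ring_1) \<Rightarrow> 'a" where
  "sum_even_rows n k x = (\<Sum>f\<in>{f \<in> shapes n k. even_rows f}. schur_fun n f x)"

definition sum_all :: "nat \<Rightarrow> nat \<Rightarrow> (nat \<Rightarrow> 'a::comm_ring_1) \<Rightarrow> 'a" where
  "sum_all n k x = (\<Sum>f\<in>shapes n k. schur_fun n f x)"

lemma even_cols_part_iff:
  assumes \<nu>: "\<nu> \<in> Par n k"
  shows "(\<forall>j<k. even (col_len \<nu> j)) \<longleftrightarrow> even_cols (part \<nu>)"
proof -
  have p: "is_partition \<nu>" and k: "part \<nu> 0 \<le> k" using \<nu> by (auto simp: Par_iff)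
  note c = col_iff[OF p]
  show ?thesis
  proof
    assume ev: "\<forall>j<k. even (col_len \<nu> j)"
    show "even_cols (part \<nu>)" unfolding even_cols_def
    proof (rule allI, rule ccontr)
      fix i assume ne: "part \<nu> (2 * i) \<noteq> part \<nu> (2 * i + 1)"
      define j where "j = part \<nu> (2 * i + 1)"
      have lt: "j < part \<nu> (2 * i)" using ne part_antimono[OF p, of "2 * i" "2 * i + 1"] by (simp add: j_def)
      then have "2 * i < col_len \<nu> j" using c by blast
      moreover have "\<not> 2 * i + 1 < col_len \<nu> j" unfolding c j_def by simp
      ultimately have "col_len \<nu> j = 2 * i + 1" by linarith
      moreover have "j < k" using lt part_antimono[OF p, of 0 "2 * i"] k by simp
      ultimately show False using ev by auto
    qed
  next
    assume ev: "even_cols (part \<nu>)"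
    show "\<forall>j<k. even (col_len \<nu> j)"
    proof (intro allI impI, rule ccontr)
      fix j assume "odd (col_len \<nu> j)"
      then obtain i where i: "col_len \<nu> j = 2 * i + 1" by (elim oddE)
      have "j < part \<nu> (2 * i)" using c[of "2 * i" j] i by simp
      moreover have "\<not> j < part \<nu> (2 * i + 1)" using c[of "2 * i + 1" j] i by simp
      ultimately show False using ev by (simp add: even_cols_def)
    qed
  qed
qed

lemma odd_cols_part_iff:
  assumes \<nu>: "\<nu> \<in> Par n k"
  shows "(\<forall>j<k. odd (col_len \<nu> j)) \<longleftrightarrow> odd_cols k (part \<nu>)"
proof -
  have p: "is_partition \<nu>" and k: "part \<nu> 0 \<le> k" using \<nu> by (auto simp: Par_iff)
  note c = col_iff[OF p]
  show ?thesis
  proof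
    assume od: "\<forall>j<k. odd (col_len \<nu> j)"
    have "part \<nu> 0 = k"
    proof (rule ccontr)
      assume "part \<nu> 0 \<noteq> k"
      then have "odd (col_len \<nu> (part \<nu> 0))" using od k by simp
      then have "0 < col_len \<nu> (part \<nu> 0)" by (cases "col_len \<nu> (part \<nu> 0)") auto
      then show False using c by blast
    qed
    moreover have "part \<nu> (2 * i + 1) = part \<nu> (2 * i + 2)" for i
    proof (rule ccontr)
      assume ne: "part \<nu> (2 * i + 1) \<noteq> part \<nu> (2 * i + 2)"
      define j where "j = part \<nu> (2 * i + 2)"
      have lt: "j < part \<nu> (2 * i + 1)" using ne part_antimono[OF p, of "2 * i + 1" "2 * i + 2"] by (simp add: j_def)
      then have "2 * i + 1 < col_len \<nu> j" using c by blast
      moreover have "\<not> 2 * i + 2 < col_len \<nu> j" unfolding c j_def by simp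
      ultimately have "col_len \<nu> j = 2 * i + 2" by linarith
      moreover have "j < k" using lt part_antimono[OF p, of 0 "2 * i + 1"] k by simp
      ultimately show False using od by auto
    qed
    ultimately show "odd_cols k (part \<nu>)" by (simp add: odd_cols_def)
  next
    assume od: "odd_cols k (part \<nu>)"
    show "\<forall>j<k. odd (col_len \<nu> j)"
    proof (intro allI impI, rule ccontr)
      fix j assume "j < k" "\<not> odd (col_len \<nu> j)"
      then have pos: "0 < col_len \<nu> j" and "even (col_len \<nu> j)" using od c[of 0 j] by (auto simp: odd_cols_def)
      then obtain d where "col_len \<nu> j = 2 * d" by (elim evenE)
      then obtain i where i: "col_len \<nu> j = 2 * i + 2" using pos by (cases d) auto
      have "j < part \<nu> (2 * i + 1)" using c[of "2 * i + 1" j] i by simp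
      moreover have "\<not> j < part \<nu> (2 * i + 2)" using c[of "2 * i + 2" j] i by simp
      ultimately show False using od by (simp add: odd_cols_def)
    qed
  qed
qed

lemma even_rows_part_iff:
  "(\<forall>i<length \<nu>. even (row_len \<nu> i)) \<longleftrightarrow> even_rows (part \<nu>)"
  unfolding row_len_part even_rows_def by (auto simp: part_def)

lemma sum_Par: "(\<Sum>\<nu> | \<nu> \<in> Par n k \<and> P \<nu>. schur n \<nu> x) = (\<Sum>f\<in>{f \<in> shapes n k. Q f}. schur_fun n f x)"
  if PQ: "\<And>\<nu>. \<nu> \<in> Par n k \<Longrightarrow> P \<nu> \<longleftrightarrow> Q (part \<nu>)"
proof -
  have b: "bij_betw part {\<nu> \<in> Par n k. P \<nu>} {f \<in> shapes n k. Q f}"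
  proof (rule bij_betw_subset[OF part_bij_Par])
    show "part ` {\<nu> \<in> Par n k. P \<nu>} = {f \<in> shapes n k. Q f}"
      using bij_betw_imp_surj_on[OF part_bij_Par[of n k], symmetric] PQ by auto
  qed auto
  show ?thesis unfolding schur_eq_schur_fun
    using sum.reindex_bij_betw[OF b, of "\<lambda>f. schur_fun n f x"] by simp
qed

lemma typeIIIa_lhs_eq: "typeIIIa_lhs n k x = prod_less n x * sum_even_cols n k x"
  unfolding typeIIIa_lhs_def sum_even_cols_def
  by (subst sum_Par[where Q = even_cols]) (simp_all add: even_cols_part_iff)

lemma typeIIIb_lhs_eq: "typeIIIb_lhs n k x = prod_less n x * sum_odd_cols n k x"
  unfolding typeIIIb_lhs_def sum_odd_cols_def
  by (subst sum_Par[where Q = "odd_cols k"]) (simp_all add: odd_cols_part_iff)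

lemma typeII_lhs_eq: "typeII_lhs n k x = prod_le n x * sum_even_rows n (2 * k) x"
  unfolding typeII_lhs_def sum_even_rows_def
  by (subst sum_Par[where Q = even_rows]) (simp_all add: even_rows_part_iff)

text \<open>
  The number of columns of odd length of \<open>g\<close>.
\<close>

definition alt_size :: "nat \<Rightarrow> (nat \<Rightarrow> nat) \<Rightarrow> nat" where
  "alt_size n g = (\<Sum>i<n. if even i then g i - g (Suc i) else 0)"

lemma sum_branch:
  "(\<Sum>f\<in>{f \<in> shapes (Suc n) k. P f}. schur_fun (Suc n) f x) =
   (\<Sum>g\<in>shapes n k. \<Sum>f\<in>{f \<in> shapes (Suc n) k. P f \<and> g \<in> interlacing n f}. schur_fun n g x * x n ^ (weight (Suc n) f - weight n g))"
proof -
  have "(\<Sum>f\<in>{f \<in> shapes (Suc n) k. P f}. schur_fun (Suc n) f x) =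
    (\<Sum>f\<in>{f \<in> shapes (Suc n) k. P f}. \<Sum>g\<in>{g \<in> shapes n k. g \<in> interlacing n f}. schur_fun n g x * x n ^ (weight (Suc n) f - weight n g))"
  proof (rule sum.cong[OF refl])
    fix f assume "f \<in> {f \<in> shapes (Suc n) k. P f}"
    then have f: "f \<in> shapes (Suc n) k" by simp
    have "{g \<in> shapes n k. g \<in> interlacing n f} = interlacing n f" using interlacing_shapes[OF f] by auto
    then show "schur_fun (Suc n) f x = (\<Sum>g\<in>{g \<in> shapes n k. g \<in> interlacing n f}. schur_fun n g x * x n ^ (weight (Suc n) f - weight n g))"
      by (simp add: schur_fun_branching[OF f])
  qed
  also have "\<dots> = (\<Sum>g\<in>shapes n k. \<Sum>f\<in>{f \<in> {f \<in> shapes (Suc n) k. P f}. g \<in> interlacing n f}. schur_fun n g x * x n ^ (weight (Suc n) f - weight n g))"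
    by (rule sum.swap_restrict) auto
  finally show ?thesis by simp
qed

text \<open>
  The shapes that arise from \<open>g\<close> by adding one box to each column of odd length and, respectively, to
  each of the \<open>k\<close> columns of even length. They are the only shapes interlaced by \<open>g\<close> whose columns have even length,
  and odd length, respectively.
\<close>

definition even_fill :: "(nat \<Rightarrow> nat) \<Rightarrow> nat \<Rightarrow> nat" where
  "even_fill g i = (if even i then g i else g (i - 1))"

definition odd_fill :: "nat \<Rightarrow> (nat \<Rightarrow> nat) \<Rightarrow> nat \<Rightarrow> nat" where
  "odd_fill k g i = (if odd i then g i else if i = 0 then k else g (i - 1))"

lemma even_cols_branch:
  assumes g: "g \<in> shapes n k"
  shows "{f \<in> shapes (Suc n) k. even_cols f \<and> g \<in> interlacing n f} = {even_fill g}"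
proof (intro Set.set_eqI iffI)
  fix f assume "f \<in> {f \<in> shapes (Suc n) k. even_cols f \<and> g \<in> interlacing n f}"
  then have f: "f \<in> shapes (Suc n) k" and ev: "even_cols f" and interlacing: "g \<in> interlacing n f" by auto
  have lo: "g i \<le> f i" for i using interlacing by (cases "i < n") (auto simp: interlacing_def)
  have hi: "f (Suc i) \<le> g i" for i
    using interlacing shapes_zero[OF f, of "Suc i"] by (cases "i < n") (auto simp: interlacing_def)
  have "f i = even_fill g i" for i
  proof (cases "even i")
    case True
    then obtain d where i: "i = 2 * d" by (elim evenE)
    then have "f i = f (Suc i)" using ev by (simp add: even_cols_def)
    then show ?thesis using lo[of i] hi[of i] True by (simp add: even_fill_def)
  next
    case False
    then obtain d where i: "i = 2 * d + 1" by (elim oddE)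
    then have "f i = f (2 * d)" using ev by (simp add: even_cols_def)
    then show ?thesis using lo[of "2 * d"] hi[of "2 * d"] i by (simp add: even_fill_def)
  qed
  then show "f \<in> {even_fill g}" by auto
next
  fix f assume "f \<in> {even_fill g}"
  then have f: "f = even_fill g" by simp
  have D: "g j \<le> g i" if "i \<le> j" for i j using shapes_antimono[OF g that] .
  have "f \<in> shapes (Suc n) k"
  proof -
    have "f (Suc i) \<le> f i" for i using D[of "i - 1" "Suc i"] D[of i "Suc i"] D[of "i - 1" i] by (auto simp: f even_fill_def)
    moreover have "f i = 0" if "Suc n \<le> i" for i using shapes_zero[OF g] that by (simp add: f even_fill_def)
    ultimately show ?thesis using shapes_le[OF g, of 0] by (simp add: shapes_def f even_fill_def)
  qed
  moreover have "even_cols f" by (simp add: even_cols_def f even_fill_def)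
  moreover have "g \<in> interlacing n f"
    using D shapes_zero[OF g] by (auto simp: interlacing_def f even_fill_def)
  ultimately show "f \<in> {f \<in> shapes (Suc n) k. even_cols f \<and> g \<in> interlacing n f}" by simp
qed

lemma odd_cols_branch:
  assumes g: "g \<in> shapes n k"
  shows "{f \<in> shapes (Suc n) k. odd_cols k f \<and> g \<in> interlacing n f} = {odd_fill k g}"
proof (intro Set.set_eqI iffI)
  fix f assume "f \<in> {f \<in> shapes (Suc n) k. odd_cols k f \<and> g \<in> interlacing n f}"
  then have f: "f \<in> shapes (Suc n) k" and od: "odd_cols k f" and interlacing: "g \<in> interlacing n f" by auto
  have lo: "g i \<le> f i" for i using interlacing by (cases "i < n") (auto simp: interlacing_def)
  have hi: "f (Suc i) \<le> g i" for i
    using interlacing shapes_zero[OF f, of "Suc i"] by (cases "i < n") (auto simp: interlacing_def)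
  have od': "f (2 * d + 1) = f (2 * d + 2)" for d using od by (simp add: odd_cols_def)
  have "f i = odd_fill k g i" for i
  proof (cases "odd i")
    case True
    then obtain d where i: "i = 2 * d + 1" by (elim oddE)
    then have "f i = f (Suc i)" using od'[of d] by simp
    then show ?thesis using lo[of i] hi[of i] True by (simp add: odd_fill_def)
  next
    case False
    then obtain d where i: "i = 2 * d" by (auto elim: evenE)
    show ?thesis
    proof (cases d)
      case 0
      then show ?thesis using od i by (simp add: odd_cols_def odd_fill_def)
    next
      case (Suc d')
      then have "f i = f (i - 1)" using od'[of d'] i by simp
      moreover have "Suc (i - 1) = i" using i Suc by simp
      ultimately show ?thesis using lo[of "i - 1"] hi[of "i - 1"] False i Suc by (simp add: odd_fill_def)
    qed
  qed
  then show "f \<in> {odd_fill k g}" by auto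
next
  fix f assume "f \<in> {odd_fill k g}"
  then have f: "f = odd_fill k g" by simp
  have D: "g j \<le> g i" if "i \<le> j" for i j using shapes_antimono[OF g that] .
  have "f \<in> shapes (Suc n) k"
  proof -
    have "f (Suc i) \<le> f i" for i
      using D[of "i - 1" "Suc i"] D[of i "Suc i"] D[of "i - 1" i] shapes_le[OF g] by (auto simp: f odd_fill_def)
    moreover have "f i = 0" if "Suc n \<le> i" for i using shapes_zero[OF g] that by (simp add: f odd_fill_def)
    ultimately show ?thesis by (simp add: shapes_def f odd_fill_def)
  qed
  moreover have "odd_cols k f" by (simp add: odd_cols_def f odd_fill_def)
  moreover have "g \<in> interlacing n f"
    using D shapes_zero[OF g] shapes_le[OF g] by (auto simp: interlacing_def f odd_fill_def)
  ultimately show "f \<in> {f \<in> shapes (Suc n) k. odd_cols k f \<and> g \<in> interlacing n f}" by simp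
qed

lemma weight_even_fill:
  assumes g: "g \<in> shapes n k"
  shows "weight (Suc n) (even_fill g) - weight n g = alt_size n g"
proof -
  have "g \<in> interlacing n (even_fill g)" using even_cols_branch[OF g] by auto
  then have "weight (Suc n) (even_fill g) - weight n g = (\<Sum>i<Suc n. even_fill g i - g i)" by (rule interlacing_sum(1))
  also have "\<dots> = (even_fill g 0 - g 0) + (\<Sum>i<n. even_fill g (Suc i) - g (Suc i))"
    by (rule sum.lessThan_Suc_shift)
  also have "\<dots> = alt_size n g"
    unfolding alt_size_def by (auto simp: even_fill_def intro!: sum.cong)
  finally show ?thesis .
qed

lemma weight_odd_fill:
  assumes g: "g \<in> shapes n k"
  shows "weight (Suc n) (odd_fill k g) - weight n g = k - alt_size n g" "alt_size n g \<le> k"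
proof -
  have "g \<in> interlacing n (even_fill g)" using even_cols_branch[OF g] by auto
  note e = interlacing_sum(1)[OF this]
  have "g \<in> interlacing n (odd_fill k g)" using odd_cols_branch[OF g] by auto
  note o = interlacing_sum(1)[OF this]
  have D: "g (Suc i) \<le> g i" for i using shapes_antimono[OF g, of i "Suc i"] by simp
  (* The boxes added in one way and those added in the other make up one box per column; row by row
     the sum telescopes. *)
  have tele: "(\<Sum>i<Suc m. (even_fill g i - g i) + (odd_fill k g i - g i)) + g m = k" for m
  proof (induction m)
    case 0
    then show ?case using shapes_le[OF g] by (simp add: even_fill_def odd_fill_def)
  next
    case (Suc m)
    have "(even_fill g (Suc m) - g (Suc m)) + (odd_fill k g (Suc m) - g (Suc m)) + g (Suc m) = g m"
      using D[of m] by (simp add: even_fill_def odd_fill_def)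
    then show ?case using Suc by simp
  qed
  have "(weight (Suc n) (even_fill g) - weight n g) + (weight (Suc n) (odd_fill k g) - weight n g) = k"
    unfolding e o using tele[of n] shapes_zero[OF g, of n] by (simp add: sum.distrib)
  then show "weight (Suc n) (odd_fill k g) - weight n g = k - alt_size n g" "alt_size n g \<le> k"
    unfolding weight_even_fill[OF g] by auto
qed

lemma sum_even_cols_Suc: "sum_even_cols (Suc n) k x = (\<Sum>g\<in>shapes n k. schur_fun n g x * x n ^ alt_size n g)"
  unfolding sum_even_cols_def sum_branch by (rule sum.cong[OF refl]) (simp add: even_cols_branch weight_even_fill)

lemma sum_odd_cols_Suc: "sum_odd_cols (Suc n) k x = (\<Sum>g\<in>shapes n k. schur_fun n g x * x n ^ (k - alt_size n g))"
  unfolding sum_odd_cols_def sum_branch by (rule sum.cong[OF refl]) (simp add: odd_cols_branch weight_odd_fill)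

lemma power_inverse_cancel:
  fixes t ti :: "'a::comm_ring_1"
  assumes "t * ti = 1" "d \<le> k"
  shows "t ^ k * ti ^ d = t ^ (k - d)"
proof -
  have "t ^ k = t ^ (k - d) * t ^ d" using assms(2) by (simp flip: power_add)
  then have "t ^ k * ti ^ d = t ^ (k - d) * (t * ti) ^ d" by (simp add: power_mult_distrib mult_ac)
  then show ?thesis using assms(1) by simp
qed

lemma schur_fun_upd: "schur_fun n g (x(n := t)) = schur_fun n g x"
  unfolding schur_fun_def by (intro sum.cong prod.cong refl) (metis fillings_less fun_upd_other less_irrefl)

text \<open>
  In the branching rule the last variable has exponent \<open>alt_size n g\<close> for even columns and
  \<open>k - alt_size n g\<close> for odd ones. Inverting it therefore exchanges the two sums.
\<close>

lemma sum_even_cols_flip: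
  fixes x :: "nat \<Rightarrow> 'a::comm_ring_1"
  assumes "x n * ti = 1"
  shows "x n ^ k * sum_even_cols (Suc n) k (x(n := ti)) = sum_odd_cols (Suc n) k x"
  unfolding sum_even_cols_Suc sum_odd_cols_Suc sum_distrib_left
proof (rule sum.cong[OF refl])
  fix g assume g: "g \<in> shapes n k"
  have "x n ^ k * ti ^ alt_size n g = x n ^ (k - alt_size n g)"
    by (rule power_inverse_cancel[OF assms weight_odd_fill(2)[OF g]])
  then show "x n ^ k * (schur_fun n g (x(n := ti)) * (x(n := ti)) n ^ alt_size n g) = schur_fun n g x * x n ^ (k - alt_size n g)"
    by (simp only: schur_fun_upd fun_upd_same mult.left_commute[of "x n ^ k"])
qed

lemma sum_odd_cols_flip:
  fixes x :: "nat \<Rightarrow> 'a::comm_ring_1"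
  assumes "x n * ti = 1"
  shows "x n ^ k * sum_odd_cols (Suc n) k (x(n := ti)) = sum_even_cols (Suc n) k x"
  unfolding sum_even_cols_Suc sum_odd_cols_Suc sum_distrib_left
proof (rule sum.cong[OF refl])
  fix g assume g: "g \<in> shapes n k"
  have "x n ^ k * ti ^ (k - alt_size n g) = x n ^ alt_size n g"
    using power_inverse_cancel[OF assms, of "k - alt_size n g" k] weight_odd_fill(2)[OF g] by simp
  then show "x n ^ k * (schur_fun n g (x(n := ti)) * (x(n := ti)) n ^ (k - alt_size n g)) = schur_fun n g x * x n ^ alt_size n g"
    by (simp only: schur_fun_upd fun_upd_same mult.left_commute[of "x n ^ k"])
qed

lemma even_ceil_le: "g \<le> f \<Longrightarrow> even f \<Longrightarrow> 2 * ((g + 1) div 2) \<le> (f::nat)"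
  by presburger

lemma even_floor_ge: "f \<le> g \<Longrightarrow> even f \<Longrightarrow> f \<le> 2 * (g div 2 :: nat)"
  by presburger

lemma even_ceil_floor:
  fixes g :: nat
  shows "g \<le> 2 * ((g + 1) div 2)" "2 * (g div 2) \<le> g" "2 * ((g + 1) div 2) + 2 * (g div 2) = 2 * g"
  by presburger+

text \<open>
  For a fixed \<open>g\<close>, row \<open>i\<close> of a shape with even rows that \<open>g\<close> interlaces ranges over the even numbers
  from \<open>g i\<close> rounded up to \<open>g (i - 1)\<close> rounded down, where the upper bound for \<open>i = 0\<close> is \<open>N\<close>. These ranges
  are independent, and each row is reflected in the middle of its range.
\<close>

definition refl_row :: "nat \<Rightarrow> (nat \<Rightarrow> nat) \<Rightarrow> (nat \<Rightarrow> nat) \<Rightarrow> nat \<Rightarrow> nat" where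
  "refl_row N g f i = 2 * ((g i + 1) div 2) + (if i = 0 then N else 2 * (g (i - 1) div 2)) - f i"

lemma refl_row:
  assumes g: "g \<in> shapes n N" and N: "even N"
    and f: "f \<in> {f \<in> shapes (Suc n) N. even_rows f \<and> g \<in> interlacing n f}"
  shows "refl_row N g f \<in> {f \<in> shapes (Suc n) N. even_rows f \<and> g \<in> interlacing n f}"
    "refl_row N g (refl_row N g f) = f"
    "(weight (Suc n) f - weight n g) + (weight (Suc n) (refl_row N g f) - weight n g) = N"
proof -
  have fD: "f \<in> shapes (Suc n) N" and ev: "even (f i)" and interlacing: "g \<in> interlacing n f" for i using f by (auto simp: even_rows_def)
  define lo hi where "lo i = 2 * ((g i + 1) div 2)" and "hi i = (if i = 0 then N else 2 * (g (i - 1) div 2))" for i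
  have r: "refl_row N g h i = lo i + hi i - h i" for h i by (simp add: refl_row_def lo_def hi_def)
  have gf: "g i \<le> f i" for i using interlacing by (cases "i < n") (auto simp: interlacing_def)
  have fg: "f (Suc i) \<le> g i" for i
    using interlacing shapes_zero[OF fD, of "Suc i"] by (cases "i < n") (auto simp: interlacing_def)
  have lof: "lo i \<le> f i" for i
    unfolding lo_def by (rule even_ceil_le[OF gf ev])
  have fhi: "f i \<le> hi i" for i
  proof (cases i)
    case 0
    then show ?thesis using shapes_le[OF fD, of 0] by (simp add: hi_def)
  next
    case (Suc j)
    then show ?thesis using even_floor_ge[OF fg[of j]] ev[of i] unfolding hi_def by simp
  qed
  have sum: "f i + refl_row N g f i = lo i + hi i" for i using lof[of i] fhi[of i] r[of f i] by linarith
  have lor: "lo i \<le> refl_row N g f i" for i using sum[of i] fhi[of i] by linarith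
  have rhi: "refl_row N g f i \<le> hi i" for i using sum[of i] lof[of i] by linarith
  have glo: "g i \<le> lo i" for i unfolding lo_def by (rule even_ceil_floor(1))
  have hig: "hi (Suc i) \<le> g i" for i using even_ceil_floor(2)[of "g i"] by (simp add: hi_def)
  have D: "refl_row N g f \<in> shapes (Suc n) N"
  proof -
    have "refl_row N g f (Suc i) \<le> refl_row N g f i" for i
      using rhi[of "Suc i"] hig[of i] glo[of i] lor[of i] by linarith
    moreover have "refl_row N g f 0 \<le> N" using rhi[of 0] by (simp add: hi_def)
    moreover have "refl_row N g f i = 0" if "Suc n \<le> i" for i
      using rhi[of i] hig[of "i - 1"] shapes_zero[OF g, of "i - 1"] that by simp
    ultimately show ?thesis by (simp add: shapes_def)
  qed
  have il2: "g \<in> interlacing n (refl_row N g f)"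
  proof -
    have "refl_row N g f (Suc i) \<le> g i \<and> g i \<le> refl_row N g f i" for i
      using rhi[of "Suc i"] hig[of i] glo[of i] lor[of i] by linarith
    then show ?thesis using shapes_zero[OF g] by (simp add: interlacing_def)
  qed
  have "even (lo i + hi i)" for i using N by (simp add: lo_def hi_def)
  then have "even (refl_row N g f i)" for i using sum[of i] ev[of i] by (metis even_add)
  then show "refl_row N g f \<in> {f \<in> shapes (Suc n) N. even_rows f \<and> g \<in> interlacing n f}"
    using D il2 by (simp add: even_rows_def)
  show "refl_row N g (refl_row N g f) = f"
  proof
    fix i show "refl_row N g (refl_row N g f) i = f i"
      using r[of "refl_row N g f" i] sum[of i] by linarith
  qed
  (* Rounding g m up and rounding it down adds up to 2 * g m, so the bounds telescope. *)
  have tele: "(\<Sum>i<Suc m. lo i + hi i) = N + 2 * (\<Sum>i<m. g i) + lo m" for m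
  proof (induction m)
    case (Suc m)
    have "lo m + hi (Suc m) = 2 * g m" using even_ceil_floor(3)[of "g m"] unfolding lo_def hi_def by simp
    then show ?case using Suc by simp
  qed (simp add: hi_def)
  have "weight (Suc n) f + weight (Suc n) (refl_row N g f) = (\<Sum>i<Suc n. lo i + hi i)"
    unfolding weight_def sum.distrib[symmetric] sum ..
  also have "\<dots> = N + 2 * weight n g" using tele[of n] shapes_zero[OF g, of n] by (simp add: weight_def lo_def)
  finally show "(weight (Suc n) f - weight n g) + (weight (Suc n) (refl_row N g f) - weight n g) = N"
    using interlacing_sum(2)[OF interlacing] interlacing_sum(2)[OF il2] by linarith
qed

text \<open>
  The reflection of rows complements the exponent of the last variable in the branching rule.
\<close>

lemma sum_even_rows_flip:
  fixes x :: "nat \<Rightarrow> 'a::comm_ring_1"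
  assumes t: "x n * ti = 1" and N: "even N"
  shows "x n ^ N * sum_even_rows (Suc n) N (x(n := ti)) = sum_even_rows (Suc n) N x"
proof -
  have "(\<Sum>f\<in>{f \<in> shapes (Suc n) N. even_rows f \<and> g \<in> interlacing n f}. x n ^ N * (schur_fun n g x * ti ^ (weight (Suc n) f - weight n g))) =
    (\<Sum>f\<in>{f \<in> shapes (Suc n) N. even_rows f \<and> g \<in> interlacing n f}. schur_fun n g x * x n ^ (weight (Suc n) f - weight n g))"
    if g: "g \<in> shapes n N" for g
  proof (rule sum.reindex_bij_witness[where i = "refl_row N g" and j = "refl_row N g"])
    fix f assume f: "f \<in> {f \<in> shapes (Suc n) N. even_rows f \<and> g \<in> interlacing n f}"
    note r = refl_row[OF g N f]
    show "refl_row N g (refl_row N g f) = f" "refl_row N g f \<in> {f \<in> shapes (Suc n) N. even_rows f \<and> g \<in> interlacing n f}"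
      using r by auto
    have "x n ^ N * ti ^ (weight (Suc n) f - weight n g) = x n ^ (weight (Suc n) (refl_row N g f) - weight n g)"
    proof -
      have "x n ^ N * ti ^ (weight (Suc n) f - weight n g) = x n ^ (N - (weight (Suc n) f - weight n g))"
        by (rule power_inverse_cancel[OF t]) (use r(3) in linarith)
      also have "N - (weight (Suc n) f - weight n g) = weight (Suc n) (refl_row N g f) - weight n g" using r(3) by linarith
      finally show ?thesis .
    qed
    then show "schur_fun n g x * x n ^ (weight (Suc n) (refl_row N g f) - weight n g) = x n ^ N * (schur_fun n g x * ti ^ (weight (Suc n) f - weight n g))"
      by (simp only: mult.left_commute[of "x n ^ N"])
  next
    fix f assume f: "f \<in> {f \<in> shapes (Suc n) N. even_rows f \<and> g \<in> interlacing n f}"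
    show "refl_row N g (refl_row N g f) = f" "refl_row N g f \<in> {f \<in> shapes (Suc n) N. even_rows f \<and> g \<in> interlacing n f}"
      using refl_row[OF g N f] by auto
  qed
  note eq = this
  show ?thesis
    unfolding sum_even_rows_def sum_branch sum_distrib_left schur_fun_upd fun_upd_same by (rule sum.cong[OF refl eq])
qed

section \<open>Vertical strips and the dual Pieri rule\<close>

definition ind :: "nat set \<Rightarrow> nat \<Rightarrow> nat" where
  "ind X i = (if i \<in> X then 1 else 0)"

lemma Det_add_cols:
  "Det n (\<lambda>i j. M i j + N i j) = (\<Sum>X\<in>Pow {..<n}. Det n (\<lambda>i j. if j \<in> X then N i j else M i j))"
proof -
  have "Det n (\<lambda>i j. M i j + N i j) = Det n (\<lambda>i j. \<Sum>a\<in>UNIV. if a then N i j else M i j)"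
    by (simp add: UNIV_bool add.commute)
  also have "\<dots> = (\<Sum>f\<in>PiE {..<n} (\<lambda>_. UNIV). Det n (\<lambda>i j. if f j then N i j else M i j))"
    by (rule Det_sum_cols) simp
  also have "\<dots> = (\<Sum>X\<in>Pow {..<n}. Det n (\<lambda>i j. if j \<in> X then N i j else M i j))"
  proof (rule sum.reindex_bij_witness[where i = "\<lambda>X. \<lambda>j\<in>{..<n}. j \<in> X" and j = "\<lambda>f. {j \<in> {..<n}. f j}"])
    fix f :: "nat \<Rightarrow> bool" assume f: "f \<in> PiE {..<n} (\<lambda>_. UNIV)"
    show "(\<lambda>j\<in>{..<n}. j \<in> {j \<in> {..<n}. f j}) = f"
    proof
      fix j show "(\<lambda>j\<in>{..<n}. j \<in> {j \<in> {..<n}. f j}) j = f j"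
        using PiE_arb[OF f, of j] by (cases "j < n") auto
    qed
    show "Det n (\<lambda>i j. if j \<in> {j \<in> {..<n}. f j} then N i j else M i j) = Det n (\<lambda>i j. if f j then N i j else M i j)"
      by (rule Det_cong) simp
  qed auto
  finally show ?thesis .
qed

lemma alternant_times_linear:
  fixes x :: "nat \<Rightarrow> 'a::comm_ring_1"
  shows "(\<Prod>i<n. 1 + c * x i) * alternant n x e = (\<Sum>X\<in>Pow {..<n}. c ^ card X * alternant n x (\<lambda>i. e i + ind X i))"
proof -
  have "(\<Prod>i<n. 1 + c * x i) * alternant n x e = Det n (\<lambda>i j. x i ^ e j + c * x i ^ Suc (e j))"
    unfolding alternant_def Det_scale_rows[symmetric] by (rule Det_cong) (simp add: algebra_simps)
  also have "\<dots> = (\<Sum>X\<in>Pow {..<n}. Det n (\<lambda>i j. if j \<in> X then c * x i ^ Suc (e j) else x i ^ e j))"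
    by (rule Det_add_cols)
  also have "\<dots> = (\<Sum>X\<in>Pow {..<n}. c ^ card X * alternant n x (\<lambda>i. e i + ind X i))"
  proof (rule sum.cong[OF refl])
    fix X assume "X \<in> Pow {..<n}"
    then have X: "X \<subseteq> {..<n}" by simp
    have "Det n (\<lambda>i j. if j \<in> X then c * x i ^ Suc (e j) else x i ^ e j) =
      Det n (\<lambda>i j. (if j \<in> X then c else 1) * x i ^ (e j + ind X j))"
      by (rule Det_cong) (simp add: ind_def)
    also have "\<dots> = (\<Prod>j<n. if j \<in> X then c else 1) * alternant n x (\<lambda>i. e i + ind X i)"
      unfolding Det_scale_cols[of n "\<lambda>j. if j \<in> X then c else 1"] alternant_def ..
    also have "(\<Prod>j<n. if j \<in> X then c else 1) = c ^ card X"
      using X by (simp add: prod.If_cases Int_absorb1)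
    finally show "Det n (\<lambda>i j. if j \<in> X then c * x i ^ Suc (e j) else x i ^ e j) =
      c ^ card X * alternant n x (\<lambda>i. e i + ind X i)" .
  qed
  finally show ?thesis .
qed

text \<open>
  The vertical strips, given by their rows, that can be removed from \<open>\<tau>\<close> so as to leave a shape with
  rows of length at most \<open>k\<close>.
\<close>

definition strips :: "nat \<Rightarrow> nat \<Rightarrow> (nat \<Rightarrow> nat) \<Rightarrow> nat set set" where
  "strips n k \<tau> = {X. X \<subseteq> {..<n} \<and> (\<forall>i\<in>X. 0 < \<tau> i) \<and> (\<lambda>i. \<tau> i - ind X i) \<in> shapes n k}"

text \<open>
  The dual Pieri rule for a weighted sum. Multiplying an alternant by \<open>\<Prod>i<n. 1 + c * x i\<close> raises
  the exponents in an arbitrary set of columns. When the result is not a partition, two exponents coincide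
  and the alternant vanishes.
\<close>

lemma pieri:
  fixes x :: "nat \<Rightarrow> 'a::comm_ring_1"
  shows "(\<Prod>i<n. 1 + c * x i) * (\<Sum>g\<in>shapes n k. w g * alternant n x (beta n g)) =
    (\<Sum>\<tau>\<in>shapes n (Suc k). alternant n x (beta n \<tau>) * (\<Sum>X\<in>strips n k \<tau>. w (\<lambda>i. \<tau> i - ind X i) * c ^ card X))"
proof -
  let ?add = "\<lambda>(g, X) i. g i + ind X i"
  let ?P = "shapes n k \<times> Pow {..<n}"
  let ?Q = "{(g, X) \<in> ?P. ?add (g, X) \<in> shapes n (Suc k)}"
  let ?h = "\<lambda>(g, X). w g * c ^ card X * alternant n x (beta n (?add (g, X)))"
  have bump: "(\<lambda>i. beta n g i + ind X i) = beta n (?add (g, X))" for g X by (auto simp: beta_def)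
  have "(\<Prod>i<n. 1 + c * x i) * (\<Sum>g\<in>shapes n k. w g * alternant n x (beta n g)) =
    (\<Sum>g\<in>shapes n k. w g * ((\<Prod>i<n. 1 + c * x i) * alternant n x (beta n g)))"
    by (simp add: sum_distrib_left mult.left_commute)
  also have "\<dots> = (\<Sum>g\<in>shapes n k. \<Sum>X\<in>Pow {..<n}. ?h (g, X))"
    unfolding alternant_times_linear bump by (simp add: sum_distrib_left mult.assoc)
  also have "\<dots> = sum ?h ?P" by (simp add: sum.cartesian_product)
  also have "\<dots> = sum ?h ?Q"
  proof (rule sum.mono_neutral_right)
    show "\<forall>gX\<in>?P - ?Q. ?h gX = 0"
    proof
      fix gX assume gX: "gX \<in> ?P - ?Q"
      obtain g X where gx: "gX = (g, X)" by (cases gX)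
      have g: "g \<in> shapes n k" and X: "X \<subseteq> {..<n}" and nD: "?add (g, X) \<notin> shapes n (Suc k)"
        using gX gx by auto
      have "?add (g, X) 0 \<le> Suc k" using shapes_le[OF g, of 0] by (simp add: ind_def)
      moreover have "?add (g, X) i = 0" if "n \<le> i" for i using shapes_zero[OF g that] X that by (auto simp: ind_def)
      ultimately obtain i where i: "\<not> ?add (g, X) (Suc i) \<le> ?add (g, X) i"
        using nD by (auto simp: shapes_def)
      have dec: "g (Suc i) \<le> g i" using shapes_antimono[OF g, of i "Suc i"] by simp
      have i': "i \<notin> X" "Suc i \<in> X" "g (Suc i) = g i" using i dec by (auto simp: ind_def split: if_splits)
      then have "Suc i < n" using X by auto
      then have "alternant n x (beta n (?add (g, X))) = 0"
        using i' by (intro alternant_eq_cols[of i n "Suc i"]) (auto simp: beta_def ind_def)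
      then show "?h gX = 0" by (simp add: gx)
    qed
  qed auto
  also have "\<dots> = (\<Sum>\<tau>\<in>shapes n (Suc k). \<Sum>gX\<in>{gX \<in> ?Q. ?add gX = \<tau>}. ?h gX)"
    by (rule sum.group[symmetric]) (auto intro: finite_subset[of _ ?P])
  also have "\<dots> = (\<Sum>\<tau>\<in>shapes n (Suc k). \<Sum>X\<in>strips n k \<tau>. w (\<lambda>i. \<tau> i - ind X i) * c ^ card X * alternant n x (beta n \<tau>))"
  proof (rule sum.cong[OF refl])
    fix \<tau> assume \<tau>: "\<tau> \<in> shapes n (Suc k)"
    show "(\<Sum>gX\<in>{gX \<in> ?Q. ?add gX = \<tau>}. ?h gX) =
      (\<Sum>X\<in>strips n k \<tau>. w (\<lambda>i. \<tau> i - ind X i) * c ^ card X * alternant n x (beta n \<tau>))"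
    proof (rule sum.reindex_bij_witness[where i = "\<lambda>X. (\<lambda>i. \<tau> i - ind X i, X)" and j = snd])
      fix gX assume "gX \<in> {gX \<in> ?Q. ?add gX = \<tau>}"
      then obtain g X where gx: "gX = (g, X)" and g: "g \<in> shapes n k" and X: "X \<subseteq> {..<n}" and t: "\<tau> = (\<lambda>i. g i + ind X i)"
        by (cases gX) auto
      have g': "(\<lambda>i. \<tau> i - ind X i) = g" by (simp add: t)
      show "(\<lambda>i. \<tau> i - ind (snd gX) i, snd gX) = gX" using g' gx by simp
      show "snd gX \<in> strips n k \<tau>" using g g' X by (simp add: gx strips_def) (simp add: t ind_def)
      show "w (\<lambda>i. \<tau> i - ind (snd gX) i) * c ^ card (snd gX) * alternant n x (beta n \<tau>) = ?h gX"
        using g' by (simp add: gx) (simp add: t)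
    next
      fix X assume X: "X \<in> strips n k \<tau>"
      have "\<tau> i - ind X i + ind X i = \<tau> i" for i using X by (cases "i \<in> X") (auto simp: strips_def ind_def)
      then have "?add (\<lambda>i. \<tau> i - ind X i, X) = \<tau>" by auto
      then show "(\<lambda>i. \<tau> i - ind X i, X) \<in> {gX \<in> ?Q. ?add gX = \<tau>}"
        using X \<tau> by (auto simp: strips_def)
    qed simp
  qed
  finally show ?thesis by (simp add: sum_distrib_left mult_ac)
qed

lemma finite_strips: "finite (strips n k \<tau>)"
  by (rule finite_subset[of _ "Pow {..<n}"]) (auto simp: strips_def)

text \<open>
  The only vertical strip that leaves even rows has one box in each odd row.
\<close>

lemma strips_even_rows:
  assumes \<tau>: "\<tau> \<in> shapes n (Suc N)" and N: "even N"
  shows "(\<Sum>X\<in>strips n N \<tau>. (if even_rows (\<lambda>i. \<tau> i - ind X i) then 1 else 0) * 1 ^ card X) = (1 :: 'a::comm_ring_1)"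
proof -
  let ?X = "{i. odd (\<tau> i)}"
  have ev: "even_rows (\<lambda>i. \<tau> i - ind X i) \<longleftrightarrow> X = ?X" if "X \<in> strips n N \<tau>" for X
  proof -
    have "even (\<tau> i - ind X i) \<longleftrightarrow> (i \<in> X \<longleftrightarrow> odd (\<tau> i))" for i
      using that by (cases "i \<in> X") (auto simp: strips_def ind_def)
    then show ?thesis unfolding even_rows_def by auto
  qed
  have half: "\<tau> i - ind ?X i = 2 * (\<tau> i div 2)" for i by (auto simp: ind_def odd_two_times_div_two_nat)
  have "?X \<in> strips n N \<tau>"
  proof -
    have "i < n" if "odd (\<tau> i)" for i using shapes_zero[OF \<tau>, of i] that by (cases "n \<le> i") auto
    moreover have "0 < \<tau> i" if "odd (\<tau> i)" for i using that by (cases "\<tau> i") auto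
    moreover have "(\<lambda>i. 2 * (\<tau> i div 2)) \<in> shapes n N"
    proof -
      have "2 * (\<tau> (Suc i) div 2) \<le> 2 * (\<tau> i div 2)" for i
        using shapes_antimono[OF \<tau>, of i "Suc i"] by (simp add: div_le_mono)
      moreover have "2 * (\<tau> 0 div 2) \<le> N"
      proof -
        obtain d where "N = 2 * d" using N by (elim evenE)
        then show ?thesis using shapes_le[OF \<tau>, of 0] by simp
      qed
      ultimately show ?thesis using shapes_zero[OF \<tau>] by (simp add: shapes_def)
    qed
    ultimately show ?thesis unfolding strips_def by (auto simp: half)
  qed
  then show ?thesis by (simp add: ev finite_strips cong: sum.cong)
qed

lemma sum_involution_zero:
  fixes w :: "'b \<Rightarrow> 'a::comm_ring_1"
  assumes "finite B" and "\<And>X. X \<in> B \<Longrightarrow> h X \<in> B" "\<And>X. X \<in> B \<Longrightarrow> h (h X) = X"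
    "\<And>X. X \<in> B \<Longrightarrow> w (h X) = - w X" "\<And>X. X \<in> B \<Longrightarrow> P (h X) \<longleftrightarrow> \<not> P X"
  shows "sum w B = 0"
proof -
  have "sum w {X \<in> B. \<not> P X} = (\<Sum>X\<in>{X \<in> B. P X}. - w X)"
    by (rule sum.reindex_bij_witness[where i = h and j = h]) (use assms in auto)
  moreover have "sum w B = sum w ({X \<in> B. P X} \<union> {X \<in> B. \<not> P X})"
    by (rule arg_cong[of _ _ "sum w"]) auto
  then have "sum w B = sum w {X \<in> B. P X} + sum w {X \<in> B. \<not> P X}"
    by (subst (asm) sum.union_disjoint) (use assms(1) in auto)
  ultimately show ?thesis by (simp add: sum_negf)
qed

text \<open>
  A sign-reversing involution. Let \<open>j\<close> be the least even row for which \<open>\<tau> (j + 1) < \<tau> j\<close> or row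
  \<open>j + 1\<close> belongs to the strip. Toggling row \<open>j\<close> gives another strip and changes \<open>card X\<close> and \<open>alt_size\<close>
  by one in opposite directions, so the terms cancel. The condition defining \<open>j\<close> does not refer to the
  membership of even rows, so the same \<open>j\<close> is found again. No \<open>j\<close> exists only for the empty strip of a shape
  with even columns.
\<close>

lemma strips_alt_size:
  fixes t :: "'a::comm_ring_1"
  assumes \<tau>: "\<tau> \<in> shapes n k"
  shows "(\<Sum>X\<in>strips n k \<tau>. t ^ alt_size n (\<lambda>i. \<tau> i - ind X i) * (- t) ^ card X) = (if even_cols \<tau> then 1 else 0)"
proof -
  let ?w = "\<lambda>X. t ^ alt_size n (\<lambda>i. \<tau> i - ind X i) * (- t) ^ card X"
  define bad where "bad X j \<longleftrightarrow> even j \<and> (\<tau> (Suc j) < \<tau> j \<or> Suc j \<in> X)" for X j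
  let ?B = "{X \<in> strips n k \<tau>. \<exists>j. bad X j}"
  define tog where "tog X = (let j = (LEAST j. bad X j) in if j \<in> X then X - {j} else insert j X)" for X
  have dec: "\<tau> (Suc i) \<le> \<tau> i" for i using shapes_antimono[OF \<tau>, of i "Suc i"] by simp
  (* A strip is removable if, wherever a box is taken from row i, row i + 1 is shorter or loses a box
     too. *)
  have strips: "X \<in> strips n k \<tau> \<longleftrightarrow> (\<forall>i\<in>X. 0 < \<tau> i) \<and> (\<forall>i\<in>X. \<tau> (Suc i) < \<tau> i \<or> Suc i \<in> X)" for X
  proof
    assume X: "X \<in> strips n k \<tau>"
    have "\<tau> (Suc i) < \<tau> i \<or> Suc i \<in> X" if "i \<in> X" for i
    proof (rule ccontr)
      assume n: "\<not> (\<tau> (Suc i) < \<tau> i \<or> Suc i \<in> X)"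
      have "\<tau> (Suc i) - ind X (Suc i) \<le> \<tau> i - ind X i" "0 < \<tau> i"
        using X that by (auto simp: strips_def shapes_def)
      then show False using n dec[of i] that by (simp add: ind_def)
    qed
    then show "(\<forall>i\<in>X. 0 < \<tau> i) \<and> (\<forall>i\<in>X. \<tau> (Suc i) < \<tau> i \<or> Suc i \<in> X)"
      using X by (simp add: strips_def)
  next
    assume X: "(\<forall>i\<in>X. 0 < \<tau> i) \<and> (\<forall>i\<in>X. \<tau> (Suc i) < \<tau> i \<or> Suc i \<in> X)"
    have "i < n" if "i \<in> X" for i using shapes_zero[OF \<tau>, of i] X that by (cases "n \<le> i") auto
    moreover have "\<tau> (Suc i) - ind X (Suc i) \<le> \<tau> i - ind X i" for i
      using X dec[of i] by (cases "i \<in> X") (auto simp: ind_def)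
    moreover have "\<tau> 0 - ind X 0 \<le> k" using shapes_le[OF \<tau>, of 0] by simp
    ultimately show "X \<in> strips n k \<tau>" using X shapes_zero[OF \<tau>] by (auto simp: strips_def shapes_def)
  qed
  have sum_bad: "sum ?w ?B = 0"
  proof -
    have key: "tog X \<in> ?B \<and> tog (tog X) = X \<and> ?w (tog X) = - ?w X \<and>
      ((LEAST j. bad (tog X) j) \<in> tog X \<longleftrightarrow> (LEAST j. bad X j) \<notin> X)" if X: "X \<in> ?B" for X
    proof -
      define j where "j = (LEAST j. bad X j)"
      have bj: "bad X j" unfolding j_def using X by (auto intro: LeastI_ex)
      have jmin: "\<not> bad X i" if "i < j" for i using that not_less_Least unfolding j_def by blast
      have ej: "even j" using bj by (simp add: bad_def)
      have tX: "tog X = (if j \<in> X then X - {j} else insert j X)" by (simp add: tog_def j_def Let_def)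
      have XS: "\<forall>i\<in>X. 0 < \<tau> i" "\<forall>i\<in>X. \<tau> (Suc i) < \<tau> i \<or> Suc i \<in> X" using X strips by auto
      have pos: "0 < \<tau> j" using bj XS(1) dec[of j] by (auto simp: bad_def)
      (* By minimality of j the odd row before it is not in X, so toggling j does not spoil that row. *)
      have prev: "\<tau> (Suc i) < \<tau> i \<or> i \<notin> X" if "Suc i = j" for i
      proof -
        have oi: "odd i" using ej that by auto
        then obtain d where d: "i = Suc d" by (cases i) auto
        then have "\<not> bad X d" using jmin that by simp
        then have "i \<notin> X" using oi d by (simp add: bad_def)
        then show ?thesis ..
      qed
      have "tog X \<in> strips n k \<tau>"
        unfolding strips
      proof (intro conjI ballI)
        fix i assume i: "i \<in> tog X"
        show "0 < \<tau> i" using i XS(1) pos by (auto simp: tX split: if_splits)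
        show "\<tau> (Suc i) < \<tau> i \<or> Suc i \<in> tog X"
        proof (cases "i = j")
          case True
          then show ?thesis using bj by (auto simp: bad_def tX)
        next
          case False
          then have "i \<in> X" using i by (auto simp: tX split: if_splits)
          then show ?thesis using XS(2) prev[of i] by (auto simp: tX)
        qed
      qed
      moreover have bad_eq: "bad (tog X) i = bad X i" for i
        using ej by (auto simp: bad_def tX)
      moreover have "tog (tog X) = X"
      proof -
        have "(LEAST i. bad (tog X) i) = j" by (simp add: bad_eq j_def)
        then have "tog (tog X) = (if j \<in> tog X then tog X - {j} else insert j (tog X))"
          by (simp add: tog_def Let_def)
        then show ?thesis by (auto simp: tX)
      qed
      moreover have "(LEAST j. bad (tog X) j) \<in> tog X \<longleftrightarrow> (LEAST j. bad X j) \<notin> X"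
        by (simp add: bad_eq) (simp add: tX flip: j_def)
      moreover have "?w (tog X) = - ?w X"
      proof -
        have main: "?w (insert j Y) = - ?w Y" if jY: "j \<notin> Y" and Y: "insert j Y \<in> strips n k \<tau>" for Y
        proof -
          have fin: "finite Y" and jn: "j < n" using Y finite_subset[of Y "{..<n}"] by (auto simp: strips_def)
          have jj: "\<tau> (Suc j) - ind Y (Suc j) < \<tau> j"
          proof -
            have "\<tau> (Suc j) < \<tau> j \<or> Suc j \<in> Y" using Y unfolding strips by auto
            then show ?thesis using dec[of j] pos by (auto simp: ind_def)
          qed
          have "alt_size n (\<lambda>i. \<tau> i - ind Y i) = Suc (alt_size n (\<lambda>i. \<tau> i - ind (insert j Y) i))"
          proof -
            let ?f = "\<lambda>Y i. if even i then (\<tau> i - ind Y i) - (\<tau> (Suc i) - ind Y (Suc i)) else 0"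
            have "(\<Sum>i\<in>{..<n} - {j}. ?f Y i) = (\<Sum>i\<in>{..<n} - {j}. ?f (insert j Y) i)"
              by (rule sum.cong) (use ej in \<open>auto simp: ind_def\<close>)
            moreover have "?f Y j = Suc (?f (insert j Y) j)"
              using ej jj jY by (simp add: ind_def)
            ultimately show ?thesis
              unfolding alt_size_def using jn by (simp add: sum.remove[of "{..<n}" j])
          qed
          then show ?thesis using fin jY by simp
        qed
        show ?thesis
        proof (cases "j \<in> X")
          case True
          have "?w (insert j (X - {j})) = - ?w (X - {j})"
            using X True by (intro main) (auto simp: insert_absorb)
          then show ?thesis using True by (simp add: tX insert_absorb)
        next
          case False
          have "?w (insert j X) = - ?w X"
            using \<open>tog X \<in> strips n k \<tau>\<close> False by (intro main) (auto simp: tX)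
          then show ?thesis using False by (simp add: tX)
        qed
      qed
      ultimately show ?thesis using X by auto
    qed
    show ?thesis
    proof (rule sum_involution_zero[where h = tog and P = "\<lambda>X. (LEAST j. bad X j) \<in> X"])
      show "finite ?B" using finite_strips by simp
    qed (use key in auto)
  qed
  have "sum ?w (strips n k \<tau>) = sum ?w (?B \<union> {X \<in> strips n k \<tau>. \<not> (\<exists>j. bad X j)})"
    by (rule arg_cong[of _ _ "sum ?w"]) auto
  also have "\<dots> = sum ?w ?B + sum ?w {X \<in> strips n k \<tau>. \<not> (\<exists>j. bad X j)}"
    by (rule sum.union_disjoint) (auto simp: finite_strips)
  also have "{X \<in> strips n k \<tau>. \<not> (\<exists>j. bad X j)} = (if even_cols \<tau> then {{}} else {})"
  proof (cases "even_cols \<tau>")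
    case True
    have nb: "X = {}" if X: "X \<in> strips n k \<tau>" and nb: "\<not> (\<exists>j. bad X j)" for X
    proof (rule ccontr)
      assume "X \<noteq> {}"
      then obtain i where i: "i \<in> X" by auto
      show False
      proof (cases "even i")
        case True
        then have "\<not> bad X i" using nb by blast
        then show False using True i X strips by (auto simp: bad_def)
      next
        case False
        then obtain d where d: "i = Suc d" "even d" by (cases i) auto
        then show False using nb i by (auto simp: bad_def)
      qed
    qed
    have "\<not> bad {} j" for j
    proof
      assume "bad {} j"
      then have "even j" "\<tau> (Suc j) < \<tau> j" by (auto simp: bad_def)
      moreover obtain d where "j = 2 * d" using \<open>even j\<close> by (elim evenE)
      ultimately show False using True by (simp add: even_cols_def)
    qed
    moreover have "{} \<in> strips n k \<tau>" by (simp add: strips)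
    ultimately show ?thesis using nb True by auto
  next
    case False
    then obtain i where "\<tau> (2 * i) \<noteq> \<tau> (2 * i + 1)" by (auto simp: even_cols_def)
    then have "bad X (2 * i)" for X using dec[of "2 * i"] by (simp add: bad_def)
    then show ?thesis using False by auto
  qed
  finally show ?thesis
  proof -
    assume *: "sum ?w (strips n k \<tau>) = sum ?w ?B + sum ?w (if even_cols \<tau> then {{}} else {})"
    have "even_cols \<tau> \<Longrightarrow> alt_size n (\<lambda>i. \<tau> i - ind {} i) = 0"
    proof -
      assume ev: "even_cols \<tau>"
      have "\<tau> i = \<tau> (Suc i)" if ei: "even i" for i
      proof -
        obtain d where "i = 2 * d" using ei by (elim evenE)
        then show ?thesis using ev by (simp add: even_cols_def)
      qed
      then show ?thesis by (simp add: alt_size_def ind_def)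
    qed
    then show ?thesis using * sum_bad by auto
  qed
qed

section \<open>Truncated Littlewood identities\<close>

lemma prod_less_eq: "prod_less n x = (\<Prod>j<n. \<Prod>i<j. 1 - x i * x j)"
proof -
  have "{(i, j). i < j \<and> j < n} = (\<lambda>(j, i). (i, j)) ` (SIGMA j:{..<n}. {..<j})" by force
  moreover have "inj_on (\<lambda>(j, i). (i, j)) (SIGMA j:{..<n}. {..<j})" by (auto simp: inj_on_def)
  ultimately show ?thesis unfolding prod_less_def
    by (simp add: prod.reindex prod.Sigma split_def)
qed

lemma prod_le_eq: "prod_le n x = prod_less n x * (\<Prod>i<n. 1 - x i * x i)"
proof -
  have "{(i, j). i \<le> j \<and> j < n} = (\<lambda>(j, i). (i, j)) ` (SIGMA j:{..<n}. {..j})" by force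
  moreover have "inj_on (\<lambda>(j, i). (i, j)) (SIGMA j:{..<n}. {..j})" by (auto simp: inj_on_def)
  ultimately have "prod_le n x = (\<Prod>j<n. \<Prod>i\<le>j. 1 - x i * x j)"
    unfolding prod_le_def by (simp add: prod.reindex prod.Sigma split_def)
  also have "\<dots> = (\<Prod>j<n. (\<Prod>i<j. 1 - x i * x j) * (1 - x j * x j))"
    by (simp flip: lessThan_Suc_atMost)
  finally show ?thesis by (simp add: prod_less_eq prod.distrib)
qed

lemma prod_less_Suc: "prod_less (Suc n) x = prod_less n x * (\<Prod>i<n. 1 - x i * x n)"
  by (simp add: prod_less_eq)

lemma prod_less_swap:
  assumes \<tau>: "\<tau> permutes {..<n}" and inv: "\<And>i. \<tau> (\<tau> i) = i"
  shows "prod_less n (\<lambda>i. x (\<tau> i)) = prod_less n x"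
proof -
  define F where "F = (\<lambda>(i, j). if \<tau> i < \<tau> j then (\<tau> i, \<tau> j) else (\<tau> j, \<tau> i))"
  have lt: "\<tau> i < n" if "i < n" for i using permutes_in_image[OF \<tau>, of i] that by simp
  have ne: "\<tau> i \<noteq> \<tau> j" if "i \<noteq> j" for i j using inv that by metis
  have F: "F (i, j) \<in> {(i, j). i < j \<and> j < n} \<and> F (F (i, j)) = (i, j)" if "i < j" "j < n" for i j
    using lt[of i] lt[of j] ne[of i j] that inv by (auto simp: F_def)
  show ?thesis unfolding prod_less_def
  proof (rule prod.reindex_bij_witness[where i = F and j = F])
    fix a assume "a \<in> {(i, j). i < j \<and> j < n}"
    then obtain i j where a: "a = (i, j)" "i < j" "j < n" by auto
    show "F (F a) = a" "F a \<in> {(i, j). i < j \<and> j < n}" "F (F a) = a" "F a \<in> {(i, j). i < j \<and> j < n}"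
      using F[OF a(2,3)] a(1) by auto
    show "(case F a of (i, j) \<Rightarrow> 1 - x i * x j) = (case a of (i, j) \<Rightarrow> 1 - x (\<tau> i) * x (\<tau> j))"
      by (simp add: a(1) F_def mult.commute)
  qed
qed

lemma prod_le_swap:
  assumes \<tau>: "\<tau> permutes {..<n}" and inv: "\<And>i. \<tau> (\<tau> i) = i"
  shows "prod_le n (\<lambda>i. x (\<tau> i)) = prod_le n x"
  unfolding prod_le_eq prod_less_swap[OF assms] using prod_perm[OF \<tau>, of "\<lambda>i. 1 - x i * x i"] by simp

text \<open>
  The involution on vertical strips makes all terms cancel except the shapes with even columns. It
  applies to all removable strips, whereas those considered here must leave rows of length at most \<open>N\<close>; this is a
  restriction only if the first row has length \<open>N + 1\<close>, which explains the second sum.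
\<close>

lemma pieri_even_cols:
  fixes x :: "nat \<Rightarrow> 'a::comm_ring_1"
  shows "(\<Prod>i<n. 1 - x i * t) * (\<Sum>g\<in>shapes n N. (vandermonde n x * schur_fun n g x) * t ^ alt_size n g) =
    vandermonde n x * sum_even_cols n N x + (\<Sum>\<tau>\<in>{\<tau> \<in> shapes n (Suc N). \<tau> 0 = Suc N}. alternant n x (beta n \<tau>) *
      (\<Sum>X\<in>strips n N \<tau>. t ^ alt_size n (\<lambda>i. \<tau> i - ind X i) * (- t) ^ card X))"
proof -
  let ?C = "\<lambda>\<tau>. \<Sum>X\<in>strips n N \<tau>. t ^ alt_size n (\<lambda>i. \<tau> i - ind X i) * (- t) ^ card X"
  have p: "(\<Prod>i<n. 1 - x i * t) = (\<Prod>i<n. 1 + (- t) * x i)" by (simp add: mult.commute)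
  have q: "(\<Sum>g\<in>shapes n N. (vandermonde n x * schur_fun n g x) * t ^ alt_size n g) = (\<Sum>g\<in>shapes n N. t ^ alt_size n g * alternant n x (beta n g))"
  proof (rule sum.cong[OF refl])
    fix g assume "g \<in> shapes n N"
    from bialternant[OF this, of x] show "vandermonde n x * schur_fun n g x * t ^ alt_size n g = t ^ alt_size n g * alternant n x (beta n g)"
      by (simp add: mult.commute)
  qed
  have "(\<Prod>i<n. 1 - x i * t) * (\<Sum>g\<in>shapes n N. (vandermonde n x * schur_fun n g x) * t ^ alt_size n g) =
    (\<Prod>i<n. 1 + (- t) * x i) * (\<Sum>g\<in>shapes n N. t ^ alt_size n g * alternant n x (beta n g))"
    unfolding p q ..
  also have "\<dots> = (\<Sum>\<tau>\<in>shapes n (Suc N). alternant n x (beta n \<tau>) * ?C \<tau>)"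
    by (rule pieri)
  also have "shapes n (Suc N) = shapes n N \<union> {\<tau> \<in> shapes n (Suc N). \<tau> 0 = Suc N}"
    by (auto simp: shapes_def)
  also have "(\<Sum>\<tau>\<in>shapes n N \<union> {\<tau> \<in> shapes n (Suc N). \<tau> 0 = Suc N}. alternant n x (beta n \<tau>) * ?C \<tau>) =
    (\<Sum>\<tau>\<in>shapes n N. alternant n x (beta n \<tau>) * ?C \<tau>) + (\<Sum>\<tau>\<in>{\<tau> \<in> shapes n (Suc N). \<tau> 0 = Suc N}. alternant n x (beta n \<tau>) * ?C \<tau>)"
    by (rule sum.union_disjoint) (auto dest: shapes_le[of _ n N 0])
  also have "(\<Sum>\<tau>\<in>shapes n N. alternant n x (beta n \<tau>) * ?C \<tau>) = (\<Sum>\<tau>\<in>shapes n N. if even_cols \<tau> then vandermonde n x * schur_fun n \<tau> x else 0)"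
  proof (rule sum.cong[OF refl])
    fix \<tau> assume \<tau>: "\<tau> \<in> shapes n N"
    show "alternant n x (beta n \<tau>) * ?C \<tau> = (if even_cols \<tau> then vandermonde n x * schur_fun n \<tau> x else 0)"
      unfolding strips_alt_size[OF \<tau>] bialternant[OF \<tau>] by simp
  qed
  also have "\<dots> = vandermonde n x * sum_even_cols n N x"
    unfolding sum_even_cols_def sum_distrib_left by (simp add: sum.inter_filter)
  finally show ?thesis .
qed

interpretation pos: ring_rel "\<lambda>f (g::laurent). pos f" by (rule pos_rel)

lemma pos_prod_less: "pos (prod_less n var)"
  unfolding prod_less_eq by (intro pos.R_prod pos.R_diff pos.R_one pos.R_mult pos_var)

lemma pos_strip_sum: "pos t \<Longrightarrow> pos (\<Sum>X\<in>A. t ^ a X * (- t) ^ b X)"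
  by (intro pos.R_sum pos.R_mult pos.R_power pos.R_uminus)

text \<open>
  The leading exponent of each alternant is \<open>N + n > N\<close>.
\<close>

lemma overflow_big:
  assumes "pos t"
  shows "big n (int N) (\<Sum>\<tau>\<in>{\<tau> \<in> shapes n (Suc N). \<tau> 0 = Suc N}. alternant n var (beta n \<tau>) *
      (\<Sum>X\<in>strips n N \<tau>. t ^ alt_size n (\<lambda>i. \<tau> i - ind X i) * (- t) ^ card X))"
proof (rule big_sum)
  fix \<tau> assume "\<tau> \<in> {\<tau> \<in> shapes n (Suc N). \<tau> 0 = Suc N}"
  then have \<tau>: "\<tau> \<in> shapes n (Suc N)" "\<tau> 0 = Suc N" by auto
  then have "0 < n" using shapes_zero[OF \<tau>(1), of 0] by (cases n) auto
  then have "big n (int N) (alternant n var (beta n \<tau>))"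
    by (rule big_alternant) (simp add: beta_def \<tau>(2))
  then show "big n (int N) (alternant n var (beta n \<tau>) *
      (\<Sum>X\<in>strips n N \<tau>. t ^ alt_size n (\<lambda>i. \<tau> i - ind X i) * (- t) ^ card X))"
    by (rule big_mult) (rule pos_strip_sum[OF assms])
qed

lemma shapes_0: "shapes 0 k = {\<lambda>_. 0}" by (auto simp: shapes_def)

text \<open>
  A truncation of Littlewood's identity \<open>\<Sum> s\<^sub>\<nu> = 1 / \<Prod>i<j. (1 - x i * x j)\<close> over all \<open>\<nu>\<close> with even
  columns, by induction on \<open>n\<close>. The branching rule expands the sum for \<open>n + 1\<close> variables in the terms
  \<open>s\<^sub>g(x) * x n ^ alt_size n g\<close>, and \<open>pieri_even_cols\<close> turns the product with the new factors
  \<open>1 - x i * x n\<close> into the sum for \<open>n\<close> variables.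
\<close>

lemma littlewood_cols: "big n (int N) (vandermonde n var * (prod_less n var * sum_even_cols n N var - 1))"
proof (induction n)
  case 0
  have "{f \<in> shapes 0 N. even_cols f} = {\<lambda>_. 0}" by (auto simp: shapes_0 even_cols_def)
  then have "sum_even_cols 0 N var = 1" by (simp add: sum_even_cols_def schur_fun_empty)
  then show ?case by (simp add: prod_less_eq big_zero)
next
  case (Suc n)
  define E where "E = (\<Sum>\<tau>\<in>{\<tau> \<in> shapes n (Suc N). \<tau> 0 = Suc N}. alternant n var (beta n \<tau>) *
      (\<Sum>X\<in>strips n N \<tau>. var n ^ alt_size n (\<lambda>i. \<tau> i - ind X i) * (- var n) ^ card X))"
  have E: "big n (int N) E" unfolding E_def by (rule overflow_big[OF pos_var])
  define w where "w = (\<Prod>i<n. var i - var n)"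
  have w: "pos w" unfolding w_def
    by (intro pos.R_prod pos.R_diff pos_var)
  have "vandermonde n var * (\<Prod>i<n. 1 - var i * var n) * sum_even_cols (Suc n) N var = vandermonde n var * sum_even_cols n N var + E"
  proof -
    have "vandermonde n var * (\<Prod>i<n. 1 - var i * var n) * sum_even_cols (Suc n) N var =
      (\<Prod>i<n. 1 - var i * var n) * (\<Sum>g\<in>shapes n N. (vandermonde n var * schur_fun n g var) * var n ^ alt_size n g)"
      unfolding sum_even_cols_Suc by (simp add: sum_distrib_left mult_ac)
    then show ?thesis unfolding pieri_even_cols E_def .
  qed
  then have "vandermonde (Suc n) var * (prod_less (Suc n) var * sum_even_cols (Suc n) N var - 1) =
    w * (prod_less n var * (vandermonde n var * sum_even_cols n N var + E) - vandermonde n var)"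
    unfolding vandermonde_Suc prod_less_Suc w_def[symmetric] by (simp add: algebra_simps)
  also have "\<dots> = w * (vandermonde n var * (prod_less n var * sum_even_cols n N var - 1) + prod_less n var * E)"
    by (simp add: algebra_simps)
  finally have eq: "vandermonde (Suc n) var * (prod_less (Suc n) var * sum_even_cols (Suc n) N var - 1) =
    w * (vandermonde n var * (prod_less n var * sum_even_cols n N var - 1) + prod_less n var * E)" .
  have "big n (int N) (w * (vandermonde n var * (prod_less n var * sum_even_cols n N var - 1) + prod_less n var * E))"
    by (intro big_mult_left big_add Suc E w pos_prod_less)
  then show ?case unfolding eq by (rule big_mono) auto
qed

text \<open>
  Every shape arises in exactly one way by adding a vertical strip to a shape with even rows.
\<close>

lemma sum_even_rows_pieri:
  fixes x :: "nat \<Rightarrow> 'a::comm_ring_1"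
  assumes N: "even N"
  shows "(\<Prod>i<n. 1 + x i) * (vandermonde n x * sum_even_rows n N x) = vandermonde n x * sum_all n (Suc N) x"
proof -
  have "vandermonde n x * sum_even_rows n N x = (\<Sum>g\<in>shapes n N. (if even_rows g then 1 else 0) * alternant n x (beta n g))"
  proof -
    have "vandermonde n x * sum_even_rows n N x = (\<Sum>g\<in>shapes n N. if even_rows g then vandermonde n x * schur_fun n g x else 0)"
      unfolding sum_even_rows_def sum_distrib_left by (simp add: sum.inter_filter)
    also have "\<dots> = (\<Sum>g\<in>shapes n N. (if even_rows g then 1 else 0) * alternant n x (beta n g))"
    proof (rule sum.cong[OF refl])
      fix g assume "g \<in> shapes n N"
      from bialternant[OF this, of x]
      show "(if even_rows g then vandermonde n x * schur_fun n g x else 0) = (if even_rows g then 1 else 0) * alternant n x (beta n g)" by simp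
    qed
    finally show ?thesis .
  qed
  then have "(\<Prod>i<n. 1 + x i) * (vandermonde n x * sum_even_rows n N x) =
    (\<Prod>i<n. 1 + 1 * x i) * (\<Sum>g\<in>shapes n N. (if even_rows g then 1 else 0) * alternant n x (beta n g))" by simp
  also have "\<dots> = (\<Sum>\<tau>\<in>shapes n (Suc N). alternant n x (beta n \<tau>) *
     (\<Sum>X\<in>strips n N \<tau>. (if even_rows (\<lambda>i. \<tau> i - ind X i) then 1 else 0) * 1 ^ card X))"
    by (rule pieri)
  also have "\<dots> = (\<Sum>\<tau>\<in>shapes n (Suc N). vandermonde n x * schur_fun n \<tau> x)"
  proof (rule sum.cong[OF refl])
    fix \<tau> assume \<tau>: "\<tau> \<in> shapes n (Suc N)"
    show "alternant n x (beta n \<tau>) * (\<Sum>X\<in>strips n N \<tau>. (if even_rows (\<lambda>i. \<tau> i - ind X i) then 1 else 0) * 1 ^ card X) =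
      vandermonde n x * schur_fun n \<tau> x"
      unfolding strips_even_rows[OF \<tau> N] bialternant[OF \<tau>] by simp
  qed
  finally show ?thesis by (simp add: sum_all_def sum_distrib_left)
qed

text \<open>
  The factors \<open>1 - x i * x i\<close> split as \<open>(1 - x i) * (1 + x i)\<close>. The second factor turns shapes with even
  rows into all shapes, and the first factor turns these into shapes with even columns, by
  \<open>pieri_even_cols\<close> with \<open>t = 1\<close>.
\<close>

lemma littlewood_rows:
  assumes N: "even N"
  shows "big n (int N) (vandermonde n var * (prod_le n var * sum_even_rows n N var - 1))"
proof -
  define E where "E = (\<Sum>\<tau>\<in>{\<tau> \<in> shapes n (Suc (Suc N)). \<tau> 0 = Suc (Suc N)}. alternant n var (beta n \<tau>) *
      (\<Sum>X\<in>strips n (Suc N) \<tau>. 1 ^ alt_size n (\<lambda>i. \<tau> i - ind X i) * (- 1) ^ card X))"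
  have E: "big n (int (Suc N)) E" unfolding E_def by (rule overflow_big[OF pos.R_one])
  have "vandermonde n var * (prod_le n var * sum_even_rows n N var) =
    prod_less n var * ((\<Prod>i<n. 1 - var i * 1) * ((\<Prod>i<n. 1 + var i) * (vandermonde n var * sum_even_rows n N var)))"
  proof -
    have "(\<Prod>i<n. 1 - var i * var i) = (\<Prod>i<n. 1 - var i * 1) * (\<Prod>i<n. 1 + var i)"
      unfolding prod.distrib[symmetric] by (rule prod.cong) (simp_all add: algebra_simps)
    then show ?thesis unfolding prod_le_eq by (simp only: mult_ac)
  qed
  also have "(\<Prod>i<n. 1 + var i) * (vandermonde n var * sum_even_rows n N var) = (\<Sum>g\<in>shapes n (Suc N). (vandermonde n var * schur_fun n g var) * 1 ^ alt_size n g)"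
    unfolding sum_even_rows_pieri[OF N] by (simp add: sum_all_def sum_distrib_left)
  also have "(\<Prod>i<n. 1 - var i * 1) * \<dots> = vandermonde n var * sum_even_cols n (Suc N) var + E"
    unfolding E_def by (rule pieri_even_cols)
  finally have "vandermonde n var * (prod_le n var * sum_even_rows n N var - 1) =
    vandermonde n var * (prod_less n var * sum_even_cols n (Suc N) var - 1) + prod_less n var * E"
    by (simp add: algebra_simps)
  moreover have "big n (int N) (vandermonde n var * (prod_less n var * sum_even_cols n (Suc N) var - 1))"
    by (rule big_mono[OF littlewood_cols[of n "Suc N"]]) auto
  moreover have "big n (int N) (prod_less n var * E)"
    by (rule big_mult_left[OF big_mono[OF E] pos_prod_less]) auto
  ultimately show ?thesis by (simp add: big_add)
qed

text \<open>
  A shape with first row longer than \<open>k\<close> contributes an alternant with leading exponent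
  \<open>f 0 + n - 1\<close>.
\<close>

lemma truncation_big:
  assumes kN: "k \<le> N" and n: "1 \<le> n"
    and T: "\<And>f. f \<in> shapes n N \<Longrightarrow> P f \<Longrightarrow> k < f 0 \<Longrightarrow> T < int (f 0) + int n - 1"
  shows "big n T (vandermonde n var * ((\<Sum>f\<in>{f \<in> shapes n N. P f}. schur_fun n f var) - (\<Sum>f\<in>{f \<in> shapes n k. P f}. schur_fun n f var)))"
proof -
  have split: "{f \<in> shapes n N. P f} = {f \<in> shapes n k. P f} \<union> {f \<in> shapes n N. P f \<and> k < f 0}"
    using kN by (auto simp: shapes_def)
  have "(\<Sum>f\<in>{f \<in> shapes n N. P f}. schur_fun n f var) =
    (\<Sum>f\<in>{f \<in> shapes n k. P f}. schur_fun n f var) + (\<Sum>f\<in>{f \<in> shapes n N. P f \<and> k < f 0}. schur_fun n f var)"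
    unfolding split by (rule sum.union_disjoint) (auto dest: shapes_le[of _ n k 0])
  then have "vandermonde n var * ((\<Sum>f\<in>{f \<in> shapes n N. P f}. schur_fun n f var) - (\<Sum>f\<in>{f \<in> shapes n k. P f}. schur_fun n f var)) =
    (\<Sum>f\<in>{f \<in> shapes n N. P f \<and> k < f 0}. alternant n var (beta n f))"
    by (simp add: sum_distrib_left) (intro sum.cong refl, simp add: bialternant[of _ n N])
  also have "big n T \<dots>"
  proof (rule big_sum)
    fix f assume f: "f \<in> {f \<in> shapes n N. P f \<and> k < f 0}"
    then have "T < int (f 0) + int n - 1" using T by blast
    also have "\<dots> = int (beta n f 0)" using n by (simp add: beta_def)
    finally show "big n T (alternant n var (beta n f))" using n by (intro big_alternant[of 0]) auto
  qed
  finally show ?thesis .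
qed

text \<open>
  The bound on the exponents is half of \<open>K = k + 2 * n - 2\<close>, which will be the degree of the
  reflection \<open>e \<mapsto> K - e\<close> of exponents.
\<close>

lemma even_cols_big:
  assumes n: "1 \<le> n"
  shows "big n (int (k + 2 * n - 2) div 2) (vandermonde n var * (prod_less n var * sum_even_cols n k var - 1))"
proof -
  (* Any bound that is at least k and at least K / 2 works here. *)
  define N where "N = k + n"
  have a: "big n (int (k + 2 * n - 2) div 2) (vandermonde n var * (prod_less n var * sum_even_cols n N var - 1))"
    by (rule big_mono[OF littlewood_cols]) (use n in \<open>auto simp: N_def\<close>)
  have b: "big n (int (k + 2 * n - 2) div 2) (vandermonde n var * (sum_even_cols n N var - sum_even_cols n k var))"
    unfolding sum_even_cols_def by (rule truncation_big[OF _ n]) (use n in \<open>auto simp: N_def\<close>)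
  have "vandermonde n var * (prod_less n var * sum_even_cols n k var - 1) =
    vandermonde n var * (prod_less n var * sum_even_cols n N var - 1) - prod_less n var * (vandermonde n var * (sum_even_cols n N var - sum_even_cols n k var))"
    by (simp add: algebra_simps)
  then show ?thesis using big_diff[OF a big_mult_left[OF b pos_prod_less]] by simp
qed

text \<open>
  All these shapes have first row \<open>k\<close>, hence leading exponent \<open>k + n - 1\<close>, which exceeds
  \<open>k / 2 + n - 1\<close>.
\<close>

lemma odd_cols_big:
  assumes n: "1 \<le> n" and k: "1 \<le> k"
  shows "big n (int (k + 2 * n - 2) div 2) (vandermonde n var * (prod_less n var * sum_odd_cols n k var))"
proof -
  have "vandermonde n var * sum_odd_cols n k var = (\<Sum>f\<in>{f \<in> shapes n k. odd_cols k f}. alternant n var (beta n f))"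
    unfolding sum_odd_cols_def sum_distrib_left
    by (rule sum.cong[OF refl]) (use bialternant[of _ n k var] in auto)
  also have "big n (int (k + 2 * n - 2) div 2) \<dots>"
  proof (rule big_sum)
    fix f assume "f \<in> {f \<in> shapes n k. odd_cols k f}"
    then have "int (k + 2 * n - 2) div 2 < int (beta n f 0)"
      using n k by (auto simp: beta_def odd_cols_def)
    then show "big n (int (k + 2 * n - 2) div 2) (alternant n var (beta n f))" using n by (intro big_alternant[of 0]) auto
  qed
  finally have "big n (int (k + 2 * n - 2) div 2) (prod_less n var * (vandermonde n var * sum_odd_cols n k var))"
    by (rule big_mult_left[OF _ pos_prod_less])
  then show ?thesis by (simp add: mult_ac)
qed

lemma even_rows_big:
  assumes n: "1 \<le> n"
  shows "big n (int (2 * k + 2 * n) div 2) (vandermonde n var * (prod_le n var * sum_even_rows n (2 * k) var - 1))"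
proof -
  define N where "N = 2 * (k + n)"
  have a: "big n (int (2 * k + 2 * n) div 2) (vandermonde n var * (prod_le n var * sum_even_rows n N var - 1))"
    by (rule big_mono[OF littlewood_rows]) (use n in \<open>auto simp: N_def\<close>)
  have b: "big n (int (2 * k + 2 * n) div 2) (vandermonde n var * (sum_even_rows n N var - sum_even_rows n (2 * k) var))"
    unfolding sum_even_rows_def
  proof (rule truncation_big[OF _ n])
    show "2 * k \<le> N" by (simp add: N_def)
    fix f :: "nat \<Rightarrow> nat" assume "even_rows f" "2 * k < f 0"
    moreover obtain d where "f 0 = 2 * d" using \<open>even_rows f\<close> by (auto simp: even_rows_def elim: evenE)
    ultimately have "2 * k + 2 \<le> f 0" by simp
    then show "int (2 * k + 2 * n) div 2 < int (f 0) + int n - 1" by simp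
  qed
  have pp: "pos (prod_le n var)"
    unfolding prod_le_eq
    by (intro pos.R_mult pos_prod_less pos.R_prod pos.R_diff pos.R_one pos_var)
  have "vandermonde n var * (prod_le n var * sum_even_rows n (2 * k) var - 1) =
    vandermonde n var * (prod_le n var * sum_even_rows n N var - 1) - prod_le n var * (vandermonde n var * (sum_even_rows n N var - sum_even_rows n (2 * k) var))"
    by (simp add: algebra_simps)
  then show ?thesis using big_diff[OF a big_mult_left[OF b pp]] by simp
qed

section \<open>Reflection of exponents\<close>

text \<open>
  Up to a monomial factor that centres the exponents at zero, these are determinants of
  \<open>x i powi a \<plusminus> x i powi (- a)\<close>, as in Weyl's character formula for the symplectic and the even
  orthogonal groups.
\<close>

definition numer :: "nat \<Rightarrow> nat \<Rightarrow> 'a::comm_ring_1 \<Rightarrow> (nat \<Rightarrow> 'a) \<Rightarrow> 'a" where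
  "numer n K \<epsilon> x = Det n (\<lambda>i j. x i ^ (n - 1 - j) + \<epsilon> * x i ^ (K - (n - 1 - j)))"

text \<open>
  The exponents in the expansion of \<open>numer\<close>: those at the positions in \<open>X\<close> are reflected.
\<close>

definition refl_exp :: "nat \<Rightarrow> nat \<Rightarrow> nat set \<Rightarrow> nat \<Rightarrow> nat" where
  "refl_exp n K X j = (if j \<in> X then K - (n - 1 - j) else n - 1 - j)"

lemma numer_expand:
  fixes x :: "nat \<Rightarrow> 'a::comm_ring_1"
  shows "numer n K \<epsilon> x = (\<Sum>X\<in>Pow {..<n}. \<epsilon> ^ card X * alternant n x (refl_exp n K X))"
  unfolding numer_def Det_add_cols
proof (rule sum.cong[OF refl])
  fix X assume "X \<in> Pow {..<n}"
  then have X: "X \<subseteq> {..<n}" by simp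
  have "Det n (\<lambda>i j. if j \<in> X then \<epsilon> * x i ^ (K - (n - 1 - j)) else x i ^ (n - 1 - j)) =
    Det n (\<lambda>i j. (if j \<in> X then \<epsilon> else 1) * x i ^ refl_exp n K X j)"
    by (rule Det_cong) (simp add: refl_exp_def)
  also have "\<dots> = (\<Prod>j<n. if j \<in> X then \<epsilon> else 1) * alternant n x (refl_exp n K X)"
    unfolding Det_scale_cols[of n "\<lambda>j. if j \<in> X then \<epsilon> else 1"] alternant_def ..
  also have "(\<Prod>j<n. if j \<in> X then \<epsilon> else 1) = \<epsilon> ^ card X"
    using X by (simp add: prod.If_cases Int_absorb1)
  finally show "Det n (\<lambda>i j. if j \<in> X then \<epsilon> * x i ^ (K - (n - 1 - j)) else x i ^ (n - 1 - j)) =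
    \<epsilon> ^ card X * alternant n x (refl_exp n K X)" .
qed

lemma numer_swap:
  "\<tau> permutes {..<n} \<Longrightarrow> numer n K \<epsilon> (\<lambda>i. x (\<tau> i)) = of_int (sign \<tau>) * numer n K \<epsilon> x"
  unfolding numer_def
  by (rule Det_perm_rows[where M = "\<lambda>i j. x i ^ (n - 1 - j) + \<epsilon> * x i ^ (K - (n - 1 - j))"])

lemma numer_flip:
  fixes x :: "nat \<Rightarrow> 'a::comm_ring_1"
  assumes t: "x n * ti = 1" and K: "n \<le> K" and \<epsilon>: "\<epsilon> * \<epsilon> = 1"
  shows "x n ^ K * numer (Suc n) K \<epsilon> (x(n := ti)) = \<epsilon> * numer (Suc n) K \<epsilon> x"
proof -
  let ?x = "x(n := ti)"
  let ?M = "\<lambda>x i j. x i ^ (Suc n - 1 - j) + \<epsilon> * x i ^ (K - (Suc n - 1 - j))"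
  have "x n ^ K * numer (Suc n) K \<epsilon> ?x = (\<Prod>i<Suc n. if i = n then x n ^ K else 1) * Det (Suc n) (?M ?x)"
    by (simp add: numer_def)
  also have "\<dots> = Det (Suc n) (\<lambda>i j. (if i = n then x n ^ K else 1) * ?M ?x i j)"
    by (rule Det_scale_rows[symmetric])
  also have "\<dots> = Det (Suc n) (\<lambda>i j. (if i = n then \<epsilon> else 1) * ?M x i j)"
  proof (rule Det_cong)
    fix i j assume "i < Suc n" "j < Suc n"
    define a where "a = Suc n - 1 - j"
    have a: "a \<le> K" using K by (simp add: a_def)
    have p: "x n ^ K * ti ^ a = x n ^ (K - a)" "x n ^ K * ti ^ (K - a) = x n ^ a"
      using power_inverse_cancel[OF t a] power_inverse_cancel[OF t, of "K - a" K] a by auto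
    have "x n ^ K * (ti ^ a + \<epsilon> * ti ^ (K - a)) = x n ^ K * ti ^ a + \<epsilon> * (x n ^ K * ti ^ (K - a))"
      by (simp add: algebra_simps)
    also have "\<dots> = \<epsilon> * \<epsilon> * x n ^ (K - a) + \<epsilon> * x n ^ a" unfolding p \<epsilon> by simp
    also have "\<dots> = \<epsilon> * (x n ^ a + \<epsilon> * x n ^ (K - a))" by (simp add: algebra_simps)
    finally show "(if i = n then x n ^ K else 1) * ?M ?x i j = (if i = n then \<epsilon> else 1) * ?M x i j"
      unfolding a_def by simp
  qed
  also have "\<dots> = (\<Prod>i<Suc n. if i = n then \<epsilon> else 1) * Det (Suc n) (?M x)"
    by (rule Det_scale_rows)
  also have "\<dots> = \<epsilon> * numer (Suc n) K \<epsilon> x" by (simp add: numer_def)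
  finally show ?thesis .
qed

lemma denom_flip:
  fixes x :: "nat \<Rightarrow> 'a::comm_ring_1"
  assumes t: "x n * ti = 1"
  shows "x n ^ (2 * n) * (vandermonde (Suc n) (x(n := ti)) * prod_less (Suc n) (x(n := ti))) =
    vandermonde (Suc n) x * prod_less (Suc n) x"
proof -
  have v: "vandermonde n (x(n := ti)) = vandermonde n x" unfolding vandermonde_def by (intro prod.cong refl) auto
  have p: "prod_less n (x(n := ti)) = prod_less n x" unfolding prod_less_eq by (intro prod.cong refl) auto
  have "x n ^ (2 * n) * ((\<Prod>i<n. x i - ti) * (\<Prod>i<n. 1 - x i * ti)) =
    (\<Prod>i<n. (x n * (x i - ti)) * (x n * (1 - x i * ti)))"
    by (simp add: prod.distrib power_mult power2_eq_square power_mult_distrib mult_ac)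
  also have "\<dots> = (\<Prod>i<n. (x i - x n) * (1 - x i * x n))"
  proof (rule prod.cong[OF refl])
    fix i
    have "(x n * (x i - ti)) * (x n * (1 - x i * ti)) = (x n * x i - x n * ti) * (x n - x i * (x n * ti))"
      by (simp add: algebra_simps)
    also have "\<dots> = (x i - x n) * (1 - x i * x n)" unfolding t by (simp add: algebra_simps)
    finally show "(x n * (x i - ti)) * (x n * (1 - x i * ti)) = (x i - x n) * (1 - x i * x n)" .
  qed
  also have "\<dots> = (\<Prod>i<n. x i - x n) * (\<Prod>i<n. 1 - x i * x n)" by (rule prod.distrib)
  finally have main: "x n ^ (2 * n) * ((\<Prod>i<n. x i - ti) * (\<Prod>i<n. 1 - x i * ti)) =
    (\<Prod>i<n. x i - x n) * (\<Prod>i<n. 1 - x i * x n)" .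
  have "x n ^ (2 * n) * (vandermonde (Suc n) (x(n := ti)) * prod_less (Suc n) (x(n := ti))) =
    vandermonde n x * prod_less n x * (x n ^ (2 * n) * ((\<Prod>i<n. x i - ti) * (\<Prod>i<n. 1 - x i * ti)))"
    unfolding vandermonde_Suc prod_less_Suc v p by (simp add: mult_ac)
  then show ?thesis unfolding main vandermonde_Suc prod_less_Suc by (simp only: mult_ac)
qed

lemma lookup_single_mult_shift:
  fixes f :: laurent
  shows "Poly_Mapping.lookup (Poly_Mapping.single u 1 * f) (m + u) = Poly_Mapping.lookup f m"
proof -
  have "Poly_Mapping.single u 1 * f = Poly_Mapping.single u 1 *
    (\<Sum>k\<in>Poly_Mapping.keys f. Poly_Mapping.single k (Poly_Mapping.lookup f k))"
    by (simp flip: laurent_expand)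
  also have "\<dots> = (\<Sum>k\<in>Poly_Mapping.keys f. Poly_Mapping.single (u + k) (Poly_Mapping.lookup f k))"
    by (simp add: sum_distrib_left mult_single)
  finally have "Poly_Mapping.lookup (Poly_Mapping.single u 1 * f) (m + u) =
    (\<Sum>k\<in>Poly_Mapping.keys f. if k = m then Poly_Mapping.lookup f m else 0)"
    by (simp add: lookup_sum lookup_single when_def add.commute[of m] cong: if_cong)
  then show ?thesis by (simp add: in_keys_iff)
qed

lemma lookup_of_int_mult:
  fixes f :: laurent
  shows "Poly_Mapping.lookup (of_int s * f) m = s * Poly_Mapping.lookup f m"
proof -
  have nat: "Poly_Mapping.lookup (of_nat a * f) m = int a * Poly_Mapping.lookup f m" for a
    by (induction a) (simp_all add: lookup_add algebra_simps)
  show ?thesis by (cases s rule: int_cases2) (simp_all add: nat)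
qed

text \<open>
  An antisymmetric Laurent polynomial that is also, up to a factor \<open>s\<close>, invariant under the
  reflection \<open>e \<mapsto> K - e\<close> of the exponents of the last variable, and all of whose monomials contain an exponent above
  \<open>K / 2\<close>, is zero. Among its monomials take one with the least number of exponents above \<open>K / 2\<close>.
  By antisymmetry one of them may be moved to the last variable, and its reflection is below \<open>K / 2\<close>,
  which contradicts minimality.

  The polynomial is given as a function \<open>P\<close> of the variables that respects all ring relations, so that
  \<open>P\<close> at permuted or inverted variables is obtained from \<open>P var\<close> by a substitution of exponents.
\<close>

theorem laurent_flip_zero:
  fixes P :: "(nat \<Rightarrow> laurent) \<Rightarrow> laurent"
  assumes nat: "\<And>R x y. ring_rel R \<Longrightarrow> (\<And>i. i < n \<Longrightarrow> R (x i) (y i)) \<Longrightarrow> R (P x) (P y)"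
    and n: "1 \<le> n"
    and swap: "\<And>i j. i < n \<Longrightarrow> j < n \<Longrightarrow> i \<noteq> j \<Longrightarrow> P (\<lambda>l. var (transpose i j l)) = - P var"
    and flip: "var (n - 1) ^ K * P (var(n - 1 := var_inv (n - 1))) = of_int s * P var" and s: "s \<noteq> 0"
    and big: "big n (int K div 2) (P var)"
  shows "P var = 0"
proof (rule ccontr)
  assume "P var \<noteq> 0"
  let ?T = "int K div 2"
  let ?l = "Poly_Mapping.lookup" and ?keys = "Poly_Mapping.keys (P var)"
  define c where "c = n - 1"
  have c: "c < n" using n by (simp add: c_def)
  define cnt where "cnt m = card {i. i < n \<and> ?T < ?l m i}" for m
  obtain m0 where "m0 \<in> ?keys" using \<open>P var \<noteq> 0\<close> by (metis keys_eq_empty ex_in_conv)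
  then obtain m where m: "m \<in> ?keys" and min: "\<And>m'. m' \<in> ?keys \<Longrightarrow> cnt m \<le> cnt m'"
    using ex_has_least_nat[of "\<lambda>m. m \<in> ?keys" m0 cnt] by blast
  obtain i where i: "i < n" "?T < ?l m i" using big m by (auto simp: big_def)
  (* Antisymmetry moves a large exponent to the position c of the last variable. *)
  obtain m1 where m1: "m1 \<in> ?keys" "cnt m1 = cnt m" "?T < ?l m1 c"
  proof (cases "i = c")
    case True
    then show thesis using that m i by blast
  next
    case False
    let ?\<tau> = "transpose i c"
    have inj: "inj ?\<tau>" by simp
    have \<tau>\<tau>: "?\<tau> (?\<tau> l) = l" for l by simp
    have R: "ring_rel (subst_rel (Poly_Mapping.map_key ?\<tau>))"
      by (rule subst_rel) (rule map_key_plus[OF inj])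
    have RV: "subst_rel (Poly_Mapping.map_key ?\<tau>) (var l) (var (?\<tau> l))" for l
      unfolding var_def[of "?\<tau> l"]
      by (rule subst_rel_var) (use map_key_single[OF inj, of "?\<tau> l" "1::int"] in simp)
    have rel: "subst_rel (Poly_Mapping.map_key ?\<tau>) (P var) (- P var)"
      unfolding swap[OF i(1) c False, symmetric] by (rule nat[OF R RV])
    have look: "?l (Poly_Mapping.map_key ?\<tau> m') l = ?l m' (?\<tau> l)" for m' l
      by (simp add: map_key.rep_eq inj)
    have "inj (Poly_Mapping.map_key ?\<tau> :: (nat \<Rightarrow>\<^sub>0 int) \<Rightarrow> _)"
    proof (rule injI)
      fix u v :: "nat \<Rightarrow>\<^sub>0 int" assume eq: "Poly_Mapping.map_key ?\<tau> u = Poly_Mapping.map_key ?\<tau> v"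
      show "u = v"
      proof (rule poly_mapping_eqI)
        fix l show "?l u l = ?l v l" using look[of u "?\<tau> l"] look[of v "?\<tau> l"] eq by simp
      qed
    qed
    from subst_rel_lookup[OF rel this, of m]
    have "Poly_Mapping.map_key ?\<tau> m \<in> ?keys" using m by (simp add: in_keys_iff)
    moreover have "cnt (Poly_Mapping.map_key ?\<tau> m) = cnt m"
    proof -
      have lt: "?\<tau> l < n" if "l < n" for l using i(1) c that by (auto simp: transpose_def)
      have "{l. l < n \<and> ?T < ?l m (?\<tau> l)} = ?\<tau> ` {l. l < n \<and> ?T < ?l m l}"
      proof (intro Set.set_eqI iffI)
        fix l assume "l \<in> {l. l < n \<and> ?T < ?l m (?\<tau> l)}"
        then have "?\<tau> l \<in> {l. l < n \<and> ?T < ?l m l}" using lt by simp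
        then show "l \<in> ?\<tau> ` {l. l < n \<and> ?T < ?l m l}" using \<tau>\<tau>[of l] by (metis imageI)
      next
        fix l assume "l \<in> ?\<tau> ` {l. l < n \<and> ?T < ?l m l}"
        then show "l \<in> {l. l < n \<and> ?T < ?l m (?\<tau> l)}" using lt by auto
      qed
      then show ?thesis unfolding cnt_def look by (simp add: card_image inj_on_subset[OF inj])
    qed
    moreover have "?T < ?l (Poly_Mapping.map_key ?\<tau> m) c" using i(2) by (simp add: look)
    ultimately show thesis by (rule that)
  qed
  (* The substitution of the inverse for the last variable, on exponents. *)
  define \<phi> :: "(nat \<Rightarrow>\<^sub>0 int) \<Rightarrow> (nat \<Rightarrow>\<^sub>0 int)" where "\<phi> m = m - Poly_Mapping.single c (2 * ?l m c)" for m
  have look: "?l (\<phi> m) l = (if l = c then - ?l m c else ?l m l)" for m l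
    by (simp add: \<phi>_def lookup_minus lookup_single when_def)
  have \<phi>\<phi>: "\<phi> (\<phi> m) = m" for m by (rule poly_mapping_eqI) (simp add: look)
  have inj: "inj \<phi>" using \<phi>\<phi> by (metis injI)
  have R: "ring_rel (subst_rel \<phi>)"
  proof (rule subst_rel)
    fix u v show "\<phi> (u + v) = \<phi> u + \<phi> v" by (rule poly_mapping_eqI) (simp add: look lookup_add)
  qed
  have RV: "subst_rel \<phi> (var l) ((var(c := var_inv c)) l)" for l
  proof (cases "l = c")
    case True
    have "\<phi> (Poly_Mapping.single c 1) = Poly_Mapping.single c (- 1)"
      by (rule poly_mapping_eqI) (simp add: look lookup_single when_def)
    then show ?thesis using True subst_rel_var[of \<phi> c] by (simp add: var_inv_def)
  next
    case False
    have "\<phi> (Poly_Mapping.single l 1) = Poly_Mapping.single l 1"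
      by (rule poly_mapping_eqI) (use False in \<open>simp add: look lookup_single when_def\<close>)
    then show ?thesis using False subst_rel_var[of \<phi> l] by (simp add: var_def)
  qed
  have rel: "subst_rel \<phi> (P var) (P (var(c := var_inv c)))" by (rule nat[OF R RV])
  (* The reflected monomial: its exponent at c is K minus the one of m1. *)
  define m2 where "m2 = \<phi> m1 + Poly_Mapping.single c (int K)"
  have "?l (P (var(c := var_inv c))) (\<phi> m1) = ?l (P var) m1" by (rule subst_rel_lookup[OF rel inj])
  moreover have "?l (var c ^ K * P (var(c := var_inv c))) m2 = ?l (P (var(c := var_inv c))) (\<phi> m1)"
    unfolding var_power m2_def by (rule lookup_single_mult_shift)
  ultimately have "?l (of_int s * P var) m2 = ?l (P var) m1" using flip by (simp add: c_def)
  then have "s * ?l (P var) m2 = ?l (P var) m1" by (simp add: lookup_of_int_mult)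
  then have m2: "m2 \<in> ?keys" using m1(1) s by (auto simp: in_keys_iff)
  have l2: "?l m2 l = (if l = c then int K - ?l m1 c else ?l m1 l)" for l
    by (simp add: m2_def lookup_add look lookup_single when_def)
  have "{l. l < n \<and> ?T < ?l m2 l} = {l. l < n \<and> ?T < ?l m1 l} - {c}"
    using m1(3) by (auto simp: l2)
  then have "cnt m2 = cnt m1 - 1" unfolding cnt_def using m1(3) c by simp
  moreover have "cnt m1 > 0" unfolding cnt_def using m1(3) c by (auto simp: card_gt_0_iff)
  ultimately show False using min[OF m2] m1(2) by simp
qed

section \<open>The identities of types II and III\<close>

context ring_rel
begin

lemma R_prod_less: "(\<And>i. i < n \<Longrightarrow> R (x i) (y i)) \<Longrightarrow> R (prod_less n x) (prod_less n y)"
  unfolding prod_less_eq by (intro R_prod R_diff R_one R_mult) auto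

lemma R_prod_le: "(\<And>i. i < n \<Longrightarrow> R (x i) (y i)) \<Longrightarrow> R (prod_le n x) (prod_le n y)"
  unfolding prod_le_eq by (intro R_mult R_prod_less R_prod R_diff R_one) auto

lemma R_sum_even_cols: "(\<And>i. i < n \<Longrightarrow> R (x i) (y i)) \<Longrightarrow> R (sum_even_cols n k x) (sum_even_cols n k y)"
  unfolding sum_even_cols_def by (intro R_sum R_schur_fun)

lemma R_sum_odd_cols: "(\<And>i. i < n \<Longrightarrow> R (x i) (y i)) \<Longrightarrow> R (sum_odd_cols n k x) (sum_odd_cols n k y)"
  unfolding sum_odd_cols_def by (intro R_sum R_schur_fun)

lemma R_sum_even_rows: "(\<And>i. i < n \<Longrightarrow> R (x i) (y i)) \<Longrightarrow> R (sum_even_rows n k x) (sum_even_rows n k y)"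
  unfolding sum_even_rows_def by (intro R_sum R_schur_fun)

lemma R_sum_all: "(\<And>i. i < n \<Longrightarrow> R (x i) (y i)) \<Longrightarrow> R (sum_all n k x) (sum_all n k y)"
  unfolding sum_all_def by (intro R_sum R_schur_fun)

lemma R_numer:
  "(\<And>i. i < n \<Longrightarrow> R (x i) (y i)) \<Longrightarrow> R (numer n K (of_int s) x) (numer n K (of_int s) y)"
  unfolding numer_def by (intro R_Det R_add R_mult R_power R_of_int)

end

lemma vandermonde_swap: "\<tau> permutes {..<n} \<Longrightarrow> vandermonde n (\<lambda>i. x (\<tau> i)) = of_int (sign \<tau>) * vandermonde n x"
  unfolding vandermonde_alternant by (rule alternant_perm_rows)

lemma vandermonde_sum_swap:
  fixes x :: "nat \<Rightarrow> 'a::comm_ring_1"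
  assumes \<tau>: "\<tau> permutes {..<n}" and F: "F \<subseteq> shapes n k"
  shows "vandermonde n (\<lambda>i. x (\<tau> i)) * (\<Sum>f\<in>F. schur_fun n f (\<lambda>i. x (\<tau> i))) = of_int (sign \<tau>) * (vandermonde n x * (\<Sum>f\<in>F. schur_fun n f x))"
  unfolding sum_distrib_left
proof (rule sum.cong[OF refl])
  fix f assume "f \<in> F"
  then have f: "f \<in> shapes n k" using F by blast
  show "vandermonde n (\<lambda>i. x (\<tau> i)) * schur_fun n f (\<lambda>i. x (\<tau> i)) = of_int (sign \<tau>) * (vandermonde n x * schur_fun n f x)"
    unfolding bialternant[OF f, symmetric] by (rule alternant_perm_rows[OF \<tau>])
qed

lemma refl_exp_empty: "alternant n x (refl_exp n K {}) = vandermonde n x"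
  unfolding vandermonde_alternant by (rule alternant_cong) (simp_all add: refl_exp_def)

lemma refl_exp_big:
  assumes "j \<in> X" "j < n" "int K div 2 < int (K - (n - 1 - j))"
  shows "big n (int K div 2) (alternant n var (refl_exp n K X))"
  by (rule big_alternant[OF assms(2)]) (use assms in \<open>simp add: refl_exp_def\<close>)

lemma pos_of_int: "pos (of_int s)"
  by (rule pos.R_of_int)

text \<open>
  Reflecting an exponent \<open>n - 1 - j\<close> makes it at least \<open>K - (n - 1) > K / 2\<close>, so only the term without
  reflections, the Vandermonde product, is not negligible.
\<close>

lemma numer_big:
  assumes n: "1 \<le> n" and K: "2 * n - 1 \<le> K"
  shows "big n (int K div 2) (numer n K (of_int s) var - vandermonde n var)"
proof -
  have "numer n K (of_int s) var - vandermonde n var = (\<Sum>X\<in>Pow {..<n} - {{}}. of_int s ^ card X * alternant n var (refl_exp n K X))"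
    unfolding numer_expand by (subst sum.remove[of _ "{}"]) (simp_all add: refl_exp_empty)
  also have "big n (int K div 2) \<dots>"
  proof (rule big_sum)
    fix X assume X: "X \<in> Pow {..<n} - {{}}"
    then obtain j where j: "j \<in> X" "j < n" by auto
    have "big n (int K div 2) (alternant n var (refl_exp n K X))" by (rule refl_exp_big[OF j]) (use K n j in linarith)
    then show "big n (int K div 2) (of_int s ^ card X * alternant n var (refl_exp n K X))"
      by (rule big_mult_left) (intro pos.R_power pos_of_int)
  qed
  finally show ?thesis .
qed

text \<open>
  For \<open>K = 2 * n - 2\<close> the exponent \<open>n - 1\<close> at position \<open>0\<close> is fixed by the reflection, which makes
  the Vandermonde product occur twice.
\<close>

lemma numer_big_0:
  assumes n: "1 \<le> n"
  shows "big n (int (2 * n - 2) div 2) (numer n (2 * n - 2) (of_int 1) var - 2 * vandermonde n var)"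
proof -
  let ?K = "2 * n - 2"
  have q0: "alternant n var (refl_exp n ?K {0}) = vandermonde n var"
    unfolding vandermonde_alternant by (rule alternant_cong) (use n in \<open>auto simp: refl_exp_def\<close>)
  have "numer n ?K (of_int 1) var = (\<Sum>X\<in>Pow {..<n}. alternant n var (refl_exp n ?K X))"
    unfolding numer_expand by simp
  also have "\<dots> = alternant n var (refl_exp n ?K {}) + (\<Sum>X\<in>Pow {..<n} - {{}}. alternant n var (refl_exp n ?K X))"
    by (rule sum.remove) auto
  also have "(\<Sum>X\<in>Pow {..<n} - {{}}. alternant n var (refl_exp n ?K X)) =
    alternant n var (refl_exp n ?K {0}) + (\<Sum>X\<in>Pow {..<n} - {{}} - {{0}}. alternant n var (refl_exp n ?K X))"
    by (rule sum.remove) (use n in auto)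
  finally have "numer n ?K (of_int 1) var - 2 * vandermonde n var = (\<Sum>X\<in>Pow {..<n} - {{}} - {{0}}. alternant n var (refl_exp n ?K X))"
    by (simp add: refl_exp_empty q0)
  also have "big n (int ?K div 2) \<dots>"
  proof (rule big_sum)
    fix X assume X: "X \<in> Pow {..<n} - {{}} - {{0}}"
    then have "\<not> X \<subseteq> {0}" by blast
    then obtain j where j: "j \<in> X" "j \<noteq> 0" by auto
    then have jn: "j < n" using X by auto
    show "big n (int ?K div 2) (alternant n var (refl_exp n ?K X))"
      by (rule refl_exp_big[OF j(1) jn]) (use n j(2) jn in linarith)
  qed
  finally show ?thesis .
qed

lemma transpose_perm:
  fixes i j n :: nat
  assumes "i < n" "j < n" "i \<noteq> j"
  shows "transpose i j permutes {..<n}" "\<And>l. transpose i j (transpose i j l) = l" "sign (transpose i j) = - 1"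
  using assms by (simp_all add: permutes_swap_id sign_swap_id)

text \<open>
  The difference of both sides satisfies the hypotheses of \<open>laurent_flip_zero\<close>. Inverting the last
  variable exchanges the sums over even and odd columns, which is why only their combinations with
  \<open>s = \<plusminus>1\<close> are reproduced up to a factor.
\<close>

lemma typeIII_laurent:
  assumes n: "1 \<le> n" and k: "1 \<le> k" and s: "s = 1 \<or> s = - 1"
  shows "vandermonde n var * (prod_less n var * (sum_even_cols n k var + of_int s * sum_odd_cols n k var)) = numer n (k + 2 * n - 2) (of_int s) var"
proof -
  let ?K = "k + 2 * n - 2"
  let ?P = "\<lambda>x. vandermonde n x * (prod_less n x * (sum_even_cols n k x + of_int s * sum_odd_cols n k x)) - numer n ?K (of_int s) x"
  have ss: "of_int s * of_int s = (1 :: laurent)" using s by auto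
  have "?P var = 0"
  proof (rule laurent_flip_zero[where P = ?P and n = n and K = ?K and s = s, OF _ n])
    fix R :: "laurent \<Rightarrow> laurent \<Rightarrow> bool" and x y
    assume "ring_rel R" and xy: "\<And>i. i < n \<Longrightarrow> R (x i) (y i)"
    then interpret ring_rel R by simp
    show "R (?P x) (?P y)"
      by (intro R_diff R_mult R_vandermonde R_prod_less R_add R_sum_even_cols R_sum_odd_cols R_numer R_of_int xy)
  next
    fix i j assume ij: "i < n" "j < n" "i \<noteq> j"
    note t = transpose_perm[OF ij]
    have A: "vandermonde n (\<lambda>l. var (transpose i j l)) * sum_even_cols n k (\<lambda>l. var (transpose i j l)) = - (vandermonde n var * sum_even_cols n k var)"
      unfolding sum_even_cols_def by (subst vandermonde_sum_swap[OF t(1), of _ k]) (auto simp: t(3))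
    have B: "vandermonde n (\<lambda>l. var (transpose i j l)) * sum_odd_cols n k (\<lambda>l. var (transpose i j l)) = - (vandermonde n var * sum_odd_cols n k var)"
      unfolding sum_odd_cols_def by (subst vandermonde_sum_swap[OF t(1), of _ k]) (auto simp: t(3))
    have "?P (\<lambda>l. var (transpose i j l)) = prod_less n var * (vandermonde n (\<lambda>l. var (transpose i j l)) * sum_even_cols n k (\<lambda>l. var (transpose i j l))
      + of_int s * (vandermonde n (\<lambda>l. var (transpose i j l)) * sum_odd_cols n k (\<lambda>l. var (transpose i j l)))) + numer n ?K (of_int s) var"
      unfolding prod_less_swap[OF t(1,2)] numer_swap[OF t(1)] t(3) by (simp add: algebra_simps)
    then show "?P (\<lambda>l. var (transpose i j l)) = - ?P var"
      unfolding A B by (simp add: algebra_simps)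
  next
    obtain m where m: "n = Suc m" using n by (cases n) auto
    let ?x = "var(m := var_inv m)"
    have K: "?K = 2 * m + k" using m by simp
    have "var m ^ ?K * ?P ?x = (var m ^ (2 * m) * (vandermonde (Suc m) ?x * prod_less (Suc m) ?x)) *
      (var m ^ k * sum_even_cols (Suc m) k ?x + of_int s * (var m ^ k * sum_odd_cols (Suc m) k ?x)) - var m ^ ?K * numer (Suc m) ?K (of_int s) ?x"
    proof -
      have alg: "(a * b) * (v * (p * (A + c * B)) - N) = (a * (v * p)) * (b * A + c * (b * B)) - (a * b) * N"
        for a b v p A B c N :: laurent by (simp add: algebra_simps)
      have pow: "var m ^ ?K = var m ^ (2 * m) * var m ^ k" by (simp only: K power_add)
      show ?thesis unfolding pow unfolding m by (rule alg)
    qed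
    also have "\<dots> = vandermonde (Suc m) var * prod_less (Suc m) var * (sum_odd_cols (Suc m) k var + of_int s * sum_even_cols (Suc m) k var)
       - of_int s * numer (Suc m) ?K (of_int s) var"
      unfolding denom_flip[of var m, OF var_var_inv] sum_even_cols_flip[of var m, OF var_var_inv] sum_odd_cols_flip[of var m, OF var_var_inv]
      by (subst numer_flip[OF var_var_inv _ ss]) (use m in auto)
    also have "\<dots> = of_int s * ?P var"
    proof -
      have "of_int s * (sum_even_cols (Suc m) k var + of_int s * sum_odd_cols (Suc m) k var) = of_int s * sum_even_cols (Suc m) k var + of_int s * of_int s * sum_odd_cols (Suc m) k var"
        by (simp add: algebra_simps)
      then have "sum_odd_cols (Suc m) k var + of_int s * sum_even_cols (Suc m) k var = of_int s * (sum_even_cols (Suc m) k var + of_int s * sum_odd_cols (Suc m) k var)"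
        unfolding ss by simp
      then show ?thesis unfolding m by (simp add: right_diff_distrib mult_ac)
    qed
    finally show "var (n - 1) ^ ?K * ?P (var(n - 1 := var_inv (n - 1))) = of_int s * ?P var" by (simp add: m)
  next
    show "s \<noteq> 0" using s by auto
    have eq: "?P var = vandermonde n var * (prod_less n var * sum_even_cols n k var - 1) + of_int s * (vandermonde n var * (prod_less n var * sum_odd_cols n k var))
      - (numer n ?K (of_int s) var - vandermonde n var)" by (simp add: algebra_simps)
    show "big n (int ?K div 2) (?P var)"
      unfolding eq
      by (intro big_diff big_add even_cols_big[OF n] big_mult_left[OF odd_cols_big[OF n k] pos_of_int] numer_big[OF n])
         (use k n in simp)
  qed
  then show ?thesis by simp
qed

lemma shapes_n_0: "shapes n 0 = {\<lambda>_. 0}"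
proof
  show "shapes n 0 \<subseteq> {\<lambda>_. 0}"
  proof
    fix f assume f: "f \<in> shapes n 0"
    have "f i = 0" for i using shapes_le[OF f, of i] by simp
    then show "f \<in> {\<lambda>_. 0}" by (simp add: fun_eq_iff)
  qed
qed (simp add: shapes_def)

lemma sum_even_cols_0: "sum_even_cols n 0 x = 1"
proof -
  have "{f \<in> shapes n 0. even_cols f} = {\<lambda>_. 0}" unfolding shapes_n_0 by (auto simp: even_cols_def)
  then show ?thesis by (simp add: sum_even_cols_def schur_fun_empty)
qed

lemma sum_odd_cols_0: "sum_odd_cols n 0 x = 1"
proof -
  have "{f \<in> shapes n 0. odd_cols 0 f} = {\<lambda>_. 0}" unfolding shapes_n_0 by (auto simp: odd_cols_def)
  then show ?thesis by (simp add: sum_odd_cols_def schur_fun_empty)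
qed

lemma sum_even_rows_0: "sum_even_rows n 0 x = 1"
proof -
  have "{f \<in> shapes n 0. even_rows f} = {\<lambda>_. 0}" unfolding shapes_n_0 by (auto simp: even_rows_def)
  then show ?thesis by (simp add: sum_even_rows_def schur_fun_empty)
qed

lemma typeIII_laurent_0:
  assumes n: "1 \<le> n"
  shows "2 * (vandermonde n var * prod_less n var) = numer n (2 * n - 2) (of_int 1) var"
proof -
  let ?K = "2 * n - 2"
  let ?P = "\<lambda>x. of_int 2 * (vandermonde n x * prod_less n x) - numer n ?K (of_int 1) x"
  have "?P var = 0"
  proof (rule laurent_flip_zero[where P = ?P and n = n and K = ?K and s = 1, OF _ n])
    fix R :: "laurent \<Rightarrow> laurent \<Rightarrow> bool" and x y
    assume "ring_rel R" and xy: "\<And>i. i < n \<Longrightarrow> R (x i) (y i)"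
    then interpret ring_rel R by simp
    show "R (?P x) (?P y)"
      by (intro R_diff R_mult R_vandermonde R_prod_less R_numer R_of_int xy)
  next
    fix i j assume ij: "i < n" "j < n" "i \<noteq> j"
    note t = transpose_perm[OF ij]
    show "?P (\<lambda>l. var (transpose i j l)) = - ?P var"
      unfolding prod_less_swap[OF t(1,2)] numer_swap[OF t(1)] vandermonde_swap[OF t(1)] t(3) by (simp add: algebra_simps)
  next
    obtain m where m: "n = Suc m" using n by (cases n) auto
    let ?x = "var(m := var_inv m)"
    have K: "?K = 2 * m" using m by simp
    have "var m ^ ?K * ?P ?x = of_int 2 * (var m ^ (2 * m) * (vandermonde (Suc m) ?x * prod_less (Suc m) ?x))
      - var m ^ ?K * numer (Suc m) ?K (of_int 1) ?x"
      unfolding m K by (simp add: algebra_simps)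
    also have "\<dots> = of_int 2 * (vandermonde (Suc m) var * prod_less (Suc m) var) - of_int 1 * numer (Suc m) ?K (of_int 1) var"
      unfolding denom_flip[of var m, OF var_var_inv] by (subst numer_flip[OF var_var_inv]) (use m in auto)
    finally show "var (n - 1) ^ ?K * ?P (var(n - 1 := var_inv (n - 1))) = of_int 1 * ?P var" by (simp add: m)
  next
    show "(1 :: int) \<noteq> 0" by simp
    have a: "big n (int ?K div 2) (vandermonde n var * (prod_less n var - 1))"
      using even_cols_big[OF n, of 0] by (simp add: sum_even_cols_0)
    have eq: "?P var = of_int 2 * (vandermonde n var * (prod_less n var - 1)) - (numer n ?K (of_int 1) var - 2 * vandermonde n var)"
      by (simp add: algebra_simps)
    show "big n (int ?K div 2) (?P var)"
      unfolding eq by (rule big_diff[OF big_mult_left[OF a pos_of_int] numer_big_0[OF n]])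
  qed
  then show ?thesis by simp
qed

text \<open>
  As for type III. The additional factor \<open>1 - x i * x i\<close> of the last variable changes sign and accounts for
  \<open>\<epsilon> = -1\<close> and for the larger degree \<open>2 * k + 2 * n\<close>.
\<close>

lemma typeII_laurent:
  assumes n: "1 \<le> n"
  shows "vandermonde n var * (prod_le n var * sum_even_rows n (2 * k) var) = numer n (2 * k + 2 * n) (of_int (- 1)) var"
proof -
  let ?K = "2 * k + 2 * n"
  let ?P = "\<lambda>x. vandermonde n x * (prod_le n x * sum_even_rows n (2 * k) x) - numer n ?K (of_int (- 1)) x"
  have "?P var = 0"
  proof (rule laurent_flip_zero[where P = ?P and n = n and K = ?K and s = "- 1", OF _ n])
    fix R :: "laurent \<Rightarrow> laurent \<Rightarrow> bool" and x y
    assume "ring_rel R" and xy: "\<And>i. i < n \<Longrightarrow> R (x i) (y i)"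
    then interpret ring_rel R by simp
    show "R (?P x) (?P y)"
      by (intro R_diff R_mult R_vandermonde R_prod_le R_sum_even_rows R_numer xy)
  next
    fix i j assume ij: "i < n" "j < n" "i \<noteq> j"
    note t = transpose_perm[OF ij]
    have E: "vandermonde n (\<lambda>l. var (transpose i j l)) * sum_even_rows n (2 * k) (\<lambda>l. var (transpose i j l)) = - (vandermonde n var * sum_even_rows n (2 * k) var)"
      unfolding sum_even_rows_def by (subst vandermonde_sum_swap[OF t(1), of _ "2 * k"]) (auto simp: t(3))
    have "?P (\<lambda>l. var (transpose i j l)) = prod_le n var * (vandermonde n (\<lambda>l. var (transpose i j l)) * sum_even_rows n (2 * k) (\<lambda>l. var (transpose i j l)))
      + numer n ?K (of_int (- 1)) var"
      unfolding prod_le_swap[OF t(1,2)] numer_swap[OF t(1)] t(3) by (simp add: algebra_simps)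
    then show "?P (\<lambda>l. var (transpose i j l)) = - ?P var"
      unfolding E by (simp add: algebra_simps)
  next
    obtain m where m: "n = Suc m" using n by (cases n) auto
    let ?x = "var(m := var_inv m)"
    have K: "?K = 2 * m + (2 + 2 * k)" using m by simp
    have sq: "var m ^ 2 * (\<Prod>i<Suc m. 1 - ?x i * ?x i) = - (\<Prod>i<Suc m. 1 - var i * var i)"
    proof -
      have "var m ^ 2 * (1 - var_inv m * var_inv m) = var m * var m - (var m * var_inv m) * (var m * var_inv m)"
        by (simp add: algebra_simps power2_eq_square)
      also have "\<dots> = - (1 - var m * var m)" by (simp add: var_var_inv)
      finally have "(\<Prod>i<m. 1 - var i * var i) * (var m ^ 2 * (1 - var_inv m * var_inv m)) = (\<Prod>i<m. 1 - var i * var i) * - (1 - var m * var m)"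
        by simp
      moreover have "(\<Prod>i<m. 1 - ?x i * ?x i) = (\<Prod>i<m. 1 - var i * var i)" by (rule prod.cong) auto
      ultimately show ?thesis by (simp add: algebra_simps)
    qed
    have "var m ^ ?K * ?P ?x = (var m ^ (2 * m) * (vandermonde (Suc m) ?x * prod_less (Suc m) ?x)) *
      (var m ^ 2 * (\<Prod>i<Suc m. 1 - ?x i * ?x i)) * (var m ^ (2 * k) * sum_even_rows (Suc m) (2 * k) ?x) - var m ^ ?K * numer (Suc m) ?K (of_int (- 1)) ?x"
    proof -
      have alg: "(a * (c * b)) * (v * ((p * q) * E) - N) = (a * (v * p)) * (c * q) * (b * E) - (a * (c * b)) * N"
        for a b c v p q E N :: laurent by (simp add: algebra_simps)
      have pow: "var m ^ ?K = var m ^ (2 * m) * (var m ^ 2 * var m ^ (2 * k))" by (simp only: K power_add)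
      show ?thesis unfolding pow prod_le_eq unfolding m by (rule alg)
    qed
    also have "\<dots> = vandermonde (Suc m) var * prod_less (Suc m) var * - (\<Prod>i<Suc m. 1 - var i * var i) * sum_even_rows (Suc m) (2 * k) var
       - of_int (- 1) * numer (Suc m) ?K (of_int (- 1)) var"
      unfolding denom_flip[of var m, OF var_var_inv] sq sum_even_rows_flip[of var m, OF var_var_inv even_mult_iff[THEN iffD2, OF disjI1, OF even_numeral]]
      by (subst numer_flip[OF var_var_inv]) (use m in auto)
    also have "\<dots> = of_int (- 1) * ?P var"
      unfolding m prod_le_eq by (simp add: algebra_simps)
    finally show "var (n - 1) ^ ?K * ?P (var(n - 1 := var_inv (n - 1))) = of_int (- 1) * ?P var" by (simp add: m)
  next
    show "(- 1 :: int) \<noteq> 0" by simp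
    have eq: "?P var = vandermonde n var * (prod_le n var * sum_even_rows n (2 * k) var - 1) - (numer n ?K (of_int (- 1)) var - vandermonde n var)"
      by (simp add: algebra_simps)
    show "big n (int ?K div 2) (?P var)"
      unfolding eq by (intro big_diff even_rows_big[OF n] numer_big[OF n]) simp
  qed
  then show ?thesis by simp
qed

text \<open>
  Reflection with \<open>K = 2 * n - 1 + m\<close> takes \<open>n - 1 - j\<close> to \<open>n + (j + m)\<close>, the beta number for a leg \<open>j\<close>
  with arm \<open>j + m\<close>. So the subsets \<open>L\<close> of reflected positions correspond to the partitions
  \<open>(\<alpha> + m | \<alpha>)\<close>, and \<open>(boxes \<pi> - c * rk \<pi>) / 2\<close> is the sum of the legs plus \<open>d * rk \<pi>\<close>. The sum of the legs
  is accounted for by sorting the exponents.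
\<close>

lemma shifted_frobs_sum:
  fixes x :: "nat \<Rightarrow> 'a::comm_ring_1"
  assumes n: "1 \<le> n" and K: "int K = 2 * int n - 1 + m" and c: "m + 1 = int c + 2 * int d"
  shows "vandermonde n x * (\<Sum>\<pi>\<in>{\<pi> \<in> shifted_frobs m n. C (rk \<pi>)}. (- 1) ^ ((boxes \<pi> - c * rk \<pi>) div 2) * schur n \<pi> x) =
    (\<Sum>L\<in>{L. L \<subseteq> {..<n} \<and> (\<forall>j\<in>L. 0 \<le> int j + m) \<and> C (card L)}. (- 1) ^ (d * card L) * alternant n x (refl_exp n K L))"
proof -
  have b: "bij_betw leg_set {\<pi> \<in> shifted_frobs m n. C (rk \<pi>)} {L. L \<subseteq> {..<n} \<and> (\<forall>j\<in>L. 0 \<le> int j + m) \<and> C (card L)}"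
  proof (rule bij_betw_subset[OF shifted_frobs_bij])
    have card: "card (leg_set \<pi>) = rk \<pi>" if "\<pi> \<in> shifted_frobs m n" for \<pi>
      using that by (intro card_leg_set) (simp add: shifted_frobs_iff)
    have "leg_set ` {\<pi> \<in> shifted_frobs m n. C (rk \<pi>)} = {L \<in> leg_set ` shifted_frobs m n. C (card L)}"
      using card by auto
    also have "\<dots> = {L. L \<subseteq> {..<n} \<and> (\<forall>j\<in>L. 0 \<le> int j + m) \<and> C (card L)}"
      unfolding bij_betw_imp_surj_on[OF shifted_frobs_bij] by auto
    finally show "leg_set ` {\<pi> \<in> shifted_frobs m n. C (rk \<pi>)} = {L. L \<subseteq> {..<n} \<and> (\<forall>j\<in>L. 0 \<le> int j + m) \<and> C (card L)}" .
  qed auto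
  have "vandermonde n x * (\<Sum>\<pi>\<in>{\<pi> \<in> shifted_frobs m n. C (rk \<pi>)}. (- 1) ^ ((boxes \<pi> - c * rk \<pi>) div 2) * schur n \<pi> x) =
    (\<Sum>\<pi>\<in>{\<pi> \<in> shifted_frobs m n. C (rk \<pi>)}. (- 1) ^ (d * card (leg_set \<pi>)) * alternant n x (refl_exp n K (leg_set \<pi>)))"
    unfolding sum_distrib_left
  proof (rule sum.cong[OF refl])
    fix \<pi> assume "\<pi> \<in> {\<pi> \<in> shifted_frobs m n. C (rk \<pi>)}"
    then have \<pi>: "\<pi> \<in> shifted_frobs m n" by simp
    have card: "card (leg_set \<pi>) = rk \<pi>" using \<pi> by (intro card_leg_set) (simp add: shifted_frobs_iff)
    have L: "leg_set \<pi> \<subseteq> {..<n}" "\<And>j. j \<in> leg_set \<pi> \<Longrightarrow> 0 \<le> int j + m"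
      using bij_betwE[OF shifted_frobs_bij[of m n]] \<pi> by auto
    have "int (boxes \<pi>) = int (2 * \<Sum>(leg_set \<pi>) + c * rk \<pi> + 2 * (d * rk \<pi>))"
      unfolding shifted_frobs_boxes[OF \<pi>] c by (simp add: algebra_simps)
    then have "boxes \<pi> = 2 * \<Sum>(leg_set \<pi>) + c * rk \<pi> + 2 * (d * rk \<pi>)" by (rule of_nat_eq_iff[THEN iffD1])
    then have e: "(boxes \<pi> - c * rk \<pi>) div 2 = \<Sum>(leg_set \<pi>) + d * rk \<pi>" by simp
    have "alternant n x (refl_exp n K (leg_set \<pi>)) = alternant n x (flip_exp n (leg_set \<pi>) (\<lambda>j. nat (int j + m)))"
    proof (rule alternant_cong)
      fix j assume "j < n"
      then show "refl_exp n K (leg_set \<pi>) j = flip_exp n (leg_set \<pi>) (\<lambda>j. nat (int j + m)) j"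
      proof (cases "j \<in> leg_set \<pi>")
        case True
        obtain a where a: "int j + m = int a" using zero_le_imp_eq_int[OF L(2)[OF True]] by blast
        have "K + j + 1 = 2 * n + a" using a K n by linarith
        then have "K - (n - 1 - j) = n + a" using \<open>j < n\<close> by arith
        then show ?thesis using True a by (simp add: refl_exp_def flip_exp_def)
      qed (simp add: refl_exp_def flip_exp_def)
    qed simp
    also have "\<dots> = (- 1) ^ (\<Sum>(leg_set \<pi>)) * (vandermonde n x * schur n \<pi> x)" by (rule shifted_frobs_alternant[OF \<pi>])
    finally show "vandermonde n x * ((- 1) ^ ((boxes \<pi> - c * rk \<pi>) div 2) * schur n \<pi> x) =
      (- 1) ^ (d * card (leg_set \<pi>)) * alternant n x (refl_exp n K (leg_set \<pi>))"
      unfolding e card power_add by (simp only: mult_ac)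
  qed
  also have "\<dots> = (\<Sum>L\<in>{L. L \<subseteq> {..<n} \<and> (\<forall>j\<in>L. 0 \<le> int j + m) \<and> C (card L)}. (- 1) ^ (d * card L) * alternant n x (refl_exp n K L))"
    by (rule sum.reindex_bij_betw[OF b])
  finally show ?thesis .
qed

lemma vandermonde_var_nonzero: "vandermonde n var \<noteq> 0"
  by (rule laurent_vandermonde_nonzero) (simp add: inj_on_def var_inject)

lemma typeII_generic:
  assumes n: "1 \<le> n"
  shows "typeII_lhs n k var = typeII_rhs n k var"
proof -
  have "vandermonde n var * typeII_rhs n k var = (\<Sum>L\<in>{L. L \<subseteq> {..<n} \<and> (\<forall>j\<in>L. 0 \<le> int j + (2 * int k + 1)) \<and> True}.
      (- 1) ^ (1 * card L) * alternant n var (refl_exp n (2 * k + 2 * n) L))"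
    unfolding typeII_rhs_def
    using shifted_frobs_sum[OF n, of "2 * k + 2 * n" "2 * int k + 1" "2 * k" 1 var "\<lambda>_. True"] by simp
  also have "{L. L \<subseteq> {..<n} \<and> (\<forall>j\<in>L. 0 \<le> int j + (2 * int k + 1)) \<and> True} = Pow {..<n}" by auto
  also have "(\<Sum>L\<in>Pow {..<n}. (- 1) ^ (1 * card L) * alternant n var (refl_exp n (2 * k + 2 * n) L)) = vandermonde n var * typeII_lhs n k var"
    unfolding typeII_lhs_eq typeII_laurent[OF n] numer_expand by simp
  finally show ?thesis using vandermonde_var_nonzero by (metis mult_left_cancel)
qed

text \<open>
  The cases \<open>s = 1\<close> and \<open>s = -1\<close> are added and subtracted. In the expansion of the numerator this
  selects the sets of even and of odd size, that is, the partitions of even and of odd rank. For \<open>k = 0\<close>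
  the leg \<open>0\<close> is not allowed, since its arm would be negative. The sets containing \<open>0\<close> duplicate those without, in
  agreement with the factor 2 in \<open>typeIII_laurent_0\<close>.
\<close>

lemma typeIII_generic:
  assumes n: "1 \<le> n"
  shows "typeIIIa_lhs n k var = typeIIIa_rhs n k var \<and> typeIIIb_lhs n k var = typeIIIb_rhs n k var"
proof -
  let ?K = "k + 2 * n - 2"
  have K: "int ?K = 2 * int n - 1 + (int k - 1)" using n by simp
  let ?Ls = "\<lambda>C. {L. L \<subseteq> {..<n} \<and> (\<forall>j\<in>L. 0 \<le> int j + (int k - 1)) \<and> C (card L)}"
  have rhs: "vandermonde n var * (\<Sum>\<pi>\<in>{\<pi> \<in> shifted_frobs (int k - 1) n. C (rk \<pi>)}. (- 1) ^ ((boxes \<pi> - k * rk \<pi>) div 2) * schur n \<pi> var) =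
      (\<Sum>L\<in>?Ls C. alternant n var (refl_exp n ?K L))" for C
    using shifted_frobs_sum[OF n K, of k 0 var C] by simp
  have ra: "vandermonde n var * typeIIIa_rhs n k var = (\<Sum>L\<in>?Ls (\<lambda>r. k = 0 \<or> even r). alternant n var (refl_exp n ?K L))"
    unfolding typeIIIa_rhs_def by (rule rhs)
  have rb: "vandermonde n var * typeIIIb_rhs n k var = (\<Sum>L\<in>?Ls (\<lambda>r. k = 0 \<or> odd r). alternant n var (refl_exp n ?K L))"
    unfolding typeIIIb_rhs_def by (rule rhs)
  show ?thesis
  proof (cases "k = 0")
    case True
    let ?L0 = "{L. L \<subseteq> {..<n} \<and> 0 \<notin> L}"
    have eqv: "(\<forall>j\<in>L. 0 \<le> int j + (int k - 1)) \<longleftrightarrow> 0 \<notin> L" for L :: "nat set"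
    proof
      assume a: "\<forall>j\<in>L. 0 \<le> int j + (int k - 1)"
      show "0 \<notin> L"
      proof
        assume "0 \<in> L"
        with a have "0 \<le> int 0 + (int k - 1)" by blast
        then show False using True by simp
      qed
    next
      assume z: "0 \<notin> L"
      show "\<forall>j\<in>L. 0 \<le> int j + (int k - 1)"
      proof
        fix j assume "j \<in> L"
        then have "j \<noteq> 0" using z by metis
        then show "0 \<le> int j + (int k - 1)" by simp
      qed
    qed
    have L0: "?Ls (\<lambda>r. k = 0 \<or> C r) = ?L0" for C unfolding eqv using True by simp
    have PL: "Pow {..<n} = ?L0 \<union> insert 0 ` ?L0"
    proof (intro Set.set_eqI iffI)
      fix L assume L: "L \<in> Pow {..<n}"
      show "L \<in> ?L0 \<union> insert 0 ` ?L0"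
      proof (cases "0 \<in> L")
        case True
        then have "L = insert 0 (L - {0})" by auto
        moreover have "L - {0} \<in> ?L0" using L by auto
        ultimately show ?thesis by blast
      qed (use L in auto)
    next
      fix L assume "L \<in> ?L0 \<union> insert 0 ` ?L0"
      then show "L \<in> Pow {..<n}" using n by auto
    qed
    have fin: "finite ?L0" by (rule finite_subset[of _ "Pow {..<n}"]) auto
    have "numer n (2 * n - 2) (of_int 1) var = (\<Sum>L\<in>Pow {..<n}. alternant n var (refl_exp n (2 * n - 2) L))"
      unfolding numer_expand by simp
    also have "\<dots> = (\<Sum>L\<in>?L0. alternant n var (refl_exp n (2 * n - 2) L)) + (\<Sum>L\<in>insert 0 ` ?L0. alternant n var (refl_exp n (2 * n - 2) L))"
      unfolding PL by (rule sum.union_disjoint) (use fin in auto)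
    also have "(\<Sum>L\<in>insert 0 ` ?L0. alternant n var (refl_exp n (2 * n - 2) L)) = (\<Sum>L\<in>?L0. alternant n var (refl_exp n (2 * n - 2) L))"
    proof (rule sum.reindex_cong[of "insert 0"])
      show "inj_on (insert 0) ?L0"
      proof (rule inj_onI)
        fix A B assume "A \<in> ?L0" "B \<in> ?L0" "insert 0 A = insert 0 B"
        then show "A = B" using insert_ident[of 0 A B] by simp
      qed
      fix L assume "L \<in> ?L0"
      show "alternant n var (refl_exp n (2 * n - 2) (insert 0 L)) = alternant n var (refl_exp n (2 * n - 2) L)"
        by (rule alternant_cong) (use n in \<open>auto simp: refl_exp_def\<close>)
    qed simp
    finally have "2 * (vandermonde n var * prod_less n var) = 2 * (\<Sum>L\<in>?L0. alternant n var (refl_exp n (2 * n - 2) L))"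
      unfolding typeIII_laurent_0[OF n] by simp
    then have "vandermonde n var * prod_less n var = (\<Sum>L\<in>?L0. alternant n var (refl_exp n (2 * n - 2) L))" by simp
    then have "vandermonde n var * typeIIIa_lhs n k var = vandermonde n var * typeIIIa_rhs n k var"
      "vandermonde n var * typeIIIb_lhs n k var = vandermonde n var * typeIIIb_rhs n k var"
      unfolding ra rb L0[of even] L0[of odd] typeIIIa_lhs_eq typeIIIb_lhs_eq using True by (simp_all add: sum_even_cols_0 sum_odd_cols_0)
    then show ?thesis using vandermonde_var_nonzero by (metis mult_left_cancel)
  next
    case False
    then have k: "1 \<le> k" by simp
    have Ls: "?Ls (\<lambda>r. k = 0 \<or> C r) = {L \<in> Pow {..<n}. C (card L)}" for C using False k by auto
    define a b where "a = vandermonde n var * typeIIIa_lhs n k var" and "b = vandermonde n var * typeIIIb_lhs n k var"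
    have p: "a + b = (\<Sum>L\<in>Pow {..<n}. alternant n var (refl_exp n ?K L))"
      using typeIII_laurent[OF n k, of 1] unfolding numer_expand a_def b_def typeIIIa_lhs_eq typeIIIb_lhs_eq
      by (simp add: algebra_simps)
    have m: "a - b = (\<Sum>L\<in>Pow {..<n}. (- 1) ^ card L * alternant n var (refl_exp n ?K L))"
      using typeIII_laurent[OF n k, of "- 1"] unfolding numer_expand a_def b_def typeIIIa_lhs_eq typeIIIb_lhs_eq
      by (simp add: algebra_simps)
    have "2 * a = (a + b) + (a - b)" by simp
    also have "\<dots> = (\<Sum>L\<in>Pow {..<n}. if even (card L) then 2 * alternant n var (refl_exp n ?K L) else 0)"
      unfolding p m sum.distrib[symmetric] by (rule sum.cong) auto
    also have "\<dots> = 2 * (\<Sum>L\<in>{L \<in> Pow {..<n}. even (card L)}. alternant n var (refl_exp n ?K L))"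
      unfolding sum_distrib_left by (rule sum.inter_filter[symmetric]) simp
    finally have a: "a = vandermonde n var * typeIIIa_rhs n k var" unfolding ra Ls[of even] by simp
    have "2 * b = (a + b) - (a - b)" by simp
    also have "\<dots> = (\<Sum>L\<in>Pow {..<n}. if odd (card L) then 2 * alternant n var (refl_exp n ?K L) else 0)"
      unfolding p m sum_subtractf[symmetric] by (rule sum.cong) auto
    also have "\<dots> = 2 * (\<Sum>L\<in>{L \<in> Pow {..<n}. odd (card L)}. alternant n var (refl_exp n ?K L))"
      unfolding sum_distrib_left by (rule sum.inter_filter[symmetric]) simp
    finally have b: "b = vandermonde n var * typeIIIb_rhs n k var" unfolding rb Ls[of odd] by simp
    show ?thesis using a b vandermonde_var_nonzero unfolding a_def b_def by (metis mult_left_cancel)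
  qed
qed

lemma typeII_identity:
  fixes x :: "nat \<Rightarrow> 'a::comm_ring_1"
  assumes n: "1 \<le> n"
  shows "typeII_lhs n k x = typeII_rhs n k x"
proof -
  interpret ring_rel "eval_rel x" by (rule eval_rel)
  have "eval_rel x (typeII_lhs n k var) (typeII_lhs n k x)"
    unfolding typeII_lhs_def by (intro R_mult R_prod_le R_sum R_schur eval_rel_var)
  moreover have "eval_rel x (typeII_rhs n k var) (typeII_rhs n k x)"
    unfolding typeII_rhs_def by (intro R_sum R_mult R_schur R_power R_uminus R_one eval_rel_var)
  ultimately show ?thesis unfolding typeII_generic[OF n] by (rule eval_rel_eq)
qed

lemma typeIII_identities:
  fixes x :: "nat \<Rightarrow> 'a::comm_ring_1"
  assumes n: "1 \<le> n"
  shows "typeIIIa_lhs n k x = typeIIIa_rhs n k x" "typeIIIb_lhs n k x = typeIIIb_rhs n k x"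
proof -
  interpret ring_rel "eval_rel x" by (rule eval_rel)
  have la: "eval_rel x (typeIIIa_lhs n k var) (typeIIIa_lhs n k x)"
    unfolding typeIIIa_lhs_def by (intro R_mult R_prod_less R_sum R_schur eval_rel_var)
  have ra: "eval_rel x (typeIIIa_rhs n k var) (typeIIIa_rhs n k x)"
    unfolding typeIIIa_rhs_def by (intro R_sum R_mult R_schur R_power R_uminus R_one eval_rel_var)
  show "typeIIIa_lhs n k x = typeIIIa_rhs n k x"
    by (rule eval_rel_eq[OF la]) (use ra typeIII_generic[OF n, of k] in simp)
  have lb: "eval_rel x (typeIIIb_lhs n k var) (typeIIIb_lhs n k x)"
    unfolding typeIIIb_lhs_def by (intro R_mult R_prod_less R_sum R_schur eval_rel_var)
  have rb: "eval_rel x (typeIIIb_rhs n k var) (typeIIIb_rhs n k x)"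
    unfolding typeIIIb_rhs_def by (intro R_sum R_mult R_schur R_power R_uminus R_one eval_rel_var)
  show "typeIIIb_lhs n k x = typeIIIb_rhs n k x"
    by (rule eval_rel_eq[OF lb]) (use rb typeIII_generic[OF n, of k] in simp)
qed

section \<open>The cases k = 0 and k = 1\<close>

lemma schur_Nil: "schur n [] x = 1"
  by (simp add: schur_def ssyt_def diagram_def)

lemma Par_0: "Par n 0 = {[]}"
proof
  show "Par n 0 \<subseteq> {[]}"
  proof
    fix \<pi> assume "\<pi> \<in> Par n 0"
    then have p: "is_partition \<pi>" "part \<pi> 0 = 0" by (auto simp: Par_iff)
    then show "\<pi> \<in> {[]}" using part_eq_0_iff[OF p(1), of 0] by simp
  qed
qed (simp add: Par_iff Nil_partition part_def)

lemma schur_uminus: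
  fixes x :: "nat \<Rightarrow> 'a::comm_ring_1"
  shows "schur n \<pi> (\<lambda>i. - x i) = (- 1) ^ boxes \<pi> * schur n \<pi> x"
proof -
  have "(\<Prod>c\<in>diagram \<pi>. - x (T c)) = (- 1) ^ boxes \<pi> * (\<Prod>c\<in>diagram \<pi>. x (T c))" for T
  proof -
    have "(\<Prod>c\<in>diagram \<pi>. - x (T c)) = (\<Prod>c\<in>diagram \<pi>. - 1 * x (T c))" by simp
    also have "\<dots> = (- 1) ^ boxes \<pi> * (\<Prod>c\<in>diagram \<pi>. x (T c))"
      unfolding prod.distrib boxes_def by simp
    finally show ?thesis .
  qed
  then show ?thesis unfolding schur_def by (simp add: sum_distrib_left)
qed

lemma pi_x_0:
  assumes "is_partition \<mu>" shows "pi_x 0 \<mu> = \<mu>"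
proof -
  have "is_frobenius \<mu> (shift (arms \<mu>) (int 0)) (legs \<mu>)"
    using assms by (simp add: is_frobenius_def shift_def)
  then show ?thesis unfolding pi_x_def by (rule frobenius_eq)
qed

lemma neg_one_twice: "(- 1 :: 'a::comm_ring_1) ^ m * ((- 1) ^ m * a) = a"
  by (simp flip: mult.assoc power_add mult_2)

lemma typeI_0:
  fixes x y :: "nat \<Rightarrow> 'a::comm_ring_1"
  shows "typeI_lhs p q 0 (\<lambda>i. - x i) y = dual_cauchy_lhs p q x y"
    "typeI_rhs p q 0 (\<lambda>i. - x i) y = dual_cauchy_rhs p q x y"
proof -
  show "typeI_lhs p q 0 (\<lambda>i. - x i) y = dual_cauchy_lhs p q x y"
    by (simp add: typeI_lhs_def dual_cauchy_lhs_def Par_0 schur_Nil)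
  show "typeI_rhs p q 0 (\<lambda>i. - x i) y = dual_cauchy_rhs p q x y"
    unfolding typeI_rhs_def dual_cauchy_rhs_def
  proof (rule sum.cong[OF refl])
    fix \<mu> assume "\<mu> \<in> Par p q"
    then have m: "is_partition \<mu>" by (simp add: Par_iff)
    have "pi_y 0 \<mu> = Defs.conjugate \<mu>"
      unfolding pi_y_conjugate[OF m] by (rule pi_x_0[OF conjugate_partition(1)[OF m]])
    then show "(- 1) ^ (boxes (pi_x 0 \<mu>) - 0 * rk (pi_x 0 \<mu>)) * schur p (pi_x 0 \<mu>) (\<lambda>i. - x i) * schur q (pi_y 0 \<mu>) y =
      schur p \<mu> x * schur q (Defs.conjugate \<mu>) y"
      by (simp add: pi_x_0[OF m] schur_uminus neg_one_twice)
  qed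
qed

lemma pi_same_size:
  assumes "\<mu> \<in> Par p q"
  shows "boxes (pi_x k \<mu>) = boxes (pi_y k \<mu>) \<and> rk (pi_x k \<mu>) = rk (pi_y k \<mu>)"
proof -
  have m: "is_partition \<mu>" using assms by (simp add: Par_iff)
  note c = conjugate_partition[OF m]
  show ?thesis
    unfolding pi_y_conjugate[OF m] boxes_pi_x[OF m] boxes_pi_x[OF c(1)] boxes_conjugate[OF m] c(4)
      pi_x_frob(3)[OF m order_refl] pi_x_frob(3)[OF c(1) order_refl] by simp
qed

lemma typeII_0:
  fixes x :: "nat \<Rightarrow> 'a::comm_ring_1"
  shows "typeII_lhs n 0 x = prod_le n x" "typeII_rhs n 0 x = classicalII_rhs n x"
proof -
  show "typeII_lhs n 0 x = prod_le n x" by (simp add: typeII_lhs_eq sum_even_rows_0)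
  have "(\<exists>\<alpha>. is_frobenius \<pi> (shift \<alpha> 1) \<alpha>) \<and> length \<pi> \<le> n \<longleftrightarrow> \<pi> \<in> shifted_frobs 1 n" for \<pi>
  proof (cases "is_partition \<pi>")
    case True
    then show ?thesis unfolding shifted_frobs_def is_frobenius_def using hd_legs_less_iff[OF True, of n] by auto
  qed (auto simp: shifted_frobs_def is_frobenius_def)
  then show "typeII_rhs n 0 x = classicalII_rhs n x"
    by (simp add: typeII_rhs_def classicalII_rhs_def)
qed

lemma typeIII_0:
  fixes x :: "nat \<Rightarrow> 'a::comm_ring_1"
  shows "typeIIIa_lhs n 0 x = prod_less n x" "typeIIIb_lhs n 0 x = prod_less n x"
    "typeIIIa_rhs n 0 x = classicalIII_rhs n x" "typeIIIb_rhs n 0 x = classicalIII_rhs n x"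
proof -
  show "typeIIIa_lhs n 0 x = prod_less n x" "typeIIIb_lhs n 0 x = prod_less n x"
    by (simp_all add: typeIIIa_lhs_eq typeIIIb_lhs_eq sum_even_cols_0 sum_odd_cols_0)
  have "is_partition \<pi> \<and> (\<exists>\<alpha>. is_frobenius (Defs.conjugate \<pi>) (shift \<alpha> 1) \<alpha>) \<and> length \<pi> \<le> n \<longleftrightarrow>
    \<pi> \<in> shifted_frobs (int 0 - 1) n" for \<pi>
  proof (cases "is_partition \<pi>")
    case True
    note c = conjugate_partition[OF True]
    have "(\<exists>\<alpha>. is_frobenius (Defs.conjugate \<pi>) (shift \<alpha> 1) \<alpha>) \<longleftrightarrow>
      arms (Defs.conjugate \<pi>) = shift (legs (Defs.conjugate \<pi>)) 1"
      using c(1) unfolding is_frobenius_def by auto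
    also have "\<dots> \<longleftrightarrow> (\<forall>i<rk \<pi>. int (leg \<pi> i) = int (arm \<pi> i) + 1)"
      unfolding arms_arm[OF c(1)] legs_leg[OF c(1)] c(4-6) shift_def by auto
    also have "\<dots> \<longleftrightarrow> (\<forall>i<rk \<pi>. int (arm \<pi> i) = int (leg \<pi> i) + (int 0 - 1))" by auto
    finally show ?thesis unfolding shifted_frobs_iff using True by blast
  qed (simp add: shifted_frobs_iff)
  then have eq: "{\<pi>. is_partition \<pi> \<and> (\<exists>\<alpha>. is_frobenius (Defs.conjugate \<pi>) (shift \<alpha> 1) \<alpha>) \<and> length \<pi> \<le> n} =
    shifted_frobs (int 0 - 1) n" by blast
  show "typeIIIa_rhs n 0 x = classicalIII_rhs n x" "typeIIIb_rhs n 0 x = classicalIII_rhs n x"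
    unfolding typeIIIa_rhs_def typeIIIb_rhs_def classicalIII_rhs_def eq by simp_all
qed

text \<open>
  The shapes with rows of length at most one are the columns, so this is the expansion into elementary
  symmetric polynomials. It follows from \<open>sum_even_rows_pieri\<close>, where for \<open>N = 0\<close> only the empty shape has
  even rows; the Vandermonde product is cancelled in the ring of Laurent polynomials.
\<close>

lemma prod_one_plus:
  fixes x :: "nat \<Rightarrow> 'a::comm_ring_1"
  shows "(\<Prod>i<n. 1 + x i) = sum_all n 1 x"
proof -
  have "vandermonde n var * (\<Prod>i<n. 1 + var i) = vandermonde n var * sum_all n 1 var"
    using sum_even_rows_pieri[of 0 var n] by (simp add: sum_even_rows_0 mult.commute)
  then have var: "(\<Prod>i<n. 1 + var i) = sum_all n 1 var" using vandermonde_var_nonzero by simp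
  interpret ring_rel "eval_rel x" by (rule eval_rel)
  have "eval_rel x (\<Prod>i<n. 1 + var i) (\<Prod>i<n. 1 + x i)"
    by (intro R_prod R_add R_one eval_rel_var)
  moreover have "eval_rel x (sum_all n 1 var) (sum_all n 1 x)" by (intro R_sum_all eval_rel_var)
  ultimately show ?thesis unfolding var by (rule eval_rel_eq)
qed

text \<open>
  A single column has either even or odd length.
\<close>

lemma shapes_1_split:
  "shapes n 1 = {f \<in> shapes n 1. even_cols f} \<union> {f \<in> shapes n 1. odd_cols 1 f}"
  "{f \<in> shapes n 1. even_cols f} \<inter> {f \<in> shapes n 1. odd_cols 1 f} = {}"
proof -
  have "even_cols f \<noteq> odd_cols 1 f" if f: "f \<in> shapes n 1" for f
  proof -
    define m where "m = card {i. f i \<noteq> 0}"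
    have le: "f i \<le> 1" for i by (rule shapes_le[OF f])
    have fm: "f i \<noteq> 0 \<longleftrightarrow> i < m" for i unfolding m_def by (rule shapes_nonzero_iff[OF f])
    have fi: "f i = (if i < m then 1 else 0)" for i
    proof (cases "i < m")
      case True
      then have "f i \<noteq> 0" using fm by blast
      then have "f i = 1" using le[of i] by linarith
      then show ?thesis using True by simp
    next
      case False
      then have "f i = 0" using fm by blast
      then show ?thesis using False by simp
    qed
    show ?thesis
    proof (cases "even m")
      case True
      then obtain d where d: "m = 2 * d" by (elim evenE)
      have "even_cols f" unfolding even_cols_def fi d by auto
      moreover have "\<not> odd_cols 1 f"
      proof
        assume o: "odd_cols 1 f"
        then have "0 < m" using fi[of 0] unfolding odd_cols_def by (metis gr0I not_less0 zero_neq_one)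
        then obtain c where "d = Suc c" using d by (cases d) auto
        then have "f (2 * c + 1) \<noteq> f (2 * c + 2)" unfolding fi d by simp
        then show False using o by (simp add: odd_cols_def)
      qed
      ultimately show ?thesis by simp
    next
      case False
      then obtain d where d: "m = 2 * d + 1" by (elim oddE)
      have "odd_cols 1 f" unfolding odd_cols_def fi d by auto
      moreover have "f (2 * d) \<noteq> f (2 * d + 1)" unfolding fi d by simp
      then have "\<not> even_cols f" by (auto simp: even_cols_def)
      ultimately show ?thesis by simp
    qed
  qed
  then show "shapes n 1 = {f \<in> shapes n 1. even_cols f} \<union> {f \<in> shapes n 1. odd_cols 1 f}"
    "{f \<in> shapes n 1. even_cols f} \<inter> {f \<in> shapes n 1. odd_cols 1 f} = {}" by blast+
qed

lemma typeIII_1_lhs: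
  fixes x :: "nat \<Rightarrow> 'a::comm_ring_1"
  shows "typeIIIa_lhs n 1 (\<lambda>i. - x i) + typeIIIb_lhs n 1 (\<lambda>i. - x i) = littlewood_lhs n x"
proof -
  let ?x = "\<lambda>i. - x i"
  have "sum_all n 1 ?x = sum_even_cols n 1 ?x + sum_odd_cols n 1 ?x"
    unfolding sum_all_def sum_even_cols_def sum_odd_cols_def
    by (subst shapes_1_split(1)) (rule sum.union_disjoint[OF _ _ shapes_1_split(2)], simp_all)
  moreover have "sum_all n 1 ?x = (\<Prod>i<n. 1 - x i)" using prod_one_plus[of ?x n] by simp
  moreover have "prod_less n ?x = prod_less n x" by (simp add: prod_less_def)
  ultimately show ?thesis
    unfolding typeIIIa_lhs_eq typeIIIb_lhs_eq littlewood_lhs_def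
    by (simp add: distrib_left[symmetric] mult.commute)
qed

lemma conjugate_eq_iff:
  assumes "is_partition \<pi>"
  shows "Defs.conjugate \<pi> = \<pi> \<longleftrightarrow> (\<forall>i<rk \<pi>. arm \<pi> i = leg \<pi> i)"
proof
  note c = conjugate_partition[OF assms]
  show "\<forall>i<rk \<pi>. arm \<pi> i = leg \<pi> i" if "Defs.conjugate \<pi> = \<pi>" using c(5) that by metis
  show "Defs.conjugate \<pi> = \<pi>" if "\<forall>i<rk \<pi>. arm \<pi> i = leg \<pi> i"
    by (rule frob_unique[OF c(1) assms c(4)]) (use that c(5,6) in simp_all)
qed

text \<open>
  For \<open>k = 1\<close> the symbols are \<open>(\<alpha> | \<alpha>)\<close>, so the partitions are self-conjugate. Replacing \<open>x\<close> by
  \<open>-x\<close> contributes \<open>(-1) ^ boxes \<pi>\<close>, and \<open>boxes \<pi>\<close> has the parity of the rank.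
\<close>

lemma typeIII_1_rhs:
  fixes x :: "nat \<Rightarrow> 'a::comm_ring_1"
  shows "typeIIIa_rhs n 1 (\<lambda>i. - x i) + typeIIIb_rhs n 1 (\<lambda>i. - x i) = littlewood_rhs n x"
proof -
  let ?F = "shifted_frobs 0 n"
  let ?t = "\<lambda>\<pi>. (- 1) ^ ((boxes \<pi> - rk \<pi>) div 2) * schur n \<pi> (\<lambda>i. - x i)"
  have fin: "finite ?F"
    using bij_betw_finite[OF shifted_frobs_bij[of 0 n]] finite_subset[of _ "Pow {..<n}"] by auto
  have "typeIIIa_rhs n 1 (\<lambda>i. - x i) + typeIIIb_rhs n 1 (\<lambda>i. - x i) =
    (\<Sum>\<pi>\<in>{\<pi> \<in> ?F. even (rk \<pi>)}. ?t \<pi>) + (\<Sum>\<pi>\<in>{\<pi> \<in> ?F. odd (rk \<pi>)}. ?t \<pi>)"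
    by (simp add: typeIIIa_rhs_def typeIIIb_rhs_def)
  also have "\<dots> = (\<Sum>\<pi>\<in>{\<pi> \<in> ?F. even (rk \<pi>)} \<union> {\<pi> \<in> ?F. odd (rk \<pi>)}. ?t \<pi>)"
    by (rule sum.union_disjoint[symmetric]) (use fin in auto)
  also have "{\<pi> \<in> ?F. even (rk \<pi>)} \<union> {\<pi> \<in> ?F. odd (rk \<pi>)} = {\<pi>. is_partition \<pi> \<and> Defs.conjugate \<pi> = \<pi> \<and> length \<pi> \<le> n}"
  proof -
    have "\<pi> \<in> ?F \<longleftrightarrow> is_partition \<pi> \<and> Defs.conjugate \<pi> = \<pi> \<and> length \<pi> \<le> n" for \<pi>
      unfolding shifted_frobs_iff using conjugate_eq_iff[of \<pi>] by auto
    then show ?thesis by blast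
  qed
  also have "(\<Sum>\<pi>\<in>{\<pi>. is_partition \<pi> \<and> Defs.conjugate \<pi> = \<pi> \<and> length \<pi> \<le> n}. ?t \<pi>) = littlewood_rhs n x"
    unfolding littlewood_rhs_def
  proof (rule sum.cong[OF refl])
    fix \<pi> assume "\<pi> \<in> {\<pi>. is_partition \<pi> \<and> Defs.conjugate \<pi> = \<pi> \<and> length \<pi> \<le> n}"
    then have p: "is_partition \<pi>" "length \<pi> \<le> n" and c: "Defs.conjugate \<pi> = \<pi>" by auto
    then have F: "\<pi> \<in> ?F" unfolding shifted_frobs_iff using conjugate_eq_iff[of \<pi>] by simp
    define s where "s = \<Sum>(leg_set \<pi>)"
    have "int (boxes \<pi>) = int (2 * s + rk \<pi>)"
      using shifted_frobs_boxes[OF F] by (simp add: s_def)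
    then have b: "boxes \<pi> = 2 * s + rk \<pi>" by (rule of_nat_eq_iff[THEN iffD1])
    have "(- 1 :: 'a) ^ ((boxes \<pi> - rk \<pi>) div 2) * (- 1) ^ boxes \<pi> = (- 1) ^ (s + rk \<pi>)"
      unfolding b by (simp add: power_add power_mult)
    also have "s + rk \<pi> = (boxes \<pi> + rk \<pi>) div 2" unfolding b by simp
    finally show "?t \<pi> = (- 1) ^ ((boxes \<pi> + rk \<pi>) div 2) * schur n \<pi> x"
      unfolding schur_uminus by (simp only: mult.assoc[symmetric])
  qed
  finally show ?thesis .
qed

theorem theorem6p3:
  fixes k p q n :: nat
    and x y :: "nat \<Rightarrow> 'a::comm_ring_1"
  assumes "1 \<le> p" and "1 \<le> q" and "1 \<le> n"
  shows
    "typeI_lhs p q k x y = typeI_rhs p q k x y \<and>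
     (\<forall>\<mu>\<in>Par p q. boxes (pi_x k \<mu>) = boxes (pi_y k \<mu>) \<and> rk (pi_x k \<mu>) = rk (pi_y k \<mu>)) \<and>
     typeII_lhs n k x = typeII_rhs n k x \<and>
     typeIIIa_lhs n k x = typeIIIa_rhs n k x \<and>
     typeIIIb_lhs n k x = typeIIIb_rhs n k x \<and>
     (typeI_lhs p q 0 (\<lambda>i. - x i) y = dual_cauchy_lhs p q x y \<and>
      typeI_rhs p q 0 (\<lambda>i. - x i) y = dual_cauchy_rhs p q x y \<and>
      dual_cauchy_lhs p q x y = dual_cauchy_rhs p q x y) \<and>
     (typeII_lhs n 0 x = prod_le n x \<and>
      typeII_rhs n 0 x = classicalII_rhs n x \<and>
      prod_le n x = classicalII_rhs n x) \<and>
     (typeIIIa_lhs n 0 x = prod_less n x \<and> typeIIIb_lhs n 0 x = prod_less n x \<and>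
      typeIIIa_rhs n 0 x = classicalIII_rhs n x \<and> typeIIIb_rhs n 0 x = classicalIII_rhs n x \<and>
      prod_less n x = classicalIII_rhs n x) \<and>
     (typeIIIa_lhs n 1 (\<lambda>i. - x i) + typeIIIb_lhs n 1 (\<lambda>i. - x i) = littlewood_lhs n x \<and>
      typeIIIa_rhs n 1 (\<lambda>i. - x i) + typeIIIb_rhs n 1 (\<lambda>i. - x i) = littlewood_rhs n x \<and>
      littlewood_lhs n x = littlewood_rhs n x)"
proof (intro conjI ballI)
  note I = typeI_identity[OF assms(1,2)] and II = typeII_identity[OF assms(3)] and III = typeIII_identities[OF assms(3)]
  show "typeI_lhs p q k x y = typeI_rhs p q k x y" by (rule I)
  show "boxes (pi_x k \<mu>) = boxes (pi_y k \<mu>)" "rk (pi_x k \<mu>) = rk (pi_y k \<mu>)" if "\<mu> \<in> Par p q" for \<mu>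
    using pi_same_size[OF that] by auto
  show "typeII_lhs n k x = typeII_rhs n k x" by (rule II)
  show "typeIIIa_lhs n k x = typeIIIa_rhs n k x" "typeIIIb_lhs n k x = typeIIIb_rhs n k x" by (rule III)+
  show "typeI_lhs p q 0 (\<lambda>i. - x i) y = dual_cauchy_lhs p q x y"
    "typeI_rhs p q 0 (\<lambda>i. - x i) y = dual_cauchy_rhs p q x y" by (rule typeI_0)+
  show "dual_cauchy_lhs p q x y = dual_cauchy_rhs p q x y"
    unfolding typeI_0[symmetric] by (rule I)
  show "typeII_lhs n 0 x = prod_le n x" "typeII_rhs n 0 x = classicalII_rhs n x" by (rule typeII_0)+
  show "prod_le n x = classicalII_rhs n x" unfolding typeII_0[symmetric] by (rule II)
  show "typeIIIa_lhs n 0 x = prod_less n x" "typeIIIb_lhs n 0 x = prod_less n x"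
    "typeIIIa_rhs n 0 x = classicalIII_rhs n x" "typeIIIb_rhs n 0 x = classicalIII_rhs n x" by (rule typeIII_0)+
  show "prod_less n x = classicalIII_rhs n x" unfolding typeIII_0(1,3)[symmetric] by (rule III)
  show "typeIIIa_lhs n 1 (\<lambda>i. - x i) + typeIIIb_lhs n 1 (\<lambda>i. - x i) = littlewood_lhs n x" by (rule typeIII_1_lhs)
  show "typeIIIa_rhs n 1 (\<lambda>i. - x i) + typeIIIb_rhs n 1 (\<lambda>i. - x i) = littlewood_rhs n x" by (rule typeIII_1_rhs)
  show "littlewood_lhs n x = littlewood_rhs n x"
    unfolding typeIII_1_lhs[symmetric] typeIII_1_rhs[symmetric] III ..
qed

end
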